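(* Let $\alpha:\mathbb{Z}^r\hookrightarrow \mathrm{GL}(d,\mathbb{Z})$ be a $\mathbb{Z}^r$-action on $\mathbb{T}^d$ by toral automorphisms such that $\alpha^{\mathbf n}$ is irreducible for at least one $\mathbf n\in\mathbb{Z}^r$, and let $K,\sigma_i,\zeta,\Gamma,X,\psi,\tilde\psi,I,V_i,\lambda_i$ be as in the context. Let $S\subset I$, let $L_S\subset(\mathbb{R}^r)^*$ be the $\mathbb{R}$-span of $\{\lambda_j:j\in S\}$ ($L_S=\{0\}$ if $S=\emptyset$), let $\langle S\rangle\supset S$ be the set of all $i\in I$ with $\lambda_i\in L_S$, and let $V_{\langle S\rangle}=\bigoplus_{i\in\langle S\rangle}V_i$. Assume that (1) $\dim L_S\le r-2$; (2) for every $\epsilon>0$ there exists $\mathbf n\in\mathbb{Z}^r$ such that $\alpha^{\mathbf n}$ is a totally irreducible toral automorphism and $|\lambda_i(\mathbf n)|<\epsilon$ for all $i\in S$. Then for any $\epsilon>0$, a point $x\in X$ satisfies that $$\{\zeta^{\mathbf n}.x:\ \mathbf n\in\mathbb{Z}^r,\ |\lambda_i(\mathbf n)|<\epsilon\ \ \forall i\in S\}\quad\text{is dense in }X$$ if and only if $x$ is not a $V_{\langle S\rangle}$-translated torsion point. Equivalently, for any $\epsilon>0$ and $y\in\mathbb{T}^d$, the set $$\{\alpha^{\mathbf n}.y:\ \mathbf n\in\mathbb{Z}^r,\ |\lambda_i(\mathbf n)|<\epsilon\ \ \forall i\in S\}$$ is dense in $\mathbb{T}^d$ if and only if $y$ cannot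 be written as $y_*+v$ (with $v$ taken modulo $\mathbb{Z}^d$), where $y_*\in\mathbb{T}^d$ is a rational point and $v\in\tilde\psi^{-1}(V_{\langle S\rangle})$.
   Context: A toral automorphism $\phi\in\mathrm{GL}(d,\mathbb{Z})=\mathrm{Aut}(\mathbb{T}^d)$, $\mathbb{T}^d=\mathbb{R}^d/\mathbb{Z}^d$, is irreducible if there is no proper $\phi$-invariant subtorus of positive dimension in $\mathbb{T}^d$, and totally irreducible if $\phi^k$ is irreducible for every $k\ne0$. Data attached to $\alpha$. Given an injective homomorphism $\alpha:\mathbb{Z}^r\to\mathrm{GL}(d,\mathbb{Z})$, $\mathbf n\mapsto\alpha^{\mathbf n}$, such that some $\alpha^{\mathbf n}$ is irreducible, the following data always exist (a known fact) and are fixed: a number field $K$ of degree $d$ with real embeddings $\sigma_1,\dots,\sigma_{r_1}$ and conjugate pairs of complex embeddings $(\sigma_{r_1+j},\sigma_{r_1+r_2+j})$, $1\le j\le r_2$, $r_1+2r_2=d$; the embedding $\sigma=(\sigma_1,\dots,\sigma_{r_1+r_2}):K\to\mathbb{R}^{r_1}\oplus\mathbb{C}^{r_2}$ and the multiplicative action $\theta.(x_i)_i=(\sigma_i(\theta)x_i)_i$ of $K$ on $\mathbb{R}^{r_1}\oplus\mathbb{C}^{r_2}$; an injective homomorphism $\zeta:\mathbb{Z}^r\to U_K$, $\mathbf n\mapsto\zeta^{\mathbf n}$, into the group of units of $K$, with $\zeta_i^{\mathbf n}:=\sigma_i(\zeta^{\mathbf n})$, $1\le i\le d$, the eigenvalues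 of $\alpha^{\mathbf n}$ on a common eigenbasis; a cocompact lattice $\Gamma\subset\mathbb{R}^{r_1}\oplus\mathbb{C}^{r_2}$ contained in $\sigma(K)$ and preserved by multiplication by every $\zeta^{\mathbf n}$, so that $\zeta^{\mathbf n}$ acts on the compact group $X=(\mathbb{R}^{r_1}\oplus\mathbb{C}^{r_2})/\Gamma$; and a continuous group isomorphism $\psi:\mathbb{T}^d\to X$ with $\alpha^{\mathbf n}.x=\psi^{-1}(\zeta^{\mathbf n}.\psi(x))$ for all $\mathbf n,x$. The isomorphism $\psi$ lifts to an invertible real linear map $\tilde\psi:\mathbb{R}^d\to\mathbb{R}^{r_1}\oplus\mathbb{C}^{r_2}$ with $\tilde\psi(\mathbb{Z}^d)=\Gamma$. Notation: $I=\{1,\dots,r_1+r_2\}$; $V_i$ is the $i$-th summand of $\mathbb{R}^{r_1}\oplus\mathbb{C}^{r_2}$ ($\cong\mathbb{R}$ if $i\le r_1$, $\cong\mathbb{C}$ if $i>r_1$). The Lyapunov functional $\lambda_i(\mathbf n)=\log|\zeta_i^{\mathbf n}|$, $i\in I$, is a homomorphism $\mathbb{Z}^r\to\mathbb{R}$, extended linearly to an element of $(\mathbb{R}^r)^*$. For a real subspace $V\subset\mathbb{R}^{r_1}\oplus\mathbb{C}^{r_2}$, a $V$-translated torsion point of $X$ is a point of the form $x_*+v$ with $x_*\in X$ a torsion point and $v\in V$ (taken modulo $\Gamma$). *)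

theory Defs
  imports "HOL-Analysis.Analysis" "HOL-Algebra.Coset"
begin

subsection \<open>Quotients of a real vector space by a subgroup\<close>

definition additive_group :: "'a::ab_group_add set \<Rightarrow> 'a monoid" where
  "additive_group A = \<lparr>carrier = A, mult = (+), one = 0\<rparr>"

definition quotient_group :: "'a::ab_group_add set \<Rightarrow> 'a set \<Rightarrow> 'a set monoid" where
  "quotient_group V \<Gamma> = additive_group V Mod \<Gamma>"

definition coset_proj :: "'a::ab_group_add set \<Rightarrow> 'a set \<Rightarrow> 'a \<Rightarrow> 'a set" where
  "coset_proj V \<Gamma> x = \<Gamma> #>\<^bsub>additive_group V\<^esub> x"

definition quotient_topology :: "'a::{ab_group_add,topological_space} set \<Rightarrow> 'a set \<Rightarrow> 'a set topology" where
  "quotient_topology V \<Gamma> =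
     topology (\<lambda>U. U \<subseteq> coset_proj V \<Gamma> ` V \<and> openin (top_of_set V) {x \<in> V. coset_proj V \<Gamma> x \<in> U})"

lemma openin_quotient_topology:
  "openin (quotient_topology V \<Gamma>) U \<longleftrightarrow>
     U \<subseteq> coset_proj V \<Gamma> ` V \<and> openin (top_of_set V) {x \<in> V. coset_proj V \<Gamma> x \<in> U}"
proof -
  let ?P = "\<lambda>U. U \<subseteq> coset_proj V \<Gamma> ` V \<and> openin (top_of_set V) {x \<in> V. coset_proj V \<Gamma> x \<in> U}"
  have "istopology ?P"
    unfolding istopology_def
  proof (rule conjI; intro allI impI)
    fix S T assume S: "?P S" and T: "?P T"
    have "{x \<in> V. coset_proj V \<Gamma> x \<in> S \<inter> T} = {x \<in> V. coset_proj V \<Gamma> x \<in> S} \<inter> {x \<in> V. coset_proj V \<Gamma> x \<in> T}"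
      by auto
    with S T show "?P (S \<inter> T)" by auto
  next
    fix \<K> assume K: "\<forall>S\<in>\<K>. ?P S"
    have "{x \<in> V. coset_proj V \<Gamma> x \<in> \<Union>\<K>} = (\<Union>S\<in>\<K>. {x \<in> V. coset_proj V \<Gamma> x \<in> S})"
      by auto
    with K show "?P (\<Union>\<K>)" by (auto intro!: openin_Union)
  qed
  then show ?thesis
    unfolding quotient_topology_def by (simp add: topology_inverse')
qed

lemma topspace_quotient_topology: "topspace (quotient_topology V \<Gamma>) = coset_proj V \<Gamma> ` V"
proof -
  have "{x \<in> V. coset_proj V \<Gamma> x \<in> coset_proj V \<Gamma> ` V} = V" by auto
  then have "openin (quotient_topology V \<Gamma>) (coset_proj V \<Gamma> ` V)"
    by (simp add: openin_quotient_topology)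
  then show ?thesis
    by (meson openin_quotient_topology openin_subset openin_topspace subset_antisym)
qed

lemma carrier_quotient_group: "carrier (quotient_group V \<Gamma>) = topspace (quotient_topology V \<Gamma>)"
  by (auto simp: topspace_quotient_topology quotient_group_def carrier_FactGroup
      coset_proj_def[abs_def] additive_group_def)

definition torsion_point :: "('a, 'b) monoid_scheme \<Rightarrow> 'a \<Rightarrow> bool" where
  "torsion_point G x \<longleftrightarrow> x \<in> carrier G \<and> (\<exists>n>0. x [^]\<^bsub>G\<^esub> (n::nat) = \<one>\<^bsub>G\<^esub>)"

text \<open>A \<open>W\<close>-translated torsion point of \<open>V/\<Gamma>\<close>, for a subspace \<open>W\<close> of \<open>V\<close>.\<close>
definition translated_torsion_point ::
    "'a::ab_group_add set \<Rightarrow> 'a set \<Rightarrow> 'a set \<Rightarrow> 'a set \<Rightarrow> bool" where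
  "translated_torsion_point V \<Gamma> W x \<longleftrightarrow>
     (\<exists>x0 v. torsion_point (quotient_group V \<Gamma>) x0 \<and> v \<in> W \<and>
        x = x0 \<otimes>\<^bsub>quotient_group V \<Gamma>\<^esub> coset_proj V \<Gamma> v)"


subsection \<open>The torus and its automorphisms\<close>

definition int_lattice :: "(real^'d) set" where
  "int_lattice = {x. \<forall>j. x $ j \<in> \<int>}"

definition vec_of_int :: "int^'n \<Rightarrow> real^'n" where
  "vec_of_int n = (\<chi> j. real_of_int (n $ j))"

abbreviation torus :: "(real^'d) set monoid" where
  "torus \<equiv> quotient_group UNIV int_lattice"

abbreviation torus_topology :: "(real^'d) set topology" where
  "torus_topology \<equiv> quotient_topology UNIV int_lattice"

abbreviation torus_proj :: "real^'d \<Rightarrow> (real^'d) set" where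
  "torus_proj \<equiv> coset_proj UNIV int_lattice"

definition rational_point :: "(real^'d) set \<Rightarrow> bool" where
  "rational_point y \<longleftrightarrow> (\<exists>q. (\<forall>j. q $ j \<in> \<rat>) \<and> y = torus_proj q)"

text \<open>Powers in \<open>GL(d, \<int>)\<close> are taken in this group; the power operation of the type class
  on vectors would be componentwise.\<close>
definition GL :: "(int^'d^'d) monoid" where
  "GL = \<lparr>carrier = {A. invertible A}, mult = (**), one = mat 1\<rparr>"

text \<open>Points of the torus are cosets, on which a matrix acts by taking images.\<close>
definition torus_act :: "int^'d^'d \<Rightarrow> (real^'d) set \<Rightarrow> (real^'d) set" where
  "torus_act A y = (\<lambda>x. map_matrix real_of_int A *v x) ` y"

definition subtorus :: "(real^'d) set set \<Rightarrow> bool" where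
  "subtorus H \<longleftrightarrow> subgroup H torus \<and> closedin torus_topology H \<and> connectedin torus_topology H"

text \<open>The dimension of a subtorus is that of its Lie algebra.\<close>
definition subtorus_dim :: "(real^'d) set set \<Rightarrow> nat" where
  "subtorus_dim H = dim {v. \<forall>t::real. torus_proj (t *\<^sub>R v) \<in> H}"

definition irreducible_automorphism :: "int^'d^'d \<Rightarrow> bool" where
  "irreducible_automorphism A \<longleftrightarrow> A \<in> carrier GL \<and>
     \<not> (\<exists>H. subtorus H \<and> H \<noteq> carrier torus \<and> 0 < subtorus_dim H \<and> torus_act A ` H \<subseteq> H)"

definition totally_irreducible_automorphism :: "int^'d^'d \<Rightarrow> bool" where
  "totally_irreducible_automorphism A \<longleftrightarrow> A \<in> carrier GL \<and>
     (\<forall>k::int. k \<noteq> 0 \<longrightarrow> irreducible_automorphism (A [^]\<^bsub>GL\<^esub> k))"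


subsection \<open>Number fields\<close>

text \<open>\<open>dim\<close> is \<open>0\<close> for infinite-dimensional spaces, so a type of positive degree
  is a number field.\<close>
definition degree_over_rat :: "'k::field_char_0 itself \<Rightarrow> nat" where
  "degree_over_rat _ = vector_space.dim (\<lambda>(q::rat) (x::'k). of_rat q * x) UNIV"

definition field_embedding :: "('k::field \<Rightarrow> complex) \<Rightarrow> bool" where
  "field_embedding \<tau> \<longleftrightarrow> \<tau> 1 = 1 \<and>
     (\<forall>x y. \<tau> (x + y) = \<tau> x + \<tau> y) \<and> (\<forall>x y. \<tau> (x * y) = \<tau> x * \<tau> y)"

definition unit_group :: "'k::field_char_0 monoid" where
  "unit_group = \<lparr>carrier = {u. u \<noteq> 0 \<and> algebraic_int u \<and> algebraic_int (inverse u)},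
                 mult = (*), one = 1\<rparr>"

text \<open>The space \<open>\<real>\<^sup>r\<^sup>1 \<oplus> \<complex>\<^sup>r\<^sup>2\<close> is realised inside \<open>complex^'i\<close>, where \<open>'i\<close> has \<open>r1 + r2\<close>
  elements and \<open>R\<close> is the set of the \<open>r1\<close> real places.\<close>
definition minkowski_space :: "'i::finite set \<Rightarrow> (complex^'i) set" where
  "minkowski_space R = {x. \<forall>i\<in>R. x $ i \<in> \<real>}"

definition coordinate_subspace :: "'i::finite set \<Rightarrow> 'i set \<Rightarrow> (complex^'i) set" where
  "coordinate_subspace R J = {x \<in> minkowski_space R. \<forall>i. i \<notin> J \<longrightarrow> x $ i = 0}"

definition minkowski_embedding :: "('i::finite \<Rightarrow> 'k \<Rightarrow> complex) \<Rightarrow> 'k \<Rightarrow> complex^'i" where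
  "minkowski_embedding \<sigma> \<theta> = (\<chi> i. \<sigma> i \<theta>)"

definition field_act :: "('i::finite \<Rightarrow> 'k \<Rightarrow> complex) \<Rightarrow> 'k \<Rightarrow> complex^'i \<Rightarrow> complex^'i" where
  "field_act \<sigma> \<theta> x = (\<chi> i. \<sigma> i \<theta> * x $ i)"


subsection \<open>The data attached to an action by toral automorphisms\<close>

text \<open>One embedding out of each conjugate pair of complex embeddings is listed by \<open>\<sigma>\<close>; the
  other one is its complex conjugate.\<close>
locale toral_action_data =
  fixes \<alpha> :: "int^'r \<Rightarrow> int^'d^'d"
    and R :: "'i::finite set"
    and \<sigma> :: "'i \<Rightarrow> 'k::field_char_0 \<Rightarrow> complex"
    and \<zeta> :: "int^'r \<Rightarrow> 'k"
    and \<Gamma> :: "(complex^'i) set"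
    and \<psi> :: "(real^'d) set \<Rightarrow> (complex^'i) set"
    and \<psi>l :: "real^'d \<Rightarrow> complex^'i"
  assumes degree: "degree_over_rat TYPE('k) = CARD('d)"
    and signature: "card R + 2 * card (- R) = CARD('d)"
    and embeddings: "{\<tau>. field_embedding \<tau>} = range \<sigma> \<union> (\<lambda>i. cnj \<circ> \<sigma> i) ` (- R)"
    and inj_embeddings: "inj \<sigma>"
    and real_embeddings: "\<And>i. i \<in> R \<Longrightarrow> range (\<sigma> i) \<subseteq> \<real>"
    and complex_embeddings: "\<And>i. i \<notin> R \<Longrightarrow> \<not> range (\<sigma> i) \<subseteq> \<real>"
    and non_conjugate: "\<And>i j. \<lbrakk>i \<notin> R; j \<notin> R\<rbrakk> \<Longrightarrow> \<sigma> i \<noteq> cnj \<circ> \<sigma> j"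
    and zeta_hom: "\<zeta> \<in> hom (additive_group UNIV) unit_group"
    and zeta_inj: "inj \<zeta>"
    and eigenbasis: "\<exists>w :: ('k \<Rightarrow> complex) \<Rightarrow> complex^'d.
          inj_on w {\<tau>. field_embedding \<tau>} \<and>
          vec.independent (w ` {\<tau>. field_embedding \<tau>}) \<and>
          vec.span (w ` {\<tau>. field_embedding \<tau>}) = UNIV \<and>
          (\<forall>\<tau> n. field_embedding \<tau> \<longrightarrow> map_matrix of_int (\<alpha> n) *v w \<tau> = \<tau> (\<zeta> n) *s w \<tau>)"
    and lattice_subgroup: "subgroup \<Gamma> (additive_group (minkowski_space R))"
    and lattice_discrete: "discrete \<Gamma>"
    and lattice_cocompact: "compact_space (quotient_topology (minkowski_space R) \<Gamma>)"
    and lattice_algebraic: "\<Gamma> \<subseteq> range (minkowski_embedding \<sigma>)"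
    and lattice_invariant: "\<And>n. field_act \<sigma> (\<zeta> n) ` \<Gamma> \<subseteq> \<Gamma>"
    and psi_iso: "\<psi> \<in> iso torus (quotient_group (minkowski_space R) \<Gamma>)"
    and psi_continuous:
          "continuous_map torus_topology (quotient_topology (minkowski_space R) \<Gamma>) \<psi>"
    and psi_equivariant: "\<And>n x. x \<in> carrier torus \<Longrightarrow>
          torus_act (\<alpha> n) x = inv_into (carrier torus) \<psi> (field_act \<sigma> (\<zeta> n) ` \<psi> x)"
    and lift_linear: "linear \<psi>l"
    and lift_bij: "bij_betw \<psi>l UNIV (minkowski_space R)"
    and lift_lattice: "\<psi>l ` int_lattice = \<Gamma>"
    and lift_psi: "\<And>x. \<psi> (torus_proj x) = coset_proj (minkowski_space R) \<Gamma> (\<psi>l x)"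

definition lyapunov :: "('i \<Rightarrow> 'k \<Rightarrow> complex) \<Rightarrow> (int^'r \<Rightarrow> 'k) \<Rightarrow> 'i \<Rightarrow> int^'r \<Rightarrow> real" where
  "lyapunov \<sigma> \<zeta> i n = ln (cmod (\<sigma> i (\<zeta> n)))"

text \<open>The linear extension of a homomorphism to an element of the dual space, which is the type
  of bounded linear functionals.\<close>
definition linear_extension :: "(int^'r \<Rightarrow> real) \<Rightarrow> ((real^'r) \<Rightarrow>\<^sub>L real)" where
  "linear_extension f = (THE L. \<forall>n. blinfun_apply L (vec_of_int n) = f n)"

lemma linear_extension:
  fixes f :: "int^'r \<Rightarrow> real"
  assumes add: "\<And>m n. f (m + n) = f m + f n"
  shows "blinfun_apply (linear_extension f) (vec_of_int n) = f n"
proof -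
  define g where "g = (\<lambda>x::real^'r. \<Sum>j\<in>UNIV. x $ j * f (axis j 1))"
  have "linear g"
    unfolding g_def by (rule linearI) (simp_all add: algebra_simps sum.distrib sum_distrib_left)
  then have bl: "bounded_linear g" by (rule linear_conv_bounded_linear[THEN iffD1])
  have f0: "f 0 = 0" using add[of 0 0] by simp
  have fm: "f (- m) = - f m" for m using add[of m "- m"] f0 by simp
  have fnat: "f (of_nat k *s m) = real k * f m" for k m
    by (induction k) (simp_all add: f0 add vector_sadd_rdistrib algebra_simps)
  have fint: "f (k *s m) = real_of_int k * f m" for k m
  proof (cases k rule: int_cases2)
    case (nonneg l) then show ?thesis using fnat[of l m] by simp
  next
    case (nonpos l)
    have "k *s m = - (of_nat l *s m)" by (simp add: nonpos vec_eq_iff)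
    then show ?thesis using fnat[of l m] fm by (simp add: nonpos)
  qed
  have fsum: "f (\<Sum>j\<in>A. h j) = (\<Sum>j\<in>A. f (h j))" if "finite A" for A and h :: "'r \<Rightarrow> int^'r"
    using that by (induction A) (simp_all add: f0 add)
  have gf: "g (vec_of_int n) = f n" for n
  proof -
    have "n = (\<Sum>j\<in>UNIV. n $ j *s axis j 1)"
      by (simp add: vec_eq_iff axis_def if_distrib[of "\<lambda>x. _ * x"] sum.delta cong: if_cong)
    then have "f n = (\<Sum>j\<in>UNIV. f (n $ j *s axis j 1))" 
      using fsum[of UNIV "\<lambda>j. n $ j *s axis j 1"] by (metis finite)
    then show ?thesis by (simp add: fint g_def vec_of_int_def)
  qed
  have "\<exists>!L. \<forall>n. blinfun_apply L (vec_of_int n) = f n"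
  proof (rule ex1I)
    show "\<forall>n. blinfun_apply (Blinfun g) (vec_of_int n) = f n"
      by (simp add: bounded_linear_Blinfun_apply[OF bl] gf)
  next
    fix L assume L: "\<forall>n. blinfun_apply L (vec_of_int n) = f n"
    show "L = Blinfun g"
    proof (rule blinfun_euclidean_eqI)
      fix b :: "real^'r" assume "b \<in> Basis"
      then obtain j where "b = axis j 1" by (auto simp: Basis_vec_def)
      then have b: "b = vec_of_int (axis j 1)" by (simp add: vec_of_int_def vec_eq_iff axis_def)
      show "blinfun_apply L b = blinfun_apply (Blinfun g) b"
        using L by (simp add: b bounded_linear_Blinfun_apply[OF bl] gf)
    qed
  qed
  from theI'[OF this] show ?thesis unfolding linear_extension_def by blast
qed

definition lyapunov_span :: "('i \<Rightarrow> 'k \<Rightarrow> complex) \<Rightarrow> (int^'r \<Rightarrow> 'k) \<Rightarrow> 'i set \<Rightarrow> ((real^'r) \<Rightarrow>\<^sub>L real) set" where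
  "lyapunov_span \<sigma> \<zeta> S = span ((\<lambda>j. linear_extension (lyapunov \<sigma> \<zeta> j)) ` S)"

definition lyapunov_closure :: "('i \<Rightarrow> 'k \<Rightarrow> complex) \<Rightarrow> (int^'r \<Rightarrow> 'k) \<Rightarrow> 'i set \<Rightarrow> 'i set" where
  "lyapunov_closure \<sigma> \<zeta> S = {i. linear_extension (lyapunov \<sigma> \<zeta> i) \<in> lyapunov_span \<sigma> \<zeta> S}"

lemma (in toral_action_data) lyapunov_add:
  "lyapunov \<sigma> \<zeta> i (m + n) = lyapunov \<sigma> \<zeta> i m + lyapunov \<sigma> \<zeta> i n"
proof -
  have emb: "field_embedding (\<sigma> i)" using embeddings by blast
  have z: "\<zeta> (m + n) = \<zeta> m * \<zeta> n"
    using zeta_hom by (simp add: hom_def additive_group_def unit_group_def)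
  have nz: "\<sigma> i (\<zeta> k) \<noteq> 0" for k
  proof
    assume 0: "\<sigma> i (\<zeta> k) = 0"
    have "\<zeta> k \<noteq> 0" using zeta_hom by (auto simp: hom_def additive_group_def unit_group_def Pi_def)
    then have "\<sigma> i (\<zeta> k * inverse (\<zeta> k)) = 1" using emb by (simp add: field_embedding_def)
    then show False using emb 0 by (simp add: field_embedding_def)
  qed
  have "\<sigma> i (\<zeta> (m + n)) = \<sigma> i (\<zeta> m) * \<sigma> i (\<zeta> n)" using emb z by (simp add: field_embedding_def)
  then show ?thesis using nz by (simp add: lyapunov_def norm_mult ln_mult)
qed

end

(*
The idea is Furstenberg's. Record the Lyapunov data of S in a second coordinate: Z^r acts on
T^d x R^S by n.(x, t) = (alpha^n x, t + (lambda_i(n))_{i in S}), and density of the partial orbits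
of x for every epsilon amounts to the closure N of the orbit of (x, 0) containing T^d x {0}.

(1) If an invariant closed set M contains points approaching V_<S> from outside, then M contains
a whole fibre. Expanding the small transverse components inside the common kernel of the lambda_i,
i in S, which has dimension at least 2, and then contracting again, one reaches a point of M whose
transverse components live on places with Lyapunov functionals proportional modulo L_S. So some
direction of R^r acts on all these places almost isometrically, and there are elements m of Z^r
acting almost trivially on them; the points alpha^(n+jm), j = 0, 1, ..., of this point then trace
out an arithmetic progression, in the limit a half-line, in M. The images of the half-line under a
bounded number of powers of a totally irreducible, almost isometric element contain, for each eta,
an eta-dense one, because a rational subspace avoids some of these powers of any finite set of
characters.

(2) If (x, t) in M and x is not a translated torsion point, then the fibrewise difference set of M
accumulates at V_<S> from outside, so by (1) it contains a whole fibre: otherwise, for small m,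
two of the points alpha^(jm) x with bounded j would differ by an element of V_<S>, making x a
translated torsion point.

(3) If N contains a translated torsion point, (1) applied to a congruence subgroup finishes the
proof. If not, (2) shows that the intersections of N with its translates by N0-torsion points are
nonempty, so that N contains a whole coset of the N0-torsion in some fibre, for every N0.
*)
theory Submission
  imports Defs
begin

text \<open>The n with |\<lambda>_i(n)| < \<epsilon> do not form a group, so a partial orbit has no
  invariance of its own; with the extra coordinate t the whole group acts again, at the price of a
  non-compact factor. Every limit therefore needs a bound on t, and long motions are only possible
  along the common kernel of the functionals, followed by lattice points up to a bounded rounding
  error. Components over the places of <S> are neither expanded nor contracted by such motions,
  which is why V_<S> is the exceptional subspace.

  The totally irreducible element is available only as an almost isometric one that depends on the
  error allowed, so it cannot be fixed in advance. This forces uniform versions of two classical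
  facts: the box of characters in Kronecker's theorem depends only on \<eta> and the dimension, and
  the number of powers needed to leave a rational subspace depends only on that box, not on the
  element or the subspace. Only afterwards is the element chosen, so close to isometric on S that
  all these powers hardly move t.\<close>

subsection \<open>Kronecker's theorem with finitely many characters\<close>

text \<open>A positive kernel that peaks at t = 0, decays geometrically in \<open>R\<close> away
  from the peak and has only frequencies of absolute value at most \<open>R\<close>. The expansion
  is the binomial theorem for (1 + cos t) / 2 = e^(-it) (1 + e^(it))^2 / 4; the index
  \<open>k = R\<close> carries the constant term.\<close>

lemma half_one_plus_cos_power:
  "complex_of_real (((1 + cos t) / 2) ^ R) =
     (\<Sum>k\<le>2*R. of_real (real (2*R choose k) / 4^R) * cis ((real k - real R) * t))"
proof -
  have sq: "(1 + cis t)^2 = 2 * cis t * of_real (1 + cos t)"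
    using sin_cos_squared_add[of t] by (simp add: complex_eq_iff power2_eq_square algebra_simps)
  then have eq: "complex_of_real ((1 + cos t) / 2) = cis (- t) * (1 + cis t)^2 / 4"
    by (simp add: sq) (simp flip: mult.assoc add: cis_mult)
  have "complex_of_real (((1 + cos t) / 2) ^ R) = cis (- (real R * t)) * (1 + cis t)^(2*R) / 4^R"
    unfolding of_real_power eq by (simp add: power_divide power_mult_distrib power_mult Complex.DeMoivre)
  also have "(1 + cis t)^(2*R) = (\<Sum>k\<le>2*R. of_nat (2*R choose k) * cis (real k * t))"
    by (subst add.commute, subst binomial_ring) (simp add: Complex.DeMoivre)
  finally show ?thesis
    by (simp add: sum_distrib_left sum_divide_distrib)
      (rule sum.cong, auto simp: algebra_simps cis_mult simp flip: mult.assoc)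
qed

text \<open>Weyl's estimate for one frequency: the geometric sum stays below 2 / |1 - w| while the
  divisor \<open>J\<close> grows.\<close>

lemma cis_average_tendsto_0:
  assumes "a \<notin> \<int>"
  shows "(\<lambda>J. (\<Sum>j<J. cis (2 * pi * (real j * a))) / of_nat J) \<longlonglongrightarrow> 0"
proof -
  define w where "w = cis (2 * pi * a)"
  have w: "w \<noteq> 1"
  proof
    assume "w = 1"
    then have "cos (2*pi*a) = 1" by (metis w_def cis.simps(1) one_complex.simps(1))
    then obtain n :: int where "2*pi*a = of_int n * 2 * pi" using cos_one_2pi_int by blast
    then have "a = of_int n" by simp
    with assms show False by simp
  qed
  have s: "(\<Sum>j<J. cis (2 * pi * (real j * a))) = (1 - w^J) / (1 - w)" for J
  proof -
    have "cis (2 * pi * (real j * a)) = w ^ j" for j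
      by (simp add: w_def Complex.DeMoivre algebra_simps)
    then show ?thesis using w by (simp add: geometric_sum field_simps)
  qed
  have b: "norm ((\<Sum>j<J. cis (2 * pi * (real j * a))) / of_nat J) \<le> (2 / norm (1 - w)) * (1 / real J)" for J
  proof -
    have "norm (1 - w^J) \<le> 2"
      using norm_triangle_ineq4[of 1 "w^J"] by (simp add: w_def norm_power)
    then have "norm (1 - w^J) / (norm (1 - w) * real J) \<le> 2 / (norm (1 - w) * real J)"
      by (intro divide_right_mono) auto
    then show ?thesis unfolding s by (simp add: norm_divide norm_mult)
  qed
  have "(\<lambda>J. (2 / norm (1 - w)) * (1 / real J)) \<longlonglongrightarrow> 0"
    using tendsto_mult[OF tendsto_const lim_1_over_n, of "2 / norm (1 - w)"] by simp
  from tendsto_0_le[OF this, of _ 1] show ?thesis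
    using b by (intro tendsto_norm_zero_cancel[OF tendsto_sandwich[OF _ _ tendsto_const \<open>(\<lambda>J. (2 / norm (1 - w))
        * (1 / real J)) \<longlonglongrightarrow> 0\<close>]]) (auto intro: always_eventually)
qed

text \<open>Selects the degree of the kernel in \<open>kronecker_int_lattice\<close>: there the mean
  is at least (2R)^(-d), the values away from the lattice are at most c^R, and this \<open>R\<close>
  makes the two incompatible.\<close>

lemma poly_times_geometric_lt_1:
  fixes c :: real assumes "0 \<le> c" "c < 1"
  shows "\<exists>R>0. (2 * real R)^d * c^R < 1"
proof -
  have "(\<lambda>R. (2 * real R)^d * c^R) \<longlonglongrightarrow> 0"
  proof (cases "c = 0")
    case True
    have "\<forall>\<^sub>F R in sequentially. (2 * real R)^d * c^R = 0"
      using eventually_gt_at_top[of 0] by eventually_elim (simp add: True)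
    then show ?thesis by (rule tendsto_eventually)
  next
    case False
    with assms have c: "c > 0" by simp
    obtain q where q: "c = exp (-q)" "q > 0"
      using c assms by (metis exp_ln ln_less_zero minus_minus neg_0_less_iff_less)
    have "((\<lambda>x::real. x ^ d / exp x) \<longlongrightarrow> 0) at_top" by (rule tendsto_power_div_exp_0)
    moreover have "filterlim (\<lambda>R::nat. q * real R) at_top sequentially"
      using q by (intro filterlim_tendsto_pos_mult_at_top[OF tendsto_const] filterlim_real_sequentially)
    ultimately have "(\<lambda>R::nat. (q * real R) ^ d / exp (q * real R)) \<longlonglongrightarrow> 0"
      by (rule filterlim_compose)
    from tendsto_mult[OF tendsto_const[of "(2/q)^d"] this]
    have "(\<lambda>R::nat. (2/q)^d * ((q * real R) ^ d / exp (q * real R))) \<longlonglongrightarrow> 0" by simp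
    moreover have "(2/q)^d * ((q * real R) ^ d / exp (q * real R)) = (2 * real R)^d * c^R" for R
    proof -
      have "c ^ R = exp (- (q * real R))" by (simp add: q(1) algebra_simps flip: exp_of_nat_mult)
      then have "c ^ R * exp (q * real R) = 1" by (simp flip: exp_add)
      then show ?thesis using q(2) by (simp add: power_mult_distrib power_divide field_simps)
    qed
    ultimately show ?thesis by simp
  qed
  then have "\<forall>\<^sub>F R in sequentially. (2 * real R)^d * c^R < 1" by (rule order_tendstoD) simp
  then have "\<forall>\<^sub>F R in sequentially. (2 * real R)^d * c^R < 1 \<and> R > 0"
    using eventually_gt_at_top[of 0] by (rule eventually_conj)
  then show ?thesis by (metis (no_types, lifting) eventually_sequentially le_refl)
qed
text \<open>Averaging the product kernel \<open>G\<close> along the progression isolates its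
  constant coefficient, since no other frequency of the box resonates with \<open>g\<close>. If the
  progression stayed \<open>eta\<close>-away from the lattice, all values of \<open>G\<close> would
  be at most c^R, which is below that coefficient. \<open>R\<close> precedes \<open>g\<close> and
  \<open>y\<close> in the quantifiers; \<open>half_line_fills\<close> relies on this, as its
  \<open>g\<close> is built from \<open>R\<close>.\<close>

lemma kronecker_int_lattice:
  assumes eta: "eta > 0"
  obtains R :: nat where
    "\<And>g y :: real^'d. (\<And>b. b \<in> int_lattice \<Longrightarrow> b \<noteq> 0 \<Longrightarrow> \<forall>i. \<bar>b $ i\<bar> \<le> real R \<Longrightarrow> b \<bullet> g \<notin> \<int>) \<Longrightarrow>
       \<exists>j::nat. \<exists>\<gamma>\<in>int_lattice. norm (y + real j *\<^sub>R g - \<gamma>) < eta"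
proof -
  \<comment> \<open>A vector at distance \<open>eta\<close> from the lattice has a coordinate at
    least \<open>eta / CARD('d)\<close> away from the nearest integer. The cap 1/2 keeps 2 pi e in
    [0, pi], where cosine decreases.\<close>
  define e where "e = min (eta / real CARD('d)) (1/2)"
  have e: "0 < e" "e \<le> 1/2" unfolding e_def using eta by (simp, intro min.cobounded2)
  define c where "c = (1 + cos (2 * pi * e)) / 2"
  have "cos (2*pi*e) < cos 0" using e by (intro cos_monotone_0_pi) auto
  then have c: "0 \<le> c" "c < 1" using cos_ge_minus_one[of "2*pi*e"]
    by (auto simp: c_def simp del: cos_ge_minus_one)
  from poly_times_geometric_lt_1[OF c] obtain R where R: "R > 0" "(2 * real R)^CARD('d) * c^R < 1" by blast
  show ?thesis
  proof (rule that[of R], rule ccontr)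
    fix g y :: "real^'d"
    assume nz: "\<And>b. b \<in> int_lattice \<Longrightarrow> b \<noteq> 0 \<Longrightarrow> \<forall>i. \<bar>b $ i\<bar> \<le> real R \<Longrightarrow> b \<bullet> g \<notin> \<int>"
    assume far: "\<not> (\<exists>j::nat. \<exists>\<gamma>\<in>int_lattice. norm (y + real j *\<^sub>R g - \<gamma>) < eta)"
    define G where "G = (\<lambda>x::real^'d. \<Prod>i\<in>UNIV. ((1 + cos (2 * pi * x $ i)) / 2)^R)"
    define F where "F = PiE (UNIV::'d set) (\<lambda>_. {..2*R})"
    have finF: "finite F" unfolding F_def by (intro finite_PiE) auto
    define cf where "cf = (\<lambda>f::'d\<Rightarrow>nat. \<Prod>i\<in>UNIV. real (2*R choose f i) / 4^R)"
    define bf where "bf = (\<lambda>f::'d\<Rightarrow>nat. (\<chi> i. real (f i) - real R) :: real^'d)"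
    have G: "complex_of_real (G x) = (\<Sum>f\<in>F. of_real (cf f) * cis (2 * pi * (bf f \<bullet> x)))" for x
    proof -
      have cisprod: "(\<Prod>i\<in>A. cis (h i)) = cis (\<Sum>i\<in>A. h i)" if "finite A" for A :: "'d set" and h
        using that by induction (auto simp: cis_mult)
      have "complex_of_real (G x) = (\<Prod>i\<in>UNIV. \<Sum>k\<in>{..2*R}. of_real (real (2*R choose k) / 4^R) * cis ((real k
          - real R) * (2 * pi * x $ i)))"
        unfolding G_def of_real_prod half_one_plus_cos_power by simp
      also have "\<dots> = (\<Sum>f\<in>F. \<Prod>i\<in>UNIV. of_real (real (2*R choose f i) / 4^R) * cis ((real (f i)
          - real R) * (2 * pi * x $ i)))"
        unfolding F_def by (subst prod_sum_PiE) auto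
      also have "\<dots> = (\<Sum>f\<in>F. of_real (cf f) * cis (2 * pi * (bf f \<bullet> x)))"
      proof (intro sum.cong refl)
        fix f :: "'d \<Rightarrow> nat"
        have "(\<Sum>i\<in>UNIV. (real (f i) - real R) * (2 * pi * x $ i)) = 2 * pi * (bf f \<bullet> x)"
          by (simp add: bf_def inner_vec_def sum_distrib_left algebra_simps)
        then show "(\<Prod>i\<in>UNIV. of_real (real (2*R choose f i) / 4^R) * cis ((real (f i)
            - real R) * (2 * pi * x $ i)))
            = of_real (cf f) * cis (2 * pi * (bf f \<bullet> x))"
          by (simp only: prod.distrib cisprod[OF finite] of_real_prod cf_def)
      qed
      finally show ?thesis .
    qed
    have le: "G (y + real j *\<^sub>R g) \<le> c^R" for j
    proof -
      define x where "x = y + real j *\<^sub>R g"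
      define \<gamma> where "\<gamma> = (\<chi> i. of_int (round (x $ i)) :: real^'d)"
      have "\<gamma> \<in> int_lattice" by (simp add: \<gamma>_def int_lattice_def)
      then have "eta \<le> norm (x - \<gamma>)" using far unfolding x_def by (meson not_less)
      also have "\<dots> \<le> (\<Sum>i\<in>UNIV. \<bar>(x - \<gamma>) $ i\<bar>)" by (rule norm_le_l1_cart)
      finally have "\<exists>i. eta / real CARD('d) \<le> \<bar>(x - \<gamma>) $ i\<bar>"
        using sum_bounded_above_strict[of UNIV "\<lambda>i. \<bar>(x - \<gamma>) $ i\<bar>" "eta / real CARD('d)"]
        by (force simp: not_le)
      then obtain i where i: "e \<le> \<bar>(x - \<gamma>) $ i\<bar>" unfolding e_def by (metis min.coboundedI1)
      have h: "\<bar>(x - \<gamma>) $ i\<bar> \<le> 1/2"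
        using of_int_round_abs_le[of "x $ i"] by (simp add: \<gamma>_def abs_minus_commute)
      have "cos (2 * pi * x $ i) = cos (2 * pi * (x - \<gamma>) $ i)"
        using cos_diff[of "2*pi*x$i" "2 * pi * of_int (round (x$i))"] sin_int_2pin cos_int_2pin
        by (simp add: \<gamma>_def right_diff_distrib)
      also have "\<dots> = cos (2 * pi * \<bar>(x - \<gamma>) $ i\<bar>)" by (metis abs_mult abs_numeral abs_of_nonneg cos_abs_real
          pi_ge_zero)
      also have "\<dots> \<le> cos (2 * pi * e)" using i h e by (intro cos_monotone_0_pi_le) auto
      finally have ci: "(1 + cos (2 * pi * x $ i)) / 2 \<le> c" by (simp add: c_def)
      have nn: "0 \<le> (1 + cos (2 * pi * x $ k)) / 2" "(1 + cos (2 * pi * x $ k)) / 2 \<le> 1" for k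
        using cos_ge_minus_one[of "2 * pi * x $ k"] cos_le_one[of "2 * pi * x $ k"]
          by (auto simp: algebra_simps simp del: cos_ge_minus_one cos_le_one)
      have "G x = ((1 + cos (2 * pi * x $ i)) / 2)^R * (\<Prod>k\<in>UNIV-{i}. ((1 + cos (2 * pi * x $ k)) / 2)^R)"
        unfolding G_def by (subst prod.remove[of _ i]) auto
      also have "\<dots> \<le> c^R * 1"
        using nn ci c by (intro mult_mono power_mono prod_le_1) (auto intro!: power_le_one prod_nonneg)
      finally show ?thesis by (simp add: x_def)
    qed
    \<comment> \<open>Of all frequencies only 0, that is \<open>f = (\<lambda>_. R)\<close>,
      survives the averaging.\<close>
    have "(\<lambda>J. \<Sum>f\<in>F. of_real (cf f) * cis (2 * pi * (bf f \<bullet> y)) * ((\<Sum>j<J. cis (2 * pi * (real j * (bf f \<bullet> g))))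
        / of_nat J))
          \<longlonglongrightarrow> (\<Sum>f\<in>F. if f = (\<lambda>_. R) then of_real (cf f) else 0)"
    proof (rule tendsto_sum)
      fix f assume f: "f \<in> F"
      show "(\<lambda>J. of_real (cf f) * cis (2 * pi * (bf f \<bullet> y)) * ((\<Sum>j<J. cis (2 * pi * (real j * (bf f \<bullet> g)))) /
          of_nat J))
         \<longlonglongrightarrow> (if f = (\<lambda>_. R) then of_real (cf f) else 0)"
      proof (cases "f = (\<lambda>_. R)")
        case True
        then have b0: "bf f = 0" by (simp add: bf_def vec_eq_iff)
        have "\<forall>\<^sub>F J in sequentially. of_real (cf f) * cis (2 * pi * (bf f \<bullet> y)) * ((\<Sum>j<J. cis (2 * pi * (real j
            * (bf f \<bullet> g)))) / of_nat J)
              = complex_of_real (cf f)"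
          using eventually_gt_at_top[of 0] by eventually_elim (simp add: b0)
        then show ?thesis using True by (simp add: tendsto_eventually)
      next
        case False
        then obtain i where "f i \<noteq> R" by auto
        then have "bf f \<noteq> 0" by (auto simp: bf_def vec_eq_iff intro!: exI[of _ i])
        moreover have "bf f \<in> int_lattice" by (simp add: bf_def int_lattice_def)
        moreover have "\<forall>i. \<bar>bf f $ i\<bar> \<le> real R"
        proof
          fix i have "f i \<le> 2*R" using f by (auto simp: F_def)
          then show "\<bar>bf f $ i\<bar> \<le> real R" by (simp add: bf_def abs_le_iff)
        qed
        ultimately have "bf f \<bullet> g \<notin> \<int>" using nz by blast
        from tendsto_mult[OF tendsto_const cis_average_tendsto_0[OF this]] show ?thesis using False by simp
      qed
    qed
    moreover have "(\<Sum>f\<in>F. of_real (cf f) * cis (2 * pi * (bf f \<bullet> y)) * ((\<Sum>j<J. cis (2 * pi * (real j * (bf f \<bullet>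
        g)))) / of_nat J))
        = complex_of_real ((\<Sum>j<J. G (y + real j *\<^sub>R g)) / real J)" for J
    proof -
      have "complex_of_real (\<Sum>j<J. G (y + real j *\<^sub>R g)) =
         (\<Sum>j<J. \<Sum>f\<in>F. of_real (cf f) * cis (2 * pi * (bf f \<bullet> y)) * cis (2 * pi * (real j * (bf f \<bullet> g))))"
        by (simp add: G inner_add_right cis_mult distrib_left mult.assoc)
      also have "\<dots> = (\<Sum>f\<in>F. \<Sum>j<J. of_real (cf f) * cis (2 * pi * (bf f \<bullet> y)) * cis (2 * pi * (real j * (bf f \<bullet>
          g))))"
        by (rule sum.swap)
      finally have s: "complex_of_real (\<Sum>j<J. G (y + real j *\<^sub>R g)) = \<dots>" .
      show ?thesis
        unfolding of_real_divide s by (simp add: sum_divide_distrib sum_distrib_left)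
    qed
    moreover have "(\<Sum>f\<in>F. if f = (\<lambda>_. R) then complex_of_real (cf f) else 0) = of_real (cf (\<lambda>_. R))"
      by (subst sum.delta[OF finF]) (auto simp: F_def)
    ultimately have "(\<lambda>J. complex_of_real ((\<Sum>j<J. G (y + real j *\<^sub>R g)) / real J)) \<longlonglongrightarrow> of_real (cf (\<lambda>_. R))"
      by simp
    then have lim: "(\<lambda>J. (\<Sum>j<J. G (y + real j *\<^sub>R g)) / real J) \<longlonglongrightarrow> cf (\<lambda>_. R)"
      unfolding tendsto_of_real_iff .
    have "cf (\<lambda>_. R) \<le> c^R"
    proof (rule LIMSEQ_le_const2[OF lim], intro exI[of _ 1] allI impI)
      fix J :: nat assume J: "1 \<le> J"
      have "(\<Sum>j<J. G (y + real j *\<^sub>R g)) \<le> of_nat (card {..<J}) * c^R" by (rule sum_bounded_above) (rule le)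
      then show "(\<Sum>j<J. G (y + real j *\<^sub>R g)) / real J \<le> c^R" using J by (simp add: divide_le_eq mult.commute)
    qed
    moreover have "(1 / (2 * real R)) ^ CARD('d) \<le> cf (\<lambda>_. R)"
    proof -
      \<comment> \<open>The central binomial coefficient is at least 4^R / (2R).\<close>
      have "1 / (2 * real R) \<le> real (2*R choose R) / 4^R"
        using central_binomial_lower_bound[OF R(1)] R(1) by (simp add: field_simps)
      then show ?thesis unfolding cf_def by (simp add: power_mono del: power_divide)
    qed
    ultimately have "(1 / (2 * real R)) ^ CARD('d) \<le> c^R" by simp
    then have "1 \<le> (2 * real R)^CARD('d) * c^R" using R(1) by (simp add: power_divide divide_le_eq mult.commute)
    then show False using R(2) by simp
  qed
qed

subsection \<open>Lattice orbits and rational subspaces\<close>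

definition rational_subspace :: "(real^'d) set \<Rightarrow> bool" where
  "rational_subspace L \<longleftrightarrow> (\<exists>T\<subseteq>int_lattice. L = span T)"

text \<open>Total irreducibility on the dual side: \<open>D\<close> will be a transposed lattice
  automorphism acting on characters, and invariant rational subspaces of characters are the
  annihilators of invariant subtori.\<close>

definition totally_irreducible_map :: "(real^'d \<Rightarrow> real^'d) \<Rightarrow> bool" where
  "totally_irreducible_map D \<longleftrightarrow> linear D \<and> D ` int_lattice \<subseteq> int_lattice \<and>
     (\<forall>k>0. \<forall>L. rational_subspace L \<and> (D ^^ k) ` L \<subseteq> L \<longrightarrow> L = {0} \<or> L = UNIV)"

text \<open>Distinct elements of \<open>F\<close> are at least \<open>J\<close> apart, so each block
  of \<open>J\<close> consecutive integers contains at most one of them.\<close>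

lemma card_spread_le:
  fixes F :: "nat set"
  assumes "F \<subseteq> {..<M}" "J > 0" and gap: "\<And>m k. m \<in> F \<Longrightarrow> 0 < k \<Longrightarrow> k < J \<Longrightarrow> m + k \<notin> F"
  shows "card F \<le> M div J + 1"
proof -
  have "inj_on (\<lambda>m. m div J) F"
  proof (rule linorder_inj_onI)
    fix m n assume mn: "m < n" "m \<in> F" "n \<in> F"
    show "m div J \<noteq> n div J"
    proof
      assume eq: "m div J = n div J"
      have "m = J * (m div J) + m mod J" "n = J * (n div J) + n mod J" by simp_all
      moreover have "m mod J < J" "n mod J < J" using assms(2) by simp_all
      moreover have "J * (m div J) = J * (n div J)" using eq by simp
      ultimately have "n - m < J" by linarith
      then show False using gap[of m "n - m"] mn by auto
    qed
  qed auto
  moreover have "(\<lambda>m. m div J) ` F \<subseteq> {..M div J}"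
    using assms(1) by (auto intro!: div_le_mono)
  ultimately have "card F \<le> card {..M div J}" by (metis card_inj_on_le finite_atMost)
  then show ?thesis by simp
qed

lemma funpow_in_int_lattice:
  fixes D :: "real^'d \<Rightarrow> real^'d"
  assumes "D ` int_lattice \<subseteq> int_lattice" "b \<in> int_lattice"
  shows "(D ^^ k) b \<in> int_lattice"
  using assms by (induction k) auto

lemma linear_funpow:
  fixes D :: "'a::real_vector \<Rightarrow> 'a"
  assumes "linear D"
  shows "linear (D ^^ k)"
proof (induction k)
  case 0
  show ?case using linear_id by (simp add: id_def)
next
  case (Suc k)
  then have "linear (D \<circ> (D ^^ k))" using assms by (intro linear_compose) auto
  then show ?case by (simp only: funpow.simps)
qed

text \<open>If many \<open>m\<close> have \<open>D\<^sup>m b \<in> L\<close>, then for some bounded \<open>k\<close> many \<open>m\<close> have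
  \<open>D\<^sup>m b \<in> L \<inter> D\<^sup>-\<^sup>k L\<close>, and total irreducibility makes the dimension drop.\<close>
lemma orbit_in_subspace_density:
  assumes "\<delta> > 0"
  shows "\<exists>M0. \<forall>M\<ge>M0. \<forall>(D :: real^'d \<Rightarrow> real^'d) b L. totally_irreducible_map D \<longrightarrow> b \<in> int_lattice \<longrightarrow>
     (\<forall>m. (D ^^ m) b \<noteq> 0) \<longrightarrow> rational_subspace L \<longrightarrow> L \<noteq> UNIV \<longrightarrow> dim L \<le> e \<longrightarrow>
     real (card {m. m < M \<and> (D ^^ m) b \<in> L}) \<le> \<delta> * real M"
  using assms
proof (induction e arbitrary: \<delta>)
  case 0
  show ?case
  proof (intro exI[of _ 0] allI impI)
    fix M and D :: "real^'d \<Rightarrow> real^'d" and b and L :: "(real^'d) set"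
    assume "\<forall>m. (D ^^ m) b \<noteq> 0" "dim L \<le> 0"
    then have "{m. m < M \<and> (D ^^ m) b \<in> L} = {}" by auto
    then show "real (card {m. m < M \<and> (D ^^ m) b \<in> L}) \<le> \<delta> * real M"
      using 0 by (simp only: card.empty) simp
  qed
next
  case (Suc e)
  \<comment> \<open>This \<open>J\<close> makes M / J at most \<delta> M / 3, and M \<ge> J makes
    the extra 1 in \<open>card_spread_le\<close> at most as much; \<delta>' is chosen so that the
    fewer than \<open>J\<close> sets \<open>E' k\<close> together cost the last third.\<close>
  define J :: nat where "J = nat \<lceil>3 / \<delta>\<rceil>"
  have J: "3 / \<delta> \<le> real J" unfolding J_def by linarith
  moreover have "0 < 3 / \<delta>" using Suc.prems by simp
  ultimately have "0 < real J" by linarith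
  then have J0: "J > 0" by simp
  define \<delta>' where "\<delta>' = \<delta> / (3 * real J)"
  have "\<delta>' > 0" using Suc.prems J0 by (simp add: \<delta>'_def)
  from Suc.IH[OF this] obtain M1 where M1: "\<And>M D b L. M1 \<le> M
      \<Longrightarrow> totally_irreducible_map (D :: real^'d \<Rightarrow> real^'d) \<Longrightarrow>
      b \<in> int_lattice \<Longrightarrow> (\<forall>m. (D ^^ m) b \<noteq> 0) \<Longrightarrow> rational_subspace L \<Longrightarrow> L \<noteq> UNIV \<Longrightarrow> dim L \<le> e \<Longrightarrow>
     real (card {m. m < M \<and> (D ^^ m) b \<in> L}) \<le> \<delta>' * real M" by blast
  show ?case
  proof (intro exI[of _ "max M1 J"] allI impI)
    fix M :: nat and D :: "real^'d \<Rightarrow> real^'d" and b and L :: "(real^'d) set"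
    assume M: "max M1 J \<le> M" and D: "totally_irreducible_map D" and b: "b \<in> int_lattice" "\<forall>m. (D ^^ m) b \<noteq> 0"
      and L: "rational_subspace L" "L \<noteq> UNIV" "dim L \<le> Suc e"
    define E where "E = {m. m < M \<and> (D ^^ m) b \<in> L}"
    define E' where "E' = (\<lambda>k. {m\<in>E. (D ^^ (m + k)) b \<in> L})"
    have finE: "finite E" "E \<subseteq> {..<M}" by (auto simp: E_def)
    have E': "real (card (E' k)) \<le> \<delta>' * real M" if k: "k > 0" for k
    proof (cases "E' k = {}")
      case True then show ?thesis using \<open>\<delta>' > 0\<close> by simp
    next
      case False
      then obtain m0 where m0: "m0 \<in> E' k" by blast
      \<comment> \<open>The lattice points of \<open>L\<close> that are again in \<open>L\<close>
        after \<open>k\<close> steps span a rational subspace of \<open>L\<close>. Were it all of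
        \<open>L\<close>, then D^k would preserve \<open>L\<close>, which total irreducibility
        forbids for a proper subspace containing a nonzero orbit point; so the dimension drops and
        the induction hypothesis applies.\<close>
      define T where "T = {c \<in> int_lattice. c \<in> L \<and> (D ^^ k) c \<in> L}"
      have subL: "subspace L" using L(1) by (auto simp: rational_subspace_def)
      have TL: "span T \<subseteq> L" using subL by (intro span_minimal) (auto simp: T_def)
      have rat: "rational_subspace (span T)" unfolding rational_subspace_def
        by (rule exI[of _ T]) (auto simp: T_def)
      have Dk: "linear (D ^^ k)" using D by (auto simp: totally_irreducible_map_def intro: linear_funpow)
      have inT: "(D ^^ m) b \<in> T" if "m \<in> E' k" for m
      proof -
        have "(D ^^ k) ((D ^^ m) b) = (D ^^ (m + k)) b" by (simp add: funpow_add add.commute[of m])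
        moreover have "(D ^^ m) b \<in> int_lattice"
          using D b(1) by (intro funpow_in_int_lattice) (auto simp: totally_irreducible_map_def)
        ultimately show ?thesis using that by (simp add: T_def E'_def E_def)
      qed
      have "dim (span T) \<le> e"
      proof (rule ccontr)
        assume "\<not> ?thesis"
        then have "span T = L" using TL subL L(3) by (intro subspace_dim_equal) auto
        moreover have "(D ^^ k) ` span T \<subseteq> L"
        proof -
          have "(D ^^ k) ` span T = span ((D ^^ k) ` T)" using Dk by (simp add: linear_span_image)
          also have "\<dots> \<subseteq> L" using subL by (intro span_minimal) (auto simp: T_def)
          finally show ?thesis .
        qed
        ultimately have "L = {0} \<or> L = UNIV" using D L(1) k by (auto simp: totally_irreducible_map_def)
        then show False using L(2) b(2) inT[OF m0] TL span_superset by blast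
      qed
      moreover have "span T \<noteq> UNIV" using TL L(2) by auto
      ultimately have "real (card {m. m < M \<and> (D ^^ m) b \<in> span T}) \<le> \<delta>' * real M"
        using M1[OF _ D b rat] M by simp
      moreover have "card (E' k) \<le> card {m. m < M \<and> (D ^^ m) b \<in> span T}"
        using inT by (intro card_mono) (auto simp: E'_def E_def intro: span_base)
      ultimately show ?thesis by linarith
    qed
    \<comment> \<open>The times left over return to \<open>L\<close> only after gaps of at least
      \<open>J\<close>.\<close>
    define F where "F = E - (\<Union>k\<in>{0<..<J}. E' k)"
    have "card F \<le> M div J + 1"
    proof (rule card_spread_le)
      show "F \<subseteq> {..<M}" using finE by (auto simp: F_def)
      fix m k assume "m \<in> F" "0 < k" "k < J"
      then show "m + k \<notin> F" by (auto simp: F_def E'_def E_def)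
    qed (fact J0)
    then have "real (card F) \<le> real M / real J + 1"
      using of_nat_div_le_of_nat[of M J, where 'a=real] by linarith
    moreover have "real M / real J \<le> \<delta> / 3 * real M"
    proof -
      have "1 / real J \<le> \<delta> / 3" using J J0 Suc.prems by (simp add: field_simps)
      from mult_right_mono[OF this, of "real M"] show ?thesis by simp
    qed
    moreover have "1 \<le> \<delta> / 3 * real M"
    proof -
      have "3 / \<delta> \<le> real M" using J M by linarith
      then show ?thesis using Suc.prems by (simp add: field_simps)
    qed
    moreover have "real (card (\<Union>k\<in>{0<..<J}. E' k)) \<le> \<delta> / 3 * real M"
    proof -
      have "real (card (\<Union>k\<in>{0<..<J}. E' k)) \<le> (\<Sum>k\<in>{0<..<J}. real (card (E' k)))"
        using card_UN_le[of "{0<..<J}" E'] by (simp flip: of_nat_sum)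
      also have "\<dots> \<le> of_nat (card {0<..<J}) * (\<delta>' * real M)"
        using E' by (intro sum_bounded_above) auto
      also have "\<dots> \<le> real J * (\<delta>' * real M)"
        using \<open>\<delta>' > 0\<close> by (intro mult_right_mono) auto
      also have "\<dots> = \<delta> / 3 * real M" using J0 by (simp add: \<delta>'_def)
      finally show ?thesis .
    qed
    moreover have "card E \<le> card F + card (\<Union>k\<in>{0<..<J}. E' k)"
    proof -
      have "E \<subseteq> F \<union> (\<Union>k\<in>{0<..<J}. E' k)" by (auto simp: F_def)
      moreover have "finite (F \<union> (\<Union>k\<in>{0<..<J}. E' k))"
        using finE by (auto simp: F_def E'_def)
      ultimately show ?thesis by (meson card_Un_le card_mono le_trans)
    qed
    ultimately show "real (card {m. m < M \<and> (D ^^ m) b \<in> L}) \<le> \<delta> * real M"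
      unfolding E_def[symmetric] by linarith
  qed
qed

text \<open>Each \<open>b\<close> spends a share of less than 1 / card B of the times below
  \<open>M\<close> in \<open>L\<close>, so some time is good for all of \<open>B\<close> at once.
  \<open>M\<close> depends on \<open>B\<close> alone, hence \<open>D\<close> may be chosen after
  it.\<close>

lemma orbit_avoids_subspace:
  fixes B :: "(real^'d) set"
  assumes finB: "finite B" and B: "B \<subseteq> int_lattice"
  obtains M where "\<And>D (L::(real^'d) set). totally_irreducible_map D \<Longrightarrow> (\<forall>b\<in>B. \<forall>m. (D ^^ m) b \<noteq> 0) \<Longrightarrow>
    rational_subspace L \<Longrightarrow> L \<noteq> UNIV \<Longrightarrow> \<exists>m<M. \<forall>b\<in>B. (D ^^ m) b \<notin> L"
proof -
  define \<delta> where "\<delta> = 1 / (real (card B) + 1)"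
  have d: "\<delta> > 0" by (simp add: \<delta>_def)
  from orbit_in_subspace_density[OF this, of "CARD('d)"] obtain M0
    where M0: "\<And>M D b L. M0 \<le> M \<Longrightarrow> totally_irreducible_map (D :: real^'d \<Rightarrow> real^'d) \<Longrightarrow>
      b \<in> int_lattice \<Longrightarrow> (\<forall>m. (D ^^ m) b \<noteq> 0) \<Longrightarrow> rational_subspace L \<Longrightarrow> L \<noteq> UNIV \<Longrightarrow> dim L \<le> CARD('d) \<Longrightarrow>
     real (card {m. m < M \<and> (D ^^ m) b \<in> L}) \<le> \<delta> * real M" by blast
  define M where "M = max M0 1"
  show ?thesis
  proof (rule that[of M], rule ccontr)
    fix D :: "real^'d \<Rightarrow> real^'d" and L :: "(real^'d) set"
    assume D: "totally_irreducible_map D" and nz: "\<forall>b\<in>B. \<forall>m. (D ^^ m) b \<noteq> 0"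
      and L: "rational_subspace L" "L \<noteq> UNIV" and no: "\<not> (\<exists>m<M. \<forall>b\<in>B. (D ^^ m) b \<notin> L)"
    have dimL: "dim L \<le> CARD('d)" using dim_subset_UNIV_cart[of L] by simp
    have "{..<M} \<subseteq> (\<Union>b\<in>B. {m. m < M \<and> (D ^^ m) b \<in> L})" using no by auto
    then have "card {..<M} \<le> card (\<Union>b\<in>B. {m. m < M \<and> (D ^^ m) b \<in> L})" using finB by (intro card_mono) auto
    also have "\<dots> \<le> (\<Sum>b\<in>B. card {m. m < M \<and> (D ^^ m) b \<in> L})" by (rule card_UN_le[OF finB])
    finally have "real M \<le> (\<Sum>b\<in>B. real (card {m. m < M \<and> (D ^^ m) b \<in> L}))" by (simp flip: of_nat_sum)
    also have "\<dots> \<le> of_nat (card B) * (\<delta> * real M)"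
      using M0[OF _ D _ _ L dimL] B nz by (intro sum_bounded_above) (auto simp: M_def)
    also have "\<dots> < real M" by (simp add: \<delta>_def field_simps M_def)
    finally show False by simp
  qed
qed

subsection \<open>Diagonalisable lattice actions\<close>

lemma vec_of_int_add: "vec_of_int (m + n) = vec_of_int m + vec_of_int n"
  by (simp add: vec_of_int_def vec_eq_iff)

lemma vec_of_int_diff: "vec_of_int (m - n) = vec_of_int m - vec_of_int n"
  by (simp add: vec_of_int_def vec_eq_iff)

lemma vec_of_int_scale: "vec_of_int (k *s n) = of_int k *\<^sub>R vec_of_int n"
  by (simp add: vec_of_int_def vec_eq_iff)

lemma vec_of_int_0 [simp]: "vec_of_int 0 = 0"
  by (simp add: vec_of_int_def vec_eq_iff)

lemma int_lattice_add: "x \<in> int_lattice \<Longrightarrow> y \<in> int_lattice \<Longrightarrow> x + y \<in> int_lattice"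
  and int_lattice_minus: "x \<in> int_lattice \<Longrightarrow> - x \<in> int_lattice"
  and int_lattice_diff: "x \<in> int_lattice \<Longrightarrow> y \<in> int_lattice \<Longrightarrow> x - y \<in> int_lattice"
  and int_lattice_0: "0 \<in> int_lattice"
  by (auto simp: int_lattice_def)

text \<open>Motion along a real direction of R^r is always realised by these lattice points, at an
  error bounded independently of the direction.\<close>

definition floor_vec :: "real^'n \<Rightarrow> int^'n" where
  "floor_vec h = (\<chi> j. \<lfloor>h $ j\<rfloor>)"

lemma norm_floor_vec: "norm (h - vec_of_int (floor_vec (h :: real^'n))) \<le> real CARD('n)"
proof -
  have "norm (h - vec_of_int (floor_vec h)) \<le> (\<Sum>j\<in>UNIV. \<bar>(h - vec_of_int (floor_vec h)) $ j\<bar>)"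
    by (rule norm_le_l1_cart)
  also have "\<dots> \<le> of_nat (card (UNIV :: 'n set)) * 1"
  proof (rule sum_bounded_above)
    fix j :: 'n
    show "\<bar>(h - vec_of_int (floor_vec h)) $ j\<bar> \<le> 1"
      using floor_correct[of "h $ j"] by (auto simp: vec_of_int_def floor_vec_def abs_le_iff simp del:
          floor_le_iff) linarith
  qed
  finally show ?thesis by simp
qed

lemma lattice_reduction: "\<exists>\<gamma>\<in>int_lattice. norm (x + \<gamma> :: real^'d) \<le> real CARD('d)"
proof (rule bexI)
  show "- vec_of_int (floor_vec x) \<in> int_lattice"
    by (simp add: int_lattice_def vec_of_int_def)
  show "norm (x + - vec_of_int (floor_vec x)) \<le> real CARD('d)" using norm_floor_vec[of x] by simp
qed

text \<open>What the dynamics uses of the number field data: \<open>P\<close> gives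
  eigencoordinates, \<open>z\<close> the eigenvalues, \<open>l\<close> the functionals on R^r. The
  field structure survives as \<open>z_one\<close>: a nonzero element has no eigenvalue 1.
  \<open>irred\<close> speaks of transposes because it is applied to characters. The abstract form
  also covers the action restricted to q Z^r, see \<open>scaled_flow\<close>.\<close>

locale torus_flow =
  fixes A :: "int^'r \<Rightarrow> real^'d^'d" and P :: "real^'d \<Rightarrow> complex^'i"
    and z :: "int^'r \<Rightarrow> 'i::finite \<Rightarrow> complex" and l :: "'i \<Rightarrow> real^'r \<Rightarrow> real" and S :: "'i set"
  assumes A_add: "A (m + n) = A m ** A n" and A_0: "A 0 = mat 1"
    and A_int: "x \<in> int_lattice \<Longrightarrow> A n *v x \<in> int_lattice"
    and P_lin: "linear P" and P_inj: "inj P"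
    and P_A: "P (A n *v x) $ i = z n i * P x $ i"
    and z_add: "z (m + n) i = z m i * z n i"
    and z_one: "z n i = 1 \<Longrightarrow> n = 0"
    and l_lin: "linear (l i)"
    and l_z: "cmod (z n i) = exp (l i (vec_of_int n))"
    and dim_H: "2 \<le> dim {h. \<forall>i\<in>S. l i h = 0}"
    and irred: "\<epsilon> > 0 \<Longrightarrow> \<exists>n. (\<forall>i\<in>S. \<bar>l i (vec_of_int n)\<bar> < \<epsilon>) \<and>
                  totally_irreducible_map (\<lambda>b. transpose (A n) *v b)"
begin

definition "H = {h. \<forall>i\<in>S. l i h = 0}"

text \<open>By duality this is <S>: a functional vanishes on the common kernel of a finite family
  exactly if it lies in the span of the family.\<close>

definition "C = {i. \<forall>h\<in>H. l i h = 0}"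

definition "V = {x. \<forall>i. i \<notin> C \<longrightarrow> P x $ i = 0}"

text \<open>A distance to \<open>V\<close> in eigencoordinates. It is a function on R^d that does
  not descend to the torus, which is why \<open>accumulates\<close> bounds \<open>u\<close> itself
  and not just its class modulo the lattice.\<close>

definition off :: "real^'d \<Rightarrow> real" where "off x = norm (\<chi> i. if i \<in> C then 0 else P x $ i)"

definition lamS :: "int^'r \<Rightarrow> real^'i" where
  "lamS n = (\<chi> i. if i \<in> S then l i (vec_of_int n) else 0)"

text \<open>Closed invariant sets of T^d x R^S are represented by their lattice-periodic lifts, so
  that limits, differences and eigencoordinates live in a vector space. The coordinates of the
  second factor outside \<open>S\<close> never move.\<close>

definition invariant :: "((real^'d) \<times> (real^'i)) set \<Rightarrow> bool" where
  "invariant M \<longleftrightarrow> closed M \<and> (\<forall>x t \<gamma>. (x, t) \<in> M \<longrightarrow> \<gamma> \<in> int_lattice \<longrightarrow> (x + \<gamma>, t) \<in> M) \<and>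
     (\<forall>x t n. (x, t) \<in> M \<longrightarrow> (A n *v x, t + lamS n) \<in> M)"

lemma z_nz: "z n i \<noteq> 0"
  by (metis l_z exp_not_eq_zero norm_zero)

lemma z_0: "z 0 i = 1"
  using z_add[of 0 0 i] z_nz[of 0 i] by simp

lemma z_minus: "z (- n) i = inverse (z n i)"
  using z_add[of n "- n" i] by (simp add: z_0 inverse_unique)

lemma z_diff: "z (m - n) i = z m i / z n i"
  using z_add[of m "- n" i] by (simp add: z_minus divide_inverse)

lemma z_nat: "z (of_nat k *s n) i = z n i ^ k"
proof (induction k)
  case (Suc k)
  have "of_nat (Suc k) *s n = n + of_nat k *s n" by (simp add: vec_eq_iff algebra_simps)
  then show ?case using Suc by (simp add: z_add)
qed (simp add: z_0)

lemma A_minus: "A (- n) *v (A n *v x) = x"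
  using A_add[of "- n" n, symmetric] by (simp add: matrix_vector_mul_assoc A_0)

lemma A_minus': "A n *v (A (- n) *v x) = x"
  using A_minus[of "- n" x] by simp

lemma A_add_v: "A (m + n) *v x = A m *v (A n *v x)"
  by (simp add: A_add matrix_vector_mul_assoc)

lemma S_subset_C: "S \<subseteq> C"
  by (auto simp: C_def H_def)

lemma l_scale: "l i (c *\<^sub>R h) = c * l i h"
  using linear_scale[OF l_lin, of i c h] by simp

lemma l_add: "l i (h + k) = l i h + l i k" and l_diff: "l i (h - k) = l i h - l i k" and l_0: "l i 0 = 0"
  by (simp_all add: linear_add[OF l_lin] linear_diff[OF l_lin] linear_0[OF l_lin])

lemma subspace_H: "subspace H"
  by (auto simp: H_def subspace_def l_add l_scale l_0)

lemma subspace_V: "subspace V"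
  by (auto simp: V_def subspace_def linear_add[OF P_lin] linear_scale[OF P_lin] linear_0[OF P_lin])

lemma lamS_add: "lamS (m + n) = lamS m + lamS n" and lamS_diff: "lamS (m - n) = lamS m - lamS n"
  and lamS_0 [simp]: "lamS 0 = 0"
  by (auto simp: lamS_def vec_eq_iff vec_of_int_add vec_of_int_diff l_add l_diff l_0)

lemma lamS_minus: "lamS (- n) = - lamS n"
  using lamS_diff[of 0 n] by simp

lemma lamS_nat: "lamS (of_nat k *s n) = real k *\<^sub>R lamS n"
  by (auto simp: lamS_def vec_eq_iff vec_of_int_scale l_scale)

section \<open>Lattice points following a direction of R^r\<close>

lemma l_bounded: obtains B where "B > 0" "\<And>i (h :: real^'r). \<bar>l i h\<bar> \<le> B * norm h"
proof -
  have "\<exists>B>0. \<forall>h. \<bar>l i h\<bar> \<le> B * norm h" for i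
    using linear_bounded_pos[OF l_lin[of i]] by auto
  then obtain B where B: "\<And>i. B i > 0" "\<And>i h. \<bar>l i h\<bar> \<le> B i * norm h" by metis
  show ?thesis
  proof (rule that[of "Max (range B)"])
    show "Max (range B) > 0" using B(1) by (subst Max_gr_iff) auto
    fix i and h :: "real^'r"
    have "B i * norm h \<le> Max (range B) * norm h" by (intro mult_right_mono) auto
    then show "\<bar>l i h\<bar> \<le> Max (range B) * norm h" using B(2)[of i h] by linarith
  qed
qed

lemma l_floor_vec:
  obtains K where "K > 0" "\<And>i h. \<bar>l i (vec_of_int (floor_vec h)) - l i h\<bar> \<le> K"
proof -
  obtain B where B: "B > 0" "\<And>i h. \<bar>l i h\<bar> \<le> B * norm h" by (rule l_bounded) blast
  show ?thesis
  proof (rule that[of "B * real CARD('r)"])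
    show "B * real CARD('r) > 0" using B by simp
    fix i h
    have "\<bar>l i (vec_of_int (floor_vec h)) - l i h\<bar> = \<bar>l i (h - vec_of_int (floor_vec h))\<bar>" by (simp add: l_diff)
    also have "\<dots> \<le> B * norm (h - vec_of_int (floor_vec h))" by (rule B)
    also have "\<dots> \<le> B * real CARD('r)" using norm_floor_vec[of h] B(1) by (intro mult_left_mono) auto
    finally show "\<bar>l i (vec_of_int (floor_vec h)) - l i h\<bar> \<le> B * real CARD('r)" .
  qed
qed

text \<open>Lattice points near the ray of \<open>h\<close> have eigenvalues of bounded modulus on
  \<open>Q\<close>, so the eigenvalue vectors have a Cauchy subsequence, and the quotient of two
  late members is close to 1. As the points run off to infinity along \<open>h\<close>, the two can
  be taken distinct.\<close>

lemma almost_identity_element: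
  assumes h: "h \<noteq> 0" "\<And>i. i \<in> Q \<Longrightarrow> l i h = 0" and e: "\<epsilon> > 0"
  shows "\<exists>m. m \<noteq> 0 \<and> (\<forall>i\<in>Q. cmod (z m i - 1) < \<epsilon>)"
proof -
  obtain K where K: "K > 0" "\<And>i h. \<bar>l i (vec_of_int (floor_vec h)) - l i h\<bar> \<le> K" by (rule l_floor_vec) blast
  define n where "n = (\<lambda>j::nat. floor_vec (real j *\<^sub>R h))"
  have ln: "\<bar>l i (vec_of_int (n j))\<bar> \<le> K" if "i \<in> Q" for i j
    using K(2)[of i "real j *\<^sub>R h"] h(2)[OF that] by (simp add: n_def l_scale)
  define w where "w = (\<lambda>j. \<chi> i. if i \<in> Q then z (n j) i else 0)"
  have "bounded (range w)"
  proof (rule boundedI)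
    fix x assume "x \<in> range w"
    then obtain j where x: "x = w j" by auto
    have "norm (w j) \<le> (\<Sum>i\<in>UNIV. norm (w j $ i))" by (simp add: norm_vec_def L2_set_le_sum)
    also have "\<dots> \<le> of_nat (card (UNIV :: 'i set)) * exp K"
      using ln by (intro sum_bounded_above) (auto simp: w_def l_z abs_le_iff)
    finally show "norm x \<le> of_nat (card (UNIV :: 'i set)) * exp K" by (simp add: x)
  qed
  then obtain lim r where r: "strict_mono r" "(w \<circ> r) \<longlonglongrightarrow> lim"
    using bounded_imp_convergent_subsequence by blast
  then have "Cauchy (w \<circ> r)" by (blast intro: LIMSEQ_imp_Cauchy)
  moreover have "\<epsilon> * exp (- K) > 0" using e by simp
  ultimately obtain N where N: "\<And>a b. a \<ge> N \<Longrightarrow> b \<ge> N \<Longrightarrow> dist ((w \<circ> r) a) ((w \<circ> r) b) < \<epsilon> * exp (- K)"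
    unfolding Cauchy_def by meson
  \<comment> \<open>Far enough along the ray for the rounded points to differ: each is within
    \<open>CARD('r)\<close> of its real point.\<close>
  obtain a where a: "(2 * real CARD('r) + real (r N) * norm h) / norm h < real a"
    using reals_Archimedean2 by blast
  define b where "b = max a N"
  have bN: "b \<ge> N" and rb: "real a \<le> real (r b)"
    using seq_suble[OF r(1), of b] by (auto simp: b_def)
  have "n (r b) \<noteq> n (r N)"
  proof
    assume eq: "n (r b) = n (r N)"
    have "norm (real (r b) *\<^sub>R h - real (r N) *\<^sub>R h) \<le> norm (real (r b) *\<^sub>R h - vec_of_int (n (r b)))
        + norm (real (r N) *\<^sub>R h - vec_of_int (n (r N)))"
      using norm_triangle_ineq4[of "real (r b) *\<^sub>R h - vec_of_int (n (r b))"
          "real (r N) *\<^sub>R h - vec_of_int (n (r N))"] by (simp add: eq)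
    also have "\<dots> \<le> 2 * real CARD('r)" using norm_floor_vec[of "real (r b) *\<^sub>R h"] norm_floor_vec[of
        "real (r N) *\<^sub>R h"] by (simp add: n_def)
    finally have "(real (r b) - real (r N)) * norm h \<le> 2 * real CARD('r)"
      by (smt (verit) abs_ge_self mult_right_mono norm_ge_zero norm_scaleR scaleR_left_diff_distrib)
    moreover have "2 * real CARD('r) + real (r N) * norm h < real (r b) * norm h"
    proof -
      have "2 * real CARD('r) + real (r N) * norm h < real a * norm h" using a h(1)
        by (simp add: divide_less_eq)
      also have "\<dots> \<le> real (r b) * norm h" using rb by (intro mult_right_mono) auto
      finally show ?thesis .
    qed
    ultimately show False by (simp add: algebra_simps)
  qed
  moreover have "cmod (z (n (r b) - n (r N)) i - 1) < \<epsilon>" if "i \<in> Q" for i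
  proof -
    have "z (n (r b) - n (r N)) i - 1 = (z (n (r b)) i - z (n (r N)) i) / z (n (r N)) i"
      using z_nz by (simp add: z_diff field_simps)
    also have "cmod \<dots> = cmod (z (n (r b)) i - z (n (r N)) i) * exp (- l i (vec_of_int (n (r N))))"
      by (simp add: norm_divide l_z exp_minus field_simps)
    also have "\<dots> \<le> dist (w (r b)) (w (r N)) * exp K"
    proof (rule mult_mono)
      show "cmod (z (n (r b)) i - z (n (r N)) i) \<le> dist (w (r b)) (w (r N))"
        using Finite_Cartesian_Product.norm_nth_le[of "w (r b) - w (r N)" i] that by (simp add: w_def dist_norm)
    qed (use ln[OF that, of "r N"] in \<open>auto simp: abs_le_iff\<close>)
    also have "\<dots> < \<epsilon> * exp (- K) * exp K" using N[OF bN, of N] by (intro mult_strict_right_mono) auto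
    finally show ?thesis by (simp add: mult.assoc flip: exp_add)
  qed
  ultimately show ?thesis by (intro exI[of _ "n (r b) - n (r N)"]) auto
qed

lemma P_coord_bound: "cmod (P x $ i) \<le> norm (P x)"
  by (rule Finite_Cartesian_Product.norm_nth_le)

lemma off_coord: "i \<notin> C \<Longrightarrow> cmod (P x $ i) \<le> off x"
  using Finite_Cartesian_Product.norm_nth_le[of "\<chi> i. if i \<in> C then 0 else P x $ i" i] by (simp add: off_def)

lemma off_mono:
  assumes "\<And>i. i \<notin> C \<Longrightarrow> cmod (P x $ i) \<le> K * cmod (P y $ i)" "K \<ge> 0"
  shows "off x \<le> K * off y"
proof -
  have "off x \<le> norm (K *\<^sub>R (\<chi> i. if i \<in> C then 0 else P y $ i))"
    unfolding off_def using assms by (intro norm_le_componentwise_cart) auto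
  then show ?thesis using assms(2) by (simp add: off_def)
qed

lemma continuous_off: "continuous_on UNIV off"
proof -
  have "continuous_on UNIV P" using P_lin by (simp add: linear_continuous_on linear_conv_bounded_linear)
  then have "continuous_on UNIV (\<lambda>x. if i \<in> C then 0 else P x $ i)" for i
    by (cases "i \<in> C") (auto intro!: continuous_intros)
  then show ?thesis unfolding off_def by (intro continuous_intros continuous_on_vec_lambda)
qed

lemma off_eq_0: "off x = 0 \<longleftrightarrow> x \<in> V"
  by (auto simp: off_def V_def vec_eq_iff)

lemma off_pos: "x \<notin> V \<Longrightarrow> off x > 0"
  using off_eq_0[of x] by (auto simp: off_def simp del: norm_eq_zero)

text \<open>One step along the ray multiplies every component by at most \<open>K\<close> in
  modulus, so the first time \<open>off\<close> reaches \<rho> / K it is still at most \<rho>; it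
  gets there because the component at \<open>i0\<close> grows exponentially. In \<open>K\<close>,
  the term \<open>2 * K0\<close> pays for the two roundings and \<open>B * norm h0\<close> for the
  step itself.\<close>

lemma expand:
  assumes h0: "l i0 h0 > 0" "i0 \<notin> C"
  obtains K where "K \<ge> 1"
    "\<And>\<rho> x. \<rho> > 0 \<Longrightarrow> P x $ i0 \<noteq> 0 \<Longrightarrow> off x \<le> \<rho> / K \<Longrightarrow>
        \<exists>t\<ge>0. \<rho> / K \<le> off (A (floor_vec (t *\<^sub>R h0)) *v x) \<and> off (A (floor_vec (t *\<^sub>R h0)) *v x) \<le> \<rho>"
proof -
  obtain K0 where K0: "K0 > 0" "\<And>i h. \<bar>l i (vec_of_int (floor_vec h)) - l i h\<bar> \<le> K0" by (rule l_floor_vec) blast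
  obtain B where B: "B > 0" "\<And>i h. \<bar>l i h\<bar> \<le> B * norm h" by (rule l_bounded) blast
  define K where "K = exp (2 * K0 + B * norm h0)"
  have K1: "K \<ge> 1" using K0 B by (simp add: K_def)
  define n where "n = (\<lambda>j::nat. floor_vec (real j *\<^sub>R h0))"
  show ?thesis
  proof (rule that[OF K1])
    fix \<rho> :: real and x assume \<rho>: "\<rho> > 0" and x: "P x $ i0 \<noteq> 0" "off x \<le> \<rho> / K"
    have "\<exists>j. \<rho> / K \<le> off (A (n j) *v x)"
    proof -
      obtain j :: nat where j: "(ln (\<rho> / K / cmod (P x $ i0)) + K0) / l i0 h0 < real j"
        using reals_Archimedean2 by blast
      then have "ln (\<rho> / K / cmod (P x $ i0)) < real j * l i0 h0 - K0" using h0 by (simp add: divide_less_eq)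
      also have "\<dots> \<le> l i0 (vec_of_int (n j))"
        using K0(2)[of i0 "real j *\<^sub>R h0"] by (simp add: n_def l_scale)
      finally have "\<rho> / K / cmod (P x $ i0) < exp (l i0 (vec_of_int (n j)))"
        using \<rho> K1 x(1) by (smt (verit) divide_pos_pos exp_less_cancel_iff exp_ln zero_less_norm_iff)
      moreover have "0 < cmod (P x $ i0)" using x(1) by simp
      ultimately have "\<rho> / K < cmod (z (n j) i0) * cmod (P x $ i0)" unfolding l_z
        by (simp only: pos_divide_less_eq)
      also have "\<dots> \<le> off (A (n j) *v x)" using off_coord[OF h0(2), of "A (n j) *v x"]
        by (simp add: P_A norm_mult)
      finally show ?thesis by (intro exI[of _ j]) simp
    qed
    then obtain j where j: "\<rho> / K \<le> off (A (n j) *v x)" and least: "\<And>k. k < j \<Longrightarrow> off (A (n k) *v x) < \<rho> / K"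
      using exists_least_iff[of "\<lambda>j. \<rho> / K \<le> off (A (n j) *v x)"] by (auto simp: not_le)
    have "off (A (n j) *v x) \<le> \<rho>"
    proof (cases j)
      case 0
      then have "n j = 0" by (simp add: n_def floor_vec_def vec_eq_iff)
      moreover have "\<rho> / K \<le> \<rho>" using \<rho> K1 by (simp add: field_simps)
      ultimately show ?thesis using x(2) by (simp add: A_0)
    next
      case (Suc k)
      have "off (A (n j) *v x) \<le> K * off (A (n k) *v x)"
      proof (rule off_mono)
        fix i
        have "\<bar>l i h0\<bar> \<le> B * norm h0" by (rule B)
        then have "l i (vec_of_int (n j)) \<le> (2 * K0 + B * norm h0) + l i (vec_of_int (n k))"
          using K0(2)[of i "real j *\<^sub>R h0"] K0(2)[of i "real k *\<^sub>R h0"]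
          by (simp add: n_def l_scale l_add Suc algebra_simps abs_le_iff)
        then have "cmod (z (n j) i) \<le> K * cmod (z (n k) i)" by (simp add: l_z K_def flip: exp_add)
        then show "cmod (P (A (n j) *v x) $ i) \<le> K * cmod (P (A (n k) *v x) $ i)"
          by (simp add: P_A norm_mult mult_right_mono flip: mult.assoc)
      qed (use K1 in auto)
      also have "\<dots> \<le> K * (\<rho> / K)" using least[of k] Suc K1 by (intro mult_left_mono) auto
      finally show ?thesis using K1 by simp
    qed
    with j show "\<exists>t\<ge>0. \<rho> / K \<le> off (A (floor_vec (t *\<^sub>R h0)) *v x) \<and> off (A (floor_vec (t *\<^sub>R h0)) *v x) \<le> \<rho>"
      by (intro exI[of _ "real j"]) (simp add: n_def)
  qed
qed

end

section \<open>Pigeonhole, integer matrices and a logarithm estimate\<close>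

lemma pigeonhole_bounded_sequence:
  assumes "\<eta> > 0"
  obtains N where "\<And>f :: nat \<Rightarrow> 'a::euclidean_space. (\<And>j. norm (f j) \<le> D) \<Longrightarrow> \<exists>j j'. j < j' \<and> j' \<le> N
      \<and> norm (f j' - f j) < \<eta>"
proof -
  have "seq_compact (cball (0::'a) D)" by (simp add: compact_imp_seq_compact)
  from seq_compact_imp_totally_bounded[OF this] assms obtain k
    where k: "finite k" "cball (0::'a) D \<subseteq> (\<Union>x\<in>k. ball x (\<eta>/2))" by (meson half_gt_zero)
  show ?thesis
  proof (rule that[of "card k"])
    fix f :: "nat \<Rightarrow> 'a" assume f: "\<And>j. norm (f j) \<le> D"
    have "\<forall>j. \<exists>c\<in>k. f j \<in> ball c (\<eta>/2)" using f k(2) by (force simp: subset_iff)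
    then obtain c where c: "\<And>j. c j \<in> k" "\<And>j. f j \<in> ball (c j) (\<eta>/2)" by metis
    have "\<not> inj_on c {..card k}"
    proof
      assume "inj_on c {..card k}"
      moreover have "c ` {..card k} \<subseteq> k" using c by auto
      ultimately have "card {..card k} \<le> card k" using k(1) by (metis card_inj_on_le)
      then show False by simp
    qed
    then obtain a b where "a \<le> card k" "b \<le> card k" "a < b" "c a = c b"
      unfolding inj_on_def by (metis atMost_iff linorder_neqE_nat)
    moreover have "norm (f b - f a) < \<eta>" if "c a = c b"
    proof -
      have "dist (c a) (f b) < \<eta> / 2" using c(2)[of b] that by simp
      moreover have "dist (c a) (f a) < \<eta> / 2" using c(2)[of a] by simp
      ultimately have "dist (f b) (f a) < \<eta>" by (rule dist_triangle_half_r)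
      then show ?thesis by (simp add: dist_norm)
    qed
    ultimately show "\<exists>j j'. j < j' \<and> j' \<le> card k \<and> norm (f j' - f j) < \<eta>" by blast
  qed
qed

lemma det_integer_matrix:
  fixes B :: "real^'d^'d"
  assumes "\<And>i j. B $ i $ j \<in> \<int>"
  shows "det B \<in> \<int>"
  unfolding det_def using assms by (intro Ints_sum Ints_mult Ints_prod) (auto simp: sign_def)

text \<open>Cramer's rule expresses the preimage by quotients of integer determinants.\<close>

lemma integer_matrix_rational_preimage:
  fixes B :: "real^'d^'d"
  assumes B: "\<And>i j. B $ i $ j \<in> \<int>" and inj: "\<And>x. B *v x = 0 \<Longrightarrow> x = 0" and b: "b \<in> int_lattice"
  obtains q where "\<forall>j. q $ j \<in> \<rat>" "B *v q = b"
proof -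
  have "det B \<noteq> 0" using inj invertible_det_nz[of B] matrix_left_invertible_ker[of B]
    by (metis invertible_left_inverse)
  define q where "q = (\<chi> k. det (\<chi> i j. if j = k then b $ i else B $ i $ j) / det B)"
  have "B *v q = b" using cramer[OF \<open>det B \<noteq> 0\<close>, of q b] by (simp add: q_def)
  moreover have "q $ k \<in> \<rat>" for k
  proof -
    have "det (\<chi> i j. if j = k then b $ i else B $ i $ j) \<in> \<int>"
      using B b by (intro det_integer_matrix) (auto simp: int_lattice_def)
    then show ?thesis using det_integer_matrix[OF B] Ints_subset_Rats by (auto simp: q_def intro!: Rats_divide)
  qed
  ultimately show ?thesis using that by blast
qed

lemma abs_ln_le:
  fixes x :: real assumes "\<bar>x - 1\<bar> \<le> 1/2"
  shows "\<bar>ln x\<bar> \<le> 2 * \<bar>x - 1\<bar>"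
proof -
  have x: "x \<ge> 1/2" using assms by linarith
  have "ln x \<le> x - 1" using x by (intro ln_le_minus_one) auto
  moreover have "- ln x \<le> 1 / x - 1" using x ln_le_minus_one[of "1/x"] by (simp add: ln_div)
  moreover have "1 / x - 1 \<le> 2 * \<bar>x - 1\<bar>"
  proof -
    have "1 / x - 1 = (1 - x) / x" using x by (simp add: field_simps)
    also have "\<dots> \<le> \<bar>x - 1\<bar> / x" using x by (intro divide_right_mono) auto
    also have "\<dots> \<le> \<bar>x - 1\<bar> / (1/2)" using x by (intro divide_left_mono) auto
    finally show ?thesis by simp
  qed
  moreover have "x - 1 \<le> 2 * \<bar>x - 1\<bar>" by (simp add: abs_if)
  ultimately show ?thesis by (intro abs_leI) linarith+
qed

context torus_flow
begin

lemma l_ln: "l i (vec_of_int n) = ln (cmod (z n i))"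
  by (simp add: l_z)

text \<open>An eigenvalue near 1 has modulus near 1, so its logarithm is small too; d is half of
  \<epsilon> to absorb the factor 2 of \<open>abs_ln_le\<close>.\<close>

lemma almost_identity_element':
  assumes h: "h \<noteq> 0" "\<And>i. i \<in> Q \<Longrightarrow> l i h = 0" and e: "\<epsilon> > 0"
  obtains m where "m \<noteq> 0" "\<And>i. i \<in> Q \<Longrightarrow> cmod (z m i - 1) < \<epsilon>" "\<And>i. i \<in> Q \<Longrightarrow> \<bar>l i (vec_of_int m)\<bar> < \<epsilon>"
proof -
  define d where "d = min (\<epsilon> / 2) (1/2)"
  have d: "d > 0" "d \<le> \<epsilon> / 2" "d \<le> 1/2" using e by (auto simp: d_def)
  from almost_identity_element[OF h d(1)] obtain m where m: "m \<noteq> 0" "\<And>i. i \<in> Q \<Longrightarrow> cmod (z m i - 1) < d" by blast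
  show ?thesis
  proof (rule that[OF m(1)])
    fix i assume i: "i \<in> Q"
    show "cmod (z m i - 1) < \<epsilon>" using m(2)[OF i] d e by simp
    have "\<bar>cmod (z m i) - 1\<bar> \<le> cmod (z m i - 1)" using norm_triangle_ineq3[of "z m i" 1] by simp
    then have "\<bar>cmod (z m i) - 1\<bar> < d" using m(2)[OF i] by simp
    then show "\<bar>l i (vec_of_int m)\<bar> < \<epsilon>" using abs_ln_le[of "cmod (z m i)"] d by (simp add: l_ln)
  qed
qed

lemma H_nonzero: obtains h where "h \<in> H" "h \<noteq> 0"
proof -
  have "\<not> H \<subseteq> {0}"
  proof
    assume "H \<subseteq> {0}"
    then have "dim H = 0" by (simp only: dim_eq_0)
    then show False using dim_H unfolding H_def by linarith
  qed
  then show ?thesis using that by blast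
qed

section \<open>Norms in eigencoordinates and expansion of any vector off V\<close>

lemma norm_le_coords: obtains B where "B > 0" "\<And>x. norm x \<le> B * (\<Sum>i\<in>UNIV. cmod (P x $ i))"
proof -
  from linear_inj_bounded_below_pos[OF P_lin P_inj] obtain b where b: "b > 0" "\<And>x. b * norm x \<le> norm (P x)"
    by blast
  show ?thesis
  proof (rule that[of "1 / b"])
    show "1 / b > 0" using b by simp
    fix x
    have "norm (P x) \<le> (\<Sum>i\<in>UNIV. cmod (P x $ i))" by (simp add: norm_vec_def L2_set_le_sum)
    with b(2)[of x] have "b * norm x \<le> (\<Sum>i\<in>UNIV. cmod (P x $ i))" by linarith
    then show "norm x \<le> 1 / b * (\<Sum>i\<in>UNIV. cmod (P x $ i))" using b(1) by (simp add: field_simps)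
  qed
qed

lemma norm_le_coord_bound: obtains B where "B > 0" "\<And>x K. (\<And>i. cmod (P x $ i) \<le> K) \<Longrightarrow> norm x \<le> B * K"
proof -
  obtain B where B: "B > 0" "\<And>x. norm x \<le> B * (\<Sum>i\<in>UNIV. cmod (P x $ i))" by (rule norm_le_coords) blast
  show ?thesis
  proof (rule that[of "B * real CARD('i)"])
    show "B * real CARD('i) > 0" using B by simp
    fix x K assume K: "\<And>i. cmod (P x $ i) \<le> K"
    have "(\<Sum>i\<in>UNIV. cmod (P x $ i)) \<le> of_nat (card (UNIV::'i set)) * K"
      by (rule sum_bounded_above) (rule K)
    then have "B * (\<Sum>i\<in>UNIV. cmod (P x $ i)) \<le> B * (real CARD('i) * K)" using B(1)
      by (intro mult_left_mono) auto
    then show "norm x \<le> B * real CARD('i) * K" using B(2)[of x] by (simp add: mult.assoc)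
  qed
qed

lemma coord_le_norm: obtains B where "B > 0" "\<And>x i. cmod (P x $ i) \<le> B * norm x" "\<And>x. off x \<le> B * norm x"
proof -
  from linear_bounded_pos[OF P_lin] obtain B where B: "B > 0" "\<And>x. norm (P x) \<le> B * norm x" by blast
  show ?thesis
  proof (rule that[OF B(1)])
    fix x i
    show "cmod (P x $ i) \<le> B * norm x" using P_coord_bound[of x i] B(2)[of x] by linarith
    have "off x \<le> norm (P x)" unfolding off_def by (rule norm_le_componentwise_cart) auto
    then show "off x \<le> B * norm x" using B(2)[of x] by linarith
  qed
qed

lemma norm_lamS_le:
  assumes "\<And>i. i \<in> S \<Longrightarrow> \<bar>l i (vec_of_int n)\<bar> \<le> K" "K \<ge> 0"
  shows "norm (lamS n) \<le> real CARD('i) * K"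
proof -
  have "norm (lamS n) \<le> (\<Sum>i\<in>UNIV. \<bar>lamS n $ i\<bar>)" by (rule norm_le_l1_cart)
  also have "\<dots> \<le> of_nat (card (UNIV::'i set)) * K"
    using assms by (intro sum_bounded_above) (auto simp: lamS_def)
  finally show ?thesis by simp
qed

lemma outside_C_direction:
  assumes "i \<notin> C" obtains h where "h \<in> H" "l i h > 0"
proof -
  from assms obtain h where h: "h \<in> H" "l i h \<noteq> 0" by (auto simp: C_def)
  show ?thesis
  proof (cases "l i h > 0")
    case False
    then have "l i (- h) > 0" "- h \<in> H"
      using h subspace_H l_scale[of i "-1" h] by (auto simp: subspace_neg)
    then show ?thesis by (rule that[rotated])
  qed (use h that in blast)
qed

text \<open>Every index outside \<open>C\<close> is expanded by some direction of \<open>H\<close>,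
  and \<open>K\<close> is a maximum over the finitely many indices. As these directions lie in
  \<open>H\<close>, the components over \<open>C\<close> change only through rounding.\<close>

lemma expand_any:
  obtains K where "K \<ge> 1"
    "\<And>\<rho> x. \<rho> > 0 \<Longrightarrow> x \<notin> V \<Longrightarrow> off x \<le> \<rho> / K \<Longrightarrow>
        \<exists>n. (\<forall>i\<in>C. \<bar>l i (vec_of_int n)\<bar> \<le> K) \<and> \<rho> / K \<le> off (A n *v x) \<and> off (A n *v x) \<le> \<rho>"
proof -
  obtain K0 where K0: "K0 > 0" "\<And>i h. \<bar>l i (vec_of_int (floor_vec h)) - l i h\<bar> \<le> K0" by (rule l_floor_vec) blast
  have "\<forall>i. \<exists>K. i \<notin> C \<longrightarrow> K \<ge> 1 \<and> (\<forall>\<rho> x. \<rho> > 0 \<longrightarrow> P x $ i \<noteq> 0 \<longrightarrow> off x \<le> \<rho> / K \<longrightarrow>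
     (\<exists>n. (\<forall>i\<in>C. \<bar>l i (vec_of_int n)\<bar> \<le> K0) \<and> \<rho> / K \<le> off (A n *v x) \<and> off (A n *v x) \<le> \<rho>))"
  proof
    fix i
    show "\<exists>K. i \<notin> C \<longrightarrow> K \<ge> 1 \<and> (\<forall>\<rho> x. \<rho> > 0 \<longrightarrow> P x $ i \<noteq> 0 \<longrightarrow> off x \<le> \<rho> / K \<longrightarrow>
     (\<exists>n. (\<forall>i\<in>C. \<bar>l i (vec_of_int n)\<bar> \<le> K0) \<and> \<rho> / K \<le> off (A n *v x) \<and> off (A n *v x) \<le> \<rho>))"
    proof (cases "i \<in> C")
      case False
      obtain h where h: "h \<in> H" "l i h > 0" using outside_C_direction[OF False] by blast
      have hC: "\<bar>l j (vec_of_int (floor_vec (t *\<^sub>R h)))\<bar> \<le> K0" if "j \<in> C" for j t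
        using K0(2)[of j "t *\<^sub>R h"] that h(1) by (simp add: C_def l_scale)
      from expand[OF h(2) False] obtain K where K: "K \<ge> 1"
        "\<And>\<rho> x. \<rho> > 0 \<Longrightarrow> P x $ i \<noteq> 0 \<Longrightarrow> off x \<le> \<rho> / K \<Longrightarrow>
        \<exists>t\<ge>0. \<rho> / K \<le> off (A (floor_vec (t *\<^sub>R h)) *v x) \<and> off (A (floor_vec (t *\<^sub>R h)) *v x) \<le> \<rho>" by blast
      show ?thesis using K hC by (intro exI[of _ K] impI conjI allI) blast+
    qed auto
  qed
  then obtain KK where KK: "\<And>i. i \<notin> C \<Longrightarrow> KK i \<ge> 1"
    "\<And>i \<rho> x. i \<notin> C \<Longrightarrow> \<rho> > 0 \<Longrightarrow> P x $ i \<noteq> 0 \<Longrightarrow> off x \<le> \<rho> / KK i \<Longrightarrow>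
     (\<exists>n. (\<forall>i\<in>C. \<bar>l i (vec_of_int n)\<bar> \<le> K0) \<and> \<rho> / KK i \<le> off (A n *v x) \<and> off (A n *v x) \<le> \<rho>)"
    by metis
  define K where "K = Max (insert 1 (insert K0 (range KK)))"
  have K: "1 \<le> K" "K0 \<le> K" "\<And>i. KK i \<le> K" unfolding K_def by (rule Max_ge; auto)+
  show ?thesis
  proof (rule that[OF K(1)])
    fix \<rho> :: real and x assume a: "\<rho> > 0" "x \<notin> V" "off x \<le> \<rho> / K"
    then obtain i where i: "i \<notin> C" "P x $ i \<noteq> 0" by (auto simp: V_def)
    have le: "\<rho> / K \<le> \<rho> / KK i" using a(1) KK(1)[OF i(1)] K(3)[of i] by (intro divide_left_mono) auto
    from KK(2)[OF i(1) a(1) i(2)] a(3) le obtain n where n: "\<forall>i\<in>C. \<bar>l i (vec_of_int n)\<bar> \<le> K0"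
      "\<rho> / KK i \<le> off (A n *v x)" "off (A n *v x) \<le> \<rho>" by fastforce
    show "\<exists>n. (\<forall>i\<in>C. \<bar>l i (vec_of_int n)\<bar> \<le> K) \<and> \<rho> / K \<le> off (A n *v x) \<and> off (A n *v x) \<le> \<rho>"
      using n K(2) le by (intro exI[of _ n]) force
  qed
qed

text \<open>The full preimage in R^d of the translated torsion points of the torus, since lattice
  vectors are rational.\<close>

definition translated_torsion :: "(real^'d) set" where
  "translated_torsion = {q + v | q v. (\<forall>j. q $ j \<in> \<rat>) \<and> v \<in> V}"

lemma A_entries: "A n $ i $ j \<in> \<int>"
proof -
  have "axis j 1 \<in> int_lattice" by (simp add: int_lattice_def axis_def)
  from A_int[OF this, of n] show ?thesis by (simp add: int_lattice_def matrix_vector_mult_basis column_def)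
qed

lemma V_A: "A n *v v \<in> V \<longleftrightarrow> v \<in> V"
  by (simp add: V_def P_A z_nz)

text \<open>\<open>A m - mat 1\<close> is an integer matrix without kernel, because no eigenvalue of
  \<open>A m\<close> is 1. So \<gamma> has a rational preimage \<open>q\<close>, and x - q lies in
  \<open>V\<close> because the matrix multiplies each eigencoordinate by a nonzero scalar.\<close>

lemma translated_torsion_fixed:
  assumes m: "m \<noteq> 0" and x: "A m *v x - x - \<gamma> \<in> V" and g: "\<gamma> \<in> int_lattice"
  shows "x \<in> translated_torsion"
proof -
  define B where "B = A m - mat 1"
  have B: "B *v y = A m *v y - y" for y by (simp add: B_def matrix_vector_mult_diff_rdistrib)
  have PB: "P (B *v y) $ i = (z m i - 1) * P y $ i" for y i
    by (simp add: B linear_diff[OF P_lin] P_A algebra_simps)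
  have z1: "z m i \<noteq> 1" for i using z_one m by blast
  have "B $ i $ j \<in> \<int>" for i j using A_entries[of m i j] by (auto simp: B_def mat_def)
  moreover have "y = 0" if "B *v y = 0" for y
  proof -
    have "P y = 0" using PB[of y] that z1 by (simp add: vec_eq_iff linear_0[OF P_lin])
    then show ?thesis using P_inj linear_0[OF P_lin] by (metis injD)
  qed
  ultimately obtain q where q: "\<forall>j. q $ j \<in> \<rat>" "B *v q = \<gamma>"
    using g by (rule integer_matrix_rational_preimage)
  have "B *v (x - q) \<in> V" using x by (simp add: matrix_vector_mult_diff_distrib q(2)) (simp add: B)
  then have "x - q \<in> V" using z1 by (simp add: V_def PB)
  then show ?thesis unfolding translated_torsion_def using q(1)
    by (intro CollectI exI[of _ q] exI[of _ "x - q"]) simp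
qed

text \<open>Among the first N + 1 points of the orbit of \<open>x\<close> under multiples of a small
  \<open>m\<close>, two are \<eta>-close modulo the lattice. If their difference were in
  \<open>V\<close>, a nonzero multiple of \<open>m\<close> would fix \<open>x\<close> modulo
  \<open>V\<close> and the lattice, and \<open>translated_torsion_fixed\<close> would apply.\<close>

lemma nearby_pair:
  assumes M: "invariant M" "(x, t) \<in> M" and x: "x \<notin> translated_torsion" and e: "\<eta> > 0"
  shows "\<exists>y y' s s'. (y, s) \<in> M \<and> (y', s') \<in> M \<and> norm (y - y') < \<eta> \<and> y - y' \<notin> V \<and> norm (s - t) < \<eta>
      \<and> norm (s' - t) < \<eta>"
proof -
  obtain N where N: "\<And>f :: nat \<Rightarrow> real^'d. (\<And>j. norm (f j) \<le> real CARD('d)) \<Longrightarrow> \<exists>j j'. j < j' \<and> j' \<le> N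
      \<and> norm (f j' - f j) < \<eta>"
    using pigeonhole_bounded_sequence[OF e, of "real CARD('d)"] by blast
  obtain h where h: "h \<in> H" "h \<noteq> 0" by (rule H_nonzero)
  have lh: "\<And>i. i \<in> S \<Longrightarrow> l i h = 0" using h(1) by (auto simp: H_def)
  \<comment> \<open>\<open>N\<close> is known before \<open>m\<close>, so \<open>m\<close> can be so
    small on \<open>S\<close> that up to \<open>N\<close> multiples of it move the second coordinate
    by less than \<eta>.\<close>
  define \<epsilon> where "\<epsilon> = \<eta> / (2 * real CARD('i) * (real N + 1))"
  have e0: "\<epsilon> > 0" using e by (simp add: \<epsilon>_def)
  obtain m where m: "m \<noteq> 0" "\<And>i. i \<in> S \<Longrightarrow> \<bar>l i (vec_of_int m)\<bar> < \<epsilon>"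
    using almost_identity_element'[OF h(2) lh e0] by metis
  have "\<forall>j. \<exists>\<gamma>\<in>int_lattice. norm (A (of_nat j *s m) *v x + \<gamma>) \<le> real CARD('d)"
    using lattice_reduction by blast
  then obtain g where g: "\<And>j. g j \<in> int_lattice" "\<And>j. norm (A (of_nat j *s m) *v x + g j) \<le> real CARD('d)"
    by metis
  obtain j j' where j: "j < j'" "j' \<le> N" "norm ((A (of_nat j' *s m) *v x + g j') - (A (of_nat j *s m) *v x
      + g j)) < \<eta>"
    using N[of "\<lambda>j. A (of_nat j *s m) *v x + g j"] g(2) by blast
  have lam: "norm (lamS (of_nat k *s m)) < \<eta>" if "k \<le> N" for k
  proof -
    have "norm (lamS m) \<le> real CARD('i) * \<epsilon>" using m(2) e0 by (intro norm_lamS_le) (auto intro: less_imp_le)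
    then have "norm (lamS (of_nat k *s m)) \<le> real k * (real CARD('i) * \<epsilon>)"
      by (simp add: lamS_nat mult_left_mono)
    also have "\<dots> \<le> real N * (real CARD('i) * \<epsilon>)" using that e0 by (intro mult_right_mono) auto
    also have "real CARD('i) * \<epsilon> = \<eta> / (2 * (real N + 1))" by (simp add: \<epsilon>_def)
    also have "real N * (\<eta> / (2 * (real N + 1))) < \<eta>"
      using e mult_nonneg_nonneg[of "real N" \<eta>] by (simp add: divide_less_eq algebra_simps add_nonneg_pos)
    finally show ?thesis .
  qed
  have inM: "(A (of_nat k *s m) *v x + g k, t + lamS (of_nat k *s m)) \<in> M" for k
    using M g(1) by (auto simp: invariant_def)
  show ?thesis
  proof (intro exI conjI)
    show "(A (of_nat j' *s m) *v x + g j') - (A (of_nat j *s m) *v x + g j) \<notin> V"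
    proof
      assume v: "(A (of_nat j' *s m) *v x + g j') - (A (of_nat j *s m) *v x + g j) \<in> V"
      define p where "p = of_nat (j' - j) *s m"
      define n where "n = of_nat j *s m"
      have jn: "of_nat j' *s m = n + p"
        using j(1) by (simp add: n_def p_def vec_eq_iff of_nat_diff algebra_simps)
      \<comment> \<open>Pulling back by \<open>A (- n)\<close> turns the difference of two orbit
        points into the displacement of \<open>x\<close> under p = (j' - j) m.\<close>
      have "A (- n) *v ((A (n + p) *v x + g j') - (A n *v x + g j)) \<in> V"
        using v by (simp add: V_A jn n_def)
      also have "A (- n) *v ((A (n + p) *v x + g j') - (A n *v x + g j)) = A p *v x - x - A (- n) *v (g j
          - g j')"
        by (simp add: A_add_v matrix_vector_mult_diff_distrib matrix_vector_right_distrib A_minus)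
      finally have "A p *v x - x - A (- n) *v (g j - g j') \<in> V" .
      moreover have "p \<noteq> 0" using m(1) j(1) by (auto simp: p_def vec_eq_iff)
      moreover have "A (- n) *v (g j - g j') \<in> int_lattice" using g(1) by (intro A_int int_lattice_diff)
      ultimately have "x \<in> translated_torsion" using translated_torsion_fixed by blast
      with x show False by simp
    qed
  qed (use j inM lam[of j] lam[of j'] in auto)
qed

end

section \<open>Differences within a fibre that approach V\<close>

lemma convergent_triple:
  fixes a :: "nat \<Rightarrow> 'a::euclidean_space" and b :: "nat \<Rightarrow> 'b::euclidean_space" and c ::
      "nat \<Rightarrow> 'c::euclidean_space"
  assumes "\<And>k. norm (a k) \<le> Ka" "\<And>k. norm (b k) \<le> Kb" "\<And>k. norm (c k) \<le> Kc"
  shows "\<exists>r x y w. strict_mono (r :: nat \<Rightarrow> nat) \<and> (\<lambda>k. a (r k)) \<longlonglongrightarrow> x \<and> (\<lambda>k. b (r k)) \<longlonglongrightarrow> y \<and> (\<lambda>k. c (r k)) \<longlonglongrightarrow> w"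
proof -
  have "bounded (range (\<lambda>k. (a k, b k, c k)))"
  proof (rule boundedI)
    fix p assume "p \<in> range (\<lambda>k. (a k, b k, c k))"
    then obtain k where "p = (a k, b k, c k)" by auto
    then show "norm p \<le> Ka + (Kb + Kc)"
      using norm_Pair_le[of "a k" "(b k, c k)"] norm_Pair_le[of "b k"
          "c k"] assms(1)[of k] assms(2)[of k] assms(3)[of k] by simp
  qed
  then obtain lim r where r: "strict_mono r" "((\<lambda>k. (a k, b k, c k)) \<circ> r) \<longlonglongrightarrow> lim"
    using bounded_imp_convergent_subsequence by blast
  obtain x y w where lim: "lim = (x, y, w)" by (cases lim) auto
  from tendsto_fst[OF r(2)] tendsto_fst[OF tendsto_snd[OF r(2)]] tendsto_snd[OF tendsto_snd[OF r(2)]]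
  have "strict_mono r \<and> (\<lambda>k. a (r k)) \<longlonglongrightarrow> x \<and> (\<lambda>k. b (r k)) \<longlonglongrightarrow> y \<and> (\<lambda>k. c (r k)) \<longlonglongrightarrow> w"
    using r(1) by (simp add: lim o_def)
  then show ?thesis by blast
qed

context torus_flow
begin

lemma invariant_closed: "invariant M \<Longrightarrow> closed M"
  and invariant_shift: "invariant M \<Longrightarrow> (x, t) \<in> M \<Longrightarrow> \<gamma> \<in> int_lattice \<Longrightarrow> (x + \<gamma>, t) \<in> M"
  and invariant_act: "invariant M \<Longrightarrow> (x, t) \<in> M \<Longrightarrow> (A n *v x, t + lamS n) \<in> M"
  by (auto simp: invariant_def)

lemma limit_in_invariant:
  assumes "invariant M" "\<And>k. (a k, b k) \<in> M" "a \<longlonglongrightarrow> x" "b \<longlonglongrightarrow> y"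
  shows "(x, y) \<in> M"
  using closed_sequentially[OF invariant_closed[OF assms(1)], of "\<lambda>k. (a k, b k)" "(x, y)"] assms
  by (auto intro: tendsto_Pair)

lemma tendsto_off: "a \<longlonglongrightarrow> x \<Longrightarrow> (\<lambda>k. off (a k)) \<longlonglongrightarrow> off x"
  by (rule continuous_on_tendsto_compose[OF continuous_off]) auto

lemma tendsto_P: "a \<longlonglongrightarrow> x \<Longrightarrow> (\<lambda>k. P (a k) $ i) \<longlonglongrightarrow> P x $ i"
  using P_lin by (intro tendsto_vec_nth bounded_linear.tendsto[of P]) (simp_all add: linear_conv_bounded_linear)

lemma not_V_off: "x \<notin> V \<longleftrightarrow> off x > 0"
  using off_pos off_eq_0 by force

text \<open>The pairs of \<open>nearby_pair\<close> lie in slightly different fibres, and simply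
  closing the gap could push the difference into \<open>V\<close>. So it is first expanded to
  transverse size between \<rho> / K1 and \<rho>; as the gap tends to 0, the two limits share a
  fibre and their difference stays off \<open>V\<close>. \<open>K\<close> is independent of
  \<delta>, as \<open>accumulates\<close> requires.\<close>

lemma small_differences:
  assumes M: "invariant M" "(x, t) \<in> M" and x: "x \<notin> translated_torsion"
  obtains K where "\<And>\<delta>. \<delta> > 0 \<Longrightarrow> \<exists>y y' s. (y, s) \<in> M \<and> (y', s) \<in> M \<and> y - y' \<notin> V \<and> off (y - y') \<le> \<delta>
      \<and> norm (y - y') \<le> K \<and> norm s \<le> K"
proof -
  obtain K1 where K1: "K1 \<ge> 1"
    "\<And>\<rho> x. \<rho> > 0 \<Longrightarrow> x \<notin> V \<Longrightarrow> off x \<le> \<rho> / K1 \<Longrightarrow>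
        \<exists>n. (\<forall>i\<in>C. \<bar>l i (vec_of_int n)\<bar> \<le> K1) \<and> \<rho> / K1 \<le> off (A n *v x) \<and> off (A n *v x) \<le> \<rho>"
    by (rule expand_any) blast
  obtain B1 where B1: "B1 > 0" "\<And>x K. (\<And>i. cmod (P x $ i) \<le> K) \<Longrightarrow> norm x \<le> B1 * K"
    by (rule norm_le_coord_bound) blast
  obtain B2 where B2: "B2 > 0" "\<And>x i. cmod (P x $ i) \<le> B2 * norm x" "\<And>x. off x \<le> B2 * norm x"
    by (rule coord_le_norm) blast
  define Ka where "Ka = B1 * (1 + exp K1 * B2)"
  define Kb where "Kb = norm t + 1 + real CARD('i) * K1"
  show ?thesis
  proof (rule that[of "max Ka Kb"])
    fix \<delta> :: real assume "\<delta> > 0"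
    define \<rho> where "\<rho> = min \<delta> 1"
    have \<rho>: "\<rho> > 0" "\<rho> \<le> \<delta>" "\<rho> \<le> 1" using \<open>\<delta> > 0\<close> by (auto simp: \<rho>_def)
    define R where "R = (\<lambda>k p p' s s'. (p, s) \<in> M \<and> (p', s') \<in> M \<and> \<rho> / K1 \<le> off (p - p') \<and> off (p - p') \<le> \<rho>
        \<and> norm (p - p') \<le> Ka
        \<and> norm p \<le> real CARD('d) \<and> norm s \<le> Kb \<and> norm (s - s') \<le> 2 * (1 / real (Suc k)))"
    have "\<exists>p p' s s'. R k p p' s s'" for k
    proof -
      \<comment> \<open>The second bound makes the transverse size start below \<rho> / K1, where
        \<open>expand_any\<close> applies.\<close>
      define \<eta> where "\<eta> = min (1 / real (Suc k)) (\<rho> / K1 / B2)"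
      have \<eta>: "\<eta> > 0" "\<eta> \<le> 1 / real (Suc k)" "\<eta> \<le> \<rho> / K1 / B2" using \<rho> K1 B2 by (auto simp: \<eta>_def)
      have \<eta>1: "\<eta> \<le> 1" using \<eta>(2) by (rule order_trans) simp
      from nearby_pair[OF M x \<eta>(1)] obtain y y' s s'
        where y: "(y, s) \<in> M" "(y', s') \<in> M" "norm (y - y') < \<eta>" "y - y' \<notin> V"
        "norm (s - t) < \<eta>" "norm (s' - t) < \<eta>" by blast
      have "off (y - y') \<le> B2 * \<eta>" using B2(3)[of "y - y'"] y(3) B2(1) by (smt (verit) mult_left_mono)
      also have "\<dots> \<le> \<rho> / K1" using \<eta>(3) B2(1) by (simp only: pos_le_divide_eq mult.commute[of B2])
      finally obtain n where n: "\<And>i. i \<in> C \<Longrightarrow> \<bar>l i (vec_of_int n)\<bar> \<le> K1" "\<rho> / K1 \<le> off (A n *v (y - y'))"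
          "off (A n *v (y - y')) \<le> \<rho>"
        using K1(2)[OF \<rho>(1) y(4)] by blast
      obtain \<gamma> where \<gamma>: "\<gamma> \<in> int_lattice" "norm (A n *v y + \<gamma>) \<le> real CARD('d)" using lattice_reduction by blast
      define p p' where "p = A n *v y + \<gamma>" and "p' = A n *v y' + \<gamma>"
      have pp: "p - p' = A n *v (y - y')" by (simp add: p_def p'_def matrix_vector_mult_diff_distrib)
      have "norm (p - p') \<le> Ka" unfolding Ka_def
      proof (rule B1(2))
        fix i
        show "cmod (P (p - p') $ i) \<le> 1 + exp K1 * B2"
        proof (cases "i \<in> C")
          case True
          have "cmod (P (p - p') $ i) = exp (l i (vec_of_int n)) * cmod (P (y - y') $ i)"
            by (simp add: pp P_A norm_mult l_z)
          also have "\<dots> \<le> exp K1 * (B2 * 1)"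
          proof (rule mult_mono)
            have "B2 * norm (y - y') \<le> B2 * 1" using y(3) \<eta>1 B2(1) by (intro mult_left_mono) auto
            then show "cmod (P (y - y') $ i) \<le> B2 * 1" using B2(2)[of "y - y'" i] by linarith
          qed (use n(1)[OF True] in \<open>auto simp: abs_le_iff\<close>)
          finally show ?thesis by simp
        next
          case False
          have "0 \<le> exp K1 * B2" using B2(1) by simp
          with off_coord[OF False, of "p - p'"] n(3) \<rho> show ?thesis unfolding pp by linarith
        qed
      qed
      moreover have "norm (s + lamS n) \<le> Kb"
      proof -
        have "norm (lamS n) \<le> real CARD('i) * K1" using n(1) S_subset_C K1(1) by (intro norm_lamS_le) auto
        moreover have "norm s \<le> norm t + 1" using norm_triangle_ineq2[of s t] y(5) \<eta>1 by linarith
        ultimately show ?thesis using norm_triangle_ineq[of s "lamS n"] by (simp add: Kb_def)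
      qed
      moreover have "norm ((s + lamS n) - (s' + lamS n)) \<le> 2 * (1 / real (Suc k))"
        using norm_triangle_ineq4[of "s - t" "s' - t"] y(5,6) \<eta>(2) by simp
      moreover have "(p, s + lamS n) \<in> M" "(p', s' + lamS n) \<in> M"
        unfolding p_def p'_def by (intro invariant_shift[OF M(1)] invariant_act[OF M(1)] y(1,2) \<gamma>(1))+
      ultimately have "R k p p' (s + lamS n) (s' + lamS n)"
        using n(2,3) \<gamma>(2) unfolding pp[symmetric] p_def[symmetric] R_def by simp
      then show ?thesis by blast
    qed
    then obtain p p' s s' where "\<And>k. R k (p k) (p' k) (s k) (s' k)" by metis
    then have pk: "\<And>k. (p k, s k) \<in> M" "\<And>k. (p' k, s' k) \<in> M" "\<And>k. \<rho> / K1 \<le> off (p k - p' k)"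
       "\<And>k. off (p k - p' k) \<le> \<rho>" "\<And>k. norm (p k - p' k) \<le> Ka"
        "\<And>k. norm (p k) \<le> real CARD('d)" "\<And>k. norm (s k) \<le> Kb" "\<And>k. norm (s k - s' k) \<le> 2 * (1 / real (Suc k))"
      by (simp_all only: R_def)
    from convergent_triple[of p _ "\<lambda>k. p k - p' k" _ s, OF pk(6) pk(5) pk(7)] obtain r a d b
      where r: "strict_mono r"
      "(\<lambda>k. p (r k)) \<longlonglongrightarrow> a" "(\<lambda>k. p (r k) - p' (r k)) \<longlonglongrightarrow> d" "(\<lambda>k. s (r k)) \<longlonglongrightarrow> b" by blast
    have "(\<lambda>k. 2 * (1 / real (Suc k))) \<longlonglongrightarrow> 0" using tendsto_mult[OF tendsto_const LIMSEQ_Suc[OF lim_1_over_n]]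
      by simp
    then have "(\<lambda>k. s k - s' k) \<longlonglongrightarrow> 0"
      by (rule Lim_null_comparison[rotated]) (use pk(8) in auto)
    then have "(\<lambda>k. s (r k) - s' (r k)) \<longlonglongrightarrow> 0" using r(1) by (rule LIMSEQ_subseq_LIMSEQ[unfolded o_def])
    from tendsto_diff[OF r(4) this] have sb: "(\<lambda>k. s' (r k)) \<longlonglongrightarrow> b" by simp
    from tendsto_diff[OF r(2,3)] have pa: "(\<lambda>k. p' (r k)) \<longlonglongrightarrow> a - d" by simp
    have "(a, b) \<in> M" by (rule limit_in_invariant[OF M(1) _ r(2,4)]) (rule pk)
    moreover have "(a - d, b) \<in> M" by (rule limit_in_invariant[OF M(1) _ pa sb]) (rule pk)
    moreover have "off d \<le> \<rho>" by (rule LIMSEQ_le_const2[OF tendsto_off[OF r(3)]]) (use pk in auto)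
    moreover have "\<rho> / K1 \<le> off d" by (rule LIMSEQ_le_const[OF tendsto_off[OF r(3)]]) (use pk in auto)
    moreover have "norm d \<le> Ka" by (rule LIMSEQ_le_const2[OF tendsto_norm[OF r(3)]]) (use pk in auto)
    moreover have "norm b \<le> Kb" by (rule LIMSEQ_le_const2[OF tendsto_norm[OF r(4)]]) (use pk in auto)
    moreover have "d \<notin> V" using \<open>\<rho> / K1 \<le> off d\<close> \<rho>(1) K1(1) unfolding not_V_off by (smt (verit) divide_pos_pos)
    ultimately have "(a, b) \<in> M \<and> (a - d, b) \<in> M \<and> a - (a - d) \<notin> V \<and> off (a - (a - d)) \<le> \<delta>
        \<and> norm (a - (a - d)) \<le> max Ka Kb \<and> norm b \<le> max Ka Kb"
      using \<rho>(2) by (simp add: max.coboundedI1 max.coboundedI2)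
    then show "\<exists>y y' s. (y, s) \<in> M \<and> (y', s) \<in> M \<and> y - y' \<notin> V \<and> off (y - y') \<le> \<delta> \<and> norm (y - y') \<le> max Ka Kb
        \<and> norm s \<le> max Ka Kb"
      by blast
  qed
qed

text \<open>The common bound on \<open>u\<close> and \<open>s\<close> provides the compactness for
  limits of the expanded points.\<close>

definition accumulates :: "((real^'d) \<times> (real^'i)) set \<Rightarrow> bool" where
  "accumulates M \<longleftrightarrow> (\<exists>K. \<forall>\<delta>>0. \<exists>u s. (u, s) \<in> M \<and> norm s \<le> K \<and> norm u \<le> K \<and> u \<notin> V \<and> off u \<le> \<delta>)"

text \<open>Points approaching \<open>V\<close> are moved along \<open>h0\<close> until their
  transverse part has size of order 1. Components that \<open>h0\<close> does not expand started
  arbitrarily small and vanish in the limit, while \<open>off\<close> stays above 1 / K1; hence only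
  expanded ones are left.\<close>

lemma expanded_limit_point:
  assumes M: "invariant M" and acc: "accumulates M"
  obtains u s h0 where "(u, s) \<in> M" "h0 \<in> H" "u \<notin> V" "\<And>i. i \<notin> C \<Longrightarrow> P u $ i \<noteq> 0 \<Longrightarrow> l i h0 > 0"
proof -
  from acc obtain K where K: "\<And>\<delta>. \<delta> > 0 \<Longrightarrow> \<exists>u s. (u, s) \<in> M \<and> norm s \<le> K \<and> norm u \<le> K \<and> u \<notin> V \<and> off u \<le> \<delta>"
    unfolding accumulates_def by blast
  \<comment> \<open>One index can serve for all \<delta>: otherwise the minimum of finitely many
    thresholds would contradict the accumulation.\<close>
  have "\<exists>i0. i0 \<notin> C \<and> (\<forall>\<delta>>0. \<exists>u s. (u, s) \<in> M \<and> norm s \<le> K \<and> norm u \<le> K \<and> P u $ i0 \<noteq> 0 \<and> off u \<le> \<delta>)"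
  proof (rule ccontr)
    assume "\<not> ?thesis"
    then have "\<forall>i. \<exists>\<delta>. i \<notin> C \<longrightarrow> \<delta> > 0 \<and> \<not> (\<exists>u s. (u, s) \<in> M \<and> norm s \<le> K \<and> norm u \<le> K \<and> P u $ i \<noteq> 0 \<and> off u \<le> \<delta>)"
      by blast
    then obtain \<delta> where \<delta>: "\<And>i. i \<notin> C \<Longrightarrow> \<delta> i > 0" "\<And>i u s. i \<notin> C \<Longrightarrow> (u, s) \<in> M \<Longrightarrow> norm s \<le> K \<Longrightarrow> norm u \<le> K
        \<Longrightarrow> P u $ i \<noteq> 0 \<Longrightarrow> \<not> off u \<le> \<delta> i" by metis
    define \<delta>0 where "\<delta>0 = Min (insert 1 (\<delta> ` (- C)))"
    have "\<delta>0 > 0" using \<delta>(1) by (auto simp: \<delta>0_def)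
    from K[OF this] obtain u s where u: "(u, s) \<in> M" "norm s \<le> K" "norm u \<le> K" "u \<notin> V" "off u \<le> \<delta>0" by blast
    then obtain i where i: "i \<notin> C" "P u $ i \<noteq> 0" by (auto simp: V_def)
    have "\<delta>0 \<le> \<delta> i" using i(1) unfolding \<delta>0_def by (intro Min_le) auto
    with \<delta>(2)[OF i(1) u(1-3) i(2)] u(5) show False by simp
  qed
  then obtain i0 where i0: "i0 \<notin> C"
    "\<And>\<delta>. \<delta> > 0 \<Longrightarrow> \<exists>u s. (u, s) \<in> M \<and> norm s \<le> K \<and> norm u \<le> K \<and> P u $ i0 \<noteq> 0 \<and> off u \<le> \<delta>" by blast
  obtain h0 where h0: "h0 \<in> H" "l i0 h0 > 0" using outside_C_direction[OF i0(1)] by blast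
  obtain K0 where K0: "K0 > 0" "\<And>i h. \<bar>l i (vec_of_int (floor_vec h)) - l i h\<bar> \<le> K0" by (rule l_floor_vec) blast
  obtain K1 where K1: "K1 \<ge> 1"
        "\<And>\<rho> x. \<rho> > 0 \<Longrightarrow> P x $ i0 \<noteq> 0 \<Longrightarrow> off x \<le> \<rho> / K1 \<Longrightarrow>
        \<exists>t\<ge>0. \<rho> / K1 \<le> off (A (floor_vec (t *\<^sub>R h0)) *v x) \<and> off (A (floor_vec (t *\<^sub>R h0)) *v x) \<le> \<rho>"
    by (rule expand[OF h0(2) i0(1)]) blast
  obtain B1 where B1: "B1 > 0" "\<And>x K. (\<And>i. cmod (P x $ i) \<le> K) \<Longrightarrow> norm x \<le> B1 * K"
    by (rule norm_le_coord_bound) blast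
  obtain B2 where B2: "B2 > 0" "\<And>x i. cmod (P x $ i) \<le> B2 * norm x" "\<And>x. off x \<le> B2 * norm x"
    by (rule coord_le_norm) blast
  have Kpos: "K \<ge> 0" using K[of 1] norm_ge_zero order_trans by (metis zero_less_one)
  have nC: "\<bar>l j (vec_of_int (floor_vec (t *\<^sub>R h0)))\<bar> \<le> K0" if "j \<in> C" for j t
    using K0(2)[of j "t *\<^sub>R h0"] that h0(1) by (simp add: C_def l_scale)
  define Ka where "Ka = B1 * (1 + exp K0 * (B2 * K))"
  define R where "R = (\<lambda>k w s. (w, s) \<in> M \<and> norm w \<le> Ka \<and> norm s \<le> K + real CARD('i) * K0 \<and> 1 / K1 \<le> off w \<and>
      (\<forall>i. i \<notin> C \<longrightarrow> l i h0 \<le> 0 \<longrightarrow> cmod (P w $ i) \<le> exp K0 * (1 / real (Suc k))))"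
  have "\<exists>w s. R k w s" for k
  proof -
    have "min (1 / K1) (1 / real (Suc k)) > 0" using K1(1) by simp
    from i0(2)[OF this] obtain u s where u: "(u, s) \<in> M" "norm s \<le> K" "norm u \<le> K" "P u $ i0 \<noteq> 0"
      "off u \<le> 1 / K1" "off u \<le> 1 / real (Suc k)" by auto
    from K1(2)[of 1, OF _ u(4,5)] obtain t where t: "t \<ge> 0" "1 / K1 \<le> off (A (floor_vec (t *\<^sub>R h0)) *v u)"
        "off (A (floor_vec (t *\<^sub>R h0)) *v u) \<le> 1" by auto
    define n where "n = floor_vec (t *\<^sub>R h0)"
    have "norm (A n *v u) \<le> Ka" unfolding Ka_def
    proof (rule B1(2))
      fix i
      have nn: "0 \<le> exp K0 * (B2 * K)" using B2(1) Kpos by simp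
      show "cmod (P (A n *v u) $ i) \<le> 1 + exp K0 * (B2 * K)"
      proof (cases "i \<in> C")
        case True
        have "cmod (P (A n *v u) $ i) = exp (l i (vec_of_int n)) * cmod (P u $ i)"
          by (simp add: P_A norm_mult l_z)
        also have "\<dots> \<le> exp K0 * (B2 * K)"
        proof (rule mult_mono)
          have "B2 * norm u \<le> B2 * K" using u(3) B2(1) by (intro mult_left_mono) auto
          then show "cmod (P u $ i) \<le> B2 * K" using B2(2)[of u i] by linarith
        qed (use nC[OF True, of t] in \<open>auto simp: abs_le_iff n_def\<close>)
        finally show ?thesis by simp
      next
        case False
        with off_coord[OF False, of "A n *v u"] t(3) nn show ?thesis unfolding n_def by linarith
      qed
    qed
    moreover have "norm (s + lamS n) \<le> K + real CARD('i) * K0"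
    proof -
      have "norm (lamS n) \<le> real CARD('i) * K0" using nC S_subset_C K0(1)
        by (intro norm_lamS_le) (auto simp: n_def)
      then show ?thesis using norm_triangle_ineq[of s "lamS n"] u(2) by simp
    qed
    moreover have "cmod (P (A n *v u) $ i) \<le> exp K0 * (1 / real (Suc k))" if "i \<notin> C" "l i h0 \<le> 0" for i
    proof -
      have "cmod (P (A n *v u) $ i) = exp (l i (vec_of_int n)) * cmod (P u $ i)"
        by (simp add: P_A norm_mult l_z)
      also have "\<dots> \<le> exp K0 * (1 / real (Suc k))"
      proof (rule mult_mono)
        \<comment> \<open>Nonnegative time is essential here: a component contracted by
          \<open>h0\<close> would grow at negative times.\<close>
        have "t * l i h0 \<le> 0" using t(1) that(2) by (simp add: mult_nonneg_nonpos)
        then show "exp (l i (vec_of_int n)) \<le> exp K0" using K0(2)[of i "t *\<^sub>R h0"]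
          by (simp add: n_def l_scale abs_le_iff)
        show "cmod (P u $ i) \<le> 1 / real (Suc k)" using off_coord[OF that(1), of u] u(6) by linarith
      qed auto
      finally show ?thesis .
    qed
    moreover have "(A n *v u, s + lamS n) \<in> M" by (rule invariant_act[OF M u(1)])
    ultimately have "R k (A n *v u) (s + lamS n)" using t(2) unfolding n_def[symmetric] R_def by simp
    then show ?thesis by blast
  qed
  then obtain w s where "\<And>k. R k (w k) (s k)" by metis
  then have w: "\<And>k. (w k, s k) \<in> M" "\<And>k. norm (w k) \<le> Ka" "\<And>k. norm (s k) \<le> K + real CARD('i) * K0"
     "\<And>k. 1 / K1 \<le> off (w k)" "\<And>k i. i \<notin> C \<Longrightarrow> l i h0 \<le> 0 \<Longrightarrow> cmod (P (w k) $ i) \<le> exp K0 * (1 / real (Suc k))"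
    by (simp_all add: R_def)
  from convergent_triple[of w _ s _ s, OF w(2) w(3) w(3)] obtain r a b where r: "strict_mono r"
      "(\<lambda>k. w (r k)) \<longlonglongrightarrow> a" "(\<lambda>k. s (r k)) \<longlonglongrightarrow> b" by blast
  show ?thesis
  proof (rule that)
    show "(a, b) \<in> M" by (rule limit_in_invariant[OF M _ r(2,3)]) (rule w)
    show "h0 \<in> H" by fact
    have "1 / K1 \<le> off a" by (rule LIMSEQ_le_const[OF tendsto_off[OF r(2)]]) (use w in auto)
    then show "a \<notin> V" using K1(1) unfolding not_V_off by (smt (verit) divide_pos_pos)
    fix i assume i: "i \<notin> C" "P a $ i \<noteq> 0"
    show "l i h0 > 0"
    proof (rule ccontr)
      assume n: "\<not> ?thesis"
      have "(\<lambda>k. exp K0 * (1 / real (Suc k))) \<longlonglongrightarrow> exp K0 * 0"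
        by (intro tendsto_mult tendsto_const LIMSEQ_Suc[OF lim_1_over_n])
      then have "(\<lambda>k. exp K0 * (1 / real (Suc k))) \<longlonglongrightarrow> 0" by simp
      then have "(\<lambda>k. P (w k) $ i) \<longlonglongrightarrow> 0"
        by (rule Lim_null_comparison[rotated]) (use w(5)[OF i(1)] n in auto)
      then have "(\<lambda>k. P (w (r k)) $ i) \<longlonglongrightarrow> 0" using r(1) by (rule LIMSEQ_subseq_LIMSEQ[unfolded o_def])
      with tendsto_P[OF r(2), of i] have "P a $ i = 0" by (rule LIMSEQ_unique)
      with i(2) show False by simp
    qed
  qed
qed

end

section \<open>From accumulation at V to functionals proportional modulo L_S\<close>

context torus_flow
begin

definition outer_support :: "real^'d \<Rightarrow> 'i set" where
  "outer_support u = {i. i \<notin> C \<and> P u $ i \<noteq> 0}"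

lemma outer_support_empty: "outer_support u = {} \<longleftrightarrow> u \<in> V"
  by (auto simp: outer_support_def V_def)

text \<open>Along the ray of \<open>h1\<close> the components with negative functional decay to 0;
  those with functional 0 change only by the rounding factor, hence stay away from 0 in the limit.
  Nothing grows, so limits exist.\<close>

lemma contract_support:
  assumes M: "invariant M" "(u, s) \<in> M" and h1: "h1 \<in> H" "\<And>i. i \<in> outer_support u \<Longrightarrow> l i h1 \<le> 0"
  obtains u' s' where "(u', s') \<in> M" "outer_support u' = {i \<in> outer_support u. l i h1 = 0}"
proof -
  obtain K0 where K0: "K0 > 0" "\<And>i h. \<bar>l i (vec_of_int (floor_vec h)) - l i h\<bar> \<le> K0" by (rule l_floor_vec) blast
  obtain B1 where B1: "B1 > 0" "\<And>x K. (\<And>i. cmod (P x $ i) \<le> K) \<Longrightarrow> norm x \<le> B1 * K"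
    by (rule norm_le_coord_bound) blast
  define n where "n = (\<lambda>j::nat. floor_vec (real j *\<^sub>R h1))"
  have ln: "\<bar>l i (vec_of_int (n j)) - real j * l i h1\<bar> \<le> K0" for i j
    using K0(2)[of i "real j *\<^sub>R h1"] by (simp add: n_def l_scale)
  have lC: "l i h1 = 0" if "i \<in> C" for i using that h1(1) by (simp add: C_def)
  have Pn: "cmod (P (A (n j) *v u) $ i) = exp (l i (vec_of_int (n j))) * cmod (P u $ i)" for i j
    by (simp add: P_A norm_mult l_z)
  have bd: "norm (A (n j) *v u) \<le> B1 * (exp K0 * norm (P u))" for j
  proof (rule B1(2))
    fix i
    show "cmod (P (A (n j) *v u) $ i) \<le> exp K0 * norm (P u)"
    proof (cases "P u $ i = 0")
      case False
      then have "l i h1 \<le> 0" using h1(2)[of i] lC[of i] by (cases "i \<in> C") (auto simp: outer_support_def)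
      then have "real j * l i h1 \<le> 0" by (simp add: mult_nonneg_nonpos)
      then have "l i (vec_of_int (n j)) \<le> K0" using ln[of i j] by (simp add: abs_le_iff)
      then show ?thesis unfolding Pn using P_coord_bound[of u i] by (intro mult_mono) auto
    qed (simp add: P_A)
  qed
  have bl: "norm (s + lamS (n j)) \<le> norm s + real CARD('i) * K0" for j
  proof -
    have "norm (lamS (n j)) \<le> real CARD('i) * K0"
    proof (rule norm_lamS_le)
      fix i assume "i \<in> S"
      then have "l i h1 = 0" using S_subset_C lC by blast
      then show "\<bar>l i (vec_of_int (n j))\<bar> \<le> K0" using ln[of i j] by simp
    qed (use K0 in simp)
    then show ?thesis using norm_triangle_ineq[of s "lamS (n j)"] by simp
  qed
  from convergent_triple[of "\<lambda>j. A (n j) *v u" _ "\<lambda>j. s + lamS (n j)" _ "\<lambda>j. s + lamS (n j)", OF bd bl bl]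
      obtain r a b where r: "strict_mono r"
      "(\<lambda>k. A (n (r k)) *v u) \<longlonglongrightarrow> a" "(\<lambda>k. s + lamS (n (r k))) \<longlonglongrightarrow> b" by blast
  have "(a, b) \<in> M" by (rule limit_in_invariant[OF M(1) _ r(2,3)]) (rule invariant_act[OF M])
  moreover have "outer_support a = {i \<in> outer_support u. l i h1 = 0}"
  proof (rule Set.set_eqI)
    fix i
    have lim: "(\<lambda>k. cmod (P (A (n (r k)) *v u) $ i)) \<longlonglongrightarrow> cmod (P a $ i)"
      by (intro tendsto_norm tendsto_P r(2))
    show "i \<in> outer_support a \<longleftrightarrow> i \<in> {i \<in> outer_support u. l i h1 = 0}"
    proof (cases "i \<in> outer_support u")
      case False
      show ?thesis
      proof (cases "i \<in> C")
        case out: False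
        with False have "P u $ i = 0" by (simp add: outer_support_def)
        with lim have "(\<lambda>k. 0) \<longlonglongrightarrow> cmod (P a $ i)" by (simp add: P_A)
        then have "cmod (P a $ i) = 0" using LIMSEQ_unique tendsto_const by blast
        then show ?thesis using False out by (auto simp add: outer_support_def)
      qed (simp add: outer_support_def)
    next
      case True
      show ?thesis
      proof (cases "l i h1 = 0")
        case eq: True
        have "exp (- K0) * cmod (P u $ i) \<le> cmod (P a $ i)"
        proof (rule LIMSEQ_le_const[OF lim], intro exI allI impI)
          fix k
          have "- K0 \<le> l i (vec_of_int (n (r k)))" using ln[of i "r k"] eq by (simp add: abs_le_iff)
          then show "exp (- K0) * cmod (P u $ i) \<le> cmod (P (A (n (r k)) *v u) $ i)" unfolding Pn
            by (intro mult_right_mono) auto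
        qed
        moreover have "exp (- K0) * cmod (P u $ i) > 0" using True by (simp add: outer_support_def)
        ultimately have "cmod (P a $ i) > 0" by linarith
        then show ?thesis using True eq by (auto simp: outer_support_def)
      next
        case neq: False
        then have neg: "l i h1 < 0" using h1(2)[OF True] by simp
        have "filterlim (\<lambda>j. K0 + real j * l i h1) at_bot sequentially"
        proof -
          have "filterlim (\<lambda>j. l i h1 * real j) at_bot sequentially"
            by (rule filterlim_tendsto_neg_mult_at_bot[OF tendsto_const neg filterlim_real_sequentially])
          then show ?thesis
            using filterlim_tendsto_add_at_bot_iff[of "\<lambda>_. K0" K0 sequentially "\<lambda>j. l i h1 * real j"]
              by (simp add: mult.commute)
        qed
        then have "(\<lambda>j. exp (K0 + real j * l i h1)) \<longlonglongrightarrow> 0" by (rule filterlim_compose[OF exp_at_bot])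
        from tendsto_mult[OF this tendsto_const[of "cmod (P u $ i)"]]
        have "(\<lambda>j. exp (K0 + real j * l i h1) * cmod (P u $ i)) \<longlonglongrightarrow> 0" by simp
        then have "(\<lambda>j. P (A (n j) *v u) $ i) \<longlonglongrightarrow> 0"
        proof (rule Lim_null_comparison[rotated], intro always_eventually allI)
          fix j
          have "l i (vec_of_int (n j)) \<le> K0 + real j * l i h1" using ln[of i j] by (simp add: abs_le_iff)
          then show "cmod (P (A (n j) *v u) $ i) \<le> exp (K0 + real j * l i h1) * cmod (P u $ i)"
            unfolding Pn by (intro mult_right_mono) auto
        qed
        from LIMSEQ_subseq_LIMSEQ[OF this r(1)] have "(\<lambda>k. P (A (n (r k)) *v u) $ i) \<longlonglongrightarrow> 0" by (simp add: o_def)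
        with tendsto_P[OF r(2), of i] have "P a $ i = 0" by (rule LIMSEQ_unique)
        then show ?thesis using neq by (simp add: outer_support_def)
      qed
    qed
  qed
  ultimately show ?thesis by (rule that)
qed

text \<open>Among the points of \<open>M\<close> whose outer support is expanded by \<open>h0\<close>, one of minimal outer support
  works: \<open>contract_support\<close> would shrink the support if its functionals were not proportional.\<close>
lemma proportional_limit_point:
  assumes M: "invariant M" and acc: "accumulates M"
  obtains u s h where "(u, s) \<in> M" "u \<notin> V" "h \<in> H" "h \<noteq> 0" "\<And>i. i \<in> outer_support u \<Longrightarrow> l i h = 0"
proof -
  obtain u0 s0 h0 where u0: "(u0, s0) \<in> M" "h0 \<in> H" "u0 \<notin> V" "\<And>i. i \<notin> C \<Longrightarrow> P u0 $ i \<noteq> 0 \<Longrightarrow> l i h0 > 0"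
    by (rule expanded_limit_point[OF M acc]) blast
  define Q where "Q = (\<lambda>p. p \<in> M \<and> fst p \<notin> V \<and> (\<forall>i\<in>outer_support (fst p). l i h0 > 0))"
  have "Q (u0, s0)" using u0 by (auto simp: Q_def outer_support_def)
  from ex_has_least_nat[of Q, OF this, of "\<lambda>p. card (outer_support (fst p))"] obtain p where
    p: "Q p" "\<And>q. Q q \<Longrightarrow> card (outer_support (fst p)) \<le> card (outer_support (fst q))" by blast
  obtain u s where us: "p = (u, s)" by (cases p) auto
  have u: "(u, s) \<in> M" "u \<notin> V" "\<And>i. i \<in> outer_support u \<Longrightarrow> l i h0 > 0" using p(1) by (auto simp: Q_def us)
  have ne: "outer_support u \<noteq> {}" using u(2) outer_support_empty by blast
  \<comment> \<open>Here the hypothesis dim L_S \<le> r - 2 enters in full strength: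
    \<open>H\<close> has a direction independent of \<open>h0\<close>.\<close>
  have "\<not> H \<subseteq> span {h0}"
  proof
    assume "H \<subseteq> span {h0}"
    then have "dim H \<le> card {h0}" by (intro dim_le_card) auto
    then show False using dim_H unfolding H_def by simp
  qed
  then obtain h' where h': "h' \<in> H" "h' \<notin> span {h0}" by blast
  \<comment> \<open>The largest ratio makes \<open>h1\<close> nonpositive on the whole support and
    zero at a maximiser, so contraction keeps at least one component. Minimality of the support then
    forces all ratios to equal \<rho>.\<close>
  define \<rho> where "\<rho> = Max ((\<lambda>i. l i h' / l i h0) ` outer_support u)"
  define h1 where "h1 = h' - \<rho> *\<^sub>R h0"
  have h1H: "h1 \<in> H" unfolding h1_def using h'(1) u0(2) subspace_H by (intro subspace_diff subspace_scale)
  have "h1 \<noteq> 0"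
  proof
    assume "h1 = 0"
    then have "h' = \<rho> *\<^sub>R h0" by (simp add: h1_def)
    then show False using h'(2) by (simp add: span_base span_scale)
  qed
  have l1: "l i h1 = l i h' - \<rho> * l i h0" for i by (simp add: h1_def l_diff l_scale)
  have le: "l i h1 \<le> 0" if "i \<in> outer_support u" for i
  proof -
    have "l i h' / l i h0 \<le> \<rho>" unfolding \<rho>_def using that by (intro Max_ge) auto
    then show ?thesis using u(3)[OF that] by (simp add: l1 divide_le_eq)
  qed
  have "\<rho> \<in> (\<lambda>i. l i h' / l i h0) ` outer_support u" unfolding \<rho>_def using ne by (intro Max_in) auto
  then obtain j where j: "j \<in> outer_support u" "l j h1 = 0" using u(3) by (force simp: l1)
  obtain u' s' where u': "(u', s') \<in> M" "outer_support u' = {i \<in> outer_support u. l i h1 = 0}"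
    by (rule contract_support[OF M u(1) h1H le]) blast
  have "u' \<notin> V" using u'(2) j outer_support_empty by blast
  then have "Q (u', s')" using u' u(3) by (auto simp: Q_def)
  from p(2)[OF this] have "card (outer_support u) \<le> card {i \<in> outer_support u. l i h1 = 0}"
    by (simp add: us u'(2))
  then have "{i \<in> outer_support u. l i h1 = 0} = outer_support u" by (intro card_seteq) auto
  then show ?thesis using that[OF u(1,2) h1H \<open>h1 \<noteq> 0\<close>] by blast
qed

text \<open>An \<open>m\<close> acting almost as 1 on the places of \<open>u\<close> displaces
  \<open>u\<close> by a tiny e = A m u - u. After \<open>n\<close> has expanded \<open>e\<close> to
  a vector \<open>g\<close> of transverse size about \<rho>, the point A (j m) A n u equals A n u +
  j g up to an error that vanishes in the limit for each fixed \<open>j\<close>. The components of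
  \<open>g\<close> over \<open>C\<close> are not expanded and vanish as well, so the limit has norm
  at most a constant times \<rho>, with the constant independent of \<rho>.\<close>

lemma progression_in_invariant:
  assumes M: "invariant M" "(u, s) \<in> M" and u: "u \<notin> V"
    and h: "h \<in> H" "h \<noteq> 0" "\<And>i. i \<in> outer_support u \<Longrightarrow> l i h = 0"
  obtains K where "\<forall>\<rho>>0. \<exists>q g \<tau>. (\<forall>j::nat. (q + real j *\<^sub>R g, \<tau>) \<in> M) \<and> g \<noteq> 0 \<and> norm g \<le> K * \<rho> \<and> norm q \<le> K
      \<and> norm \<tau> \<le> K"
proof -
  obtain K1 where K1: "K1 \<ge> 1"
    "\<And>\<rho> x. \<rho> > 0 \<Longrightarrow> x \<notin> V \<Longrightarrow> off x \<le> \<rho> / K1 \<Longrightarrow>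
        \<exists>n. (\<forall>i\<in>C. \<bar>l i (vec_of_int n)\<bar> \<le> K1) \<and> \<rho> / K1 \<le> off (A n *v x) \<and> off (A n *v x) \<le> \<rho>"
    by (rule expand_any) blast
  obtain B0 where B0: "B0 > 0" "\<And>x. norm x \<le> B0 * (\<Sum>i\<in>UNIV. cmod (P x $ i))" by (rule norm_le_coords) blast
  obtain B1 where B1: "B1 > 0" "\<And>x K. (\<And>i. cmod (P x $ i) \<le> K) \<Longrightarrow> norm x \<le> B1 * K"
    by (rule norm_le_coord_bound) blast
  \<comment> \<open>Off \<open>Q\<close> the vector \<open>u\<close> has no components, and on
    \<open>Q\<close> the direction \<open>h\<close> is isometric; so being almost 1 on
    \<open>Q\<close> is all that is asked of \<open>m\<close>.\<close>
  define Q where "Q = C \<union> outer_support u"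
  have hQ: "l i h = 0" if "i \<in> Q" for i using that h by (auto simp: Q_def C_def)
  have nQ: "P u $ i = 0" if "i \<notin> Q" for i using that by (auto simp: Q_def outer_support_def)
  define Kt where "Kt = norm s + real CARD('i) * K1"
  show ?thesis
  proof (rule that[of "max (max B1 (real CARD('d))) Kt"], intro allI impI)
    fix \<rho> :: real assume \<rho>: "\<rho> > 0"
    define R where "R = (\<lambda>k m n \<gamma>. \<gamma> \<in> int_lattice \<and> norm (A n *v u + \<gamma>) \<le> real CARD('d) \<and>
       norm (s + lamS n) \<le> Kt \<and> (\<forall>i\<in>Q. cmod (z m i - 1) \<le> 1 / real (Suc k)) \<and> norm (lamS m) \<le> real CARD('i) * (1
           / real (Suc k)) \<and>
       \<rho> / K1 \<le> off (A n *v (A m *v u - u)) \<and> off (A n *v (A m *v u - u)) \<le> \<rho> \<and>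
       (\<forall>i\<in>C. cmod (P (A n *v (A m *v u - u)) $ i) \<le> exp K1 * norm (P u) * (1 / real (Suc k))))"
    have "\<exists>m n \<gamma>. R k m n \<gamma>" for k
    proof -
      \<comment> \<open>The second bound gives off e \<le> \<rho> / K1, so that
        \<open>expand_any\<close> applies to \<open>e\<close>.\<close>
      define \<epsilon> where "\<epsilon> = min (1 / real (Suc k)) (\<rho> / K1 / (off u + 1))"
      have offu: "off u \<ge> 0" by (simp add: off_def)
      have \<epsilon>: "\<epsilon> > 0" "\<epsilon> \<le> 1 / real (Suc k)" "\<epsilon> \<le> \<rho> / K1 / (off u + 1)" using \<rho> K1(1) offu by (auto simp: \<epsilon>_def)
      obtain m where m: "m \<noteq> 0" "\<And>i. i \<in> Q \<Longrightarrow> cmod (z m i - 1) < \<epsilon>" "\<And>i. i \<in> Q \<Longrightarrow> \<bar>l i (vec_of_int m)\<bar> < \<epsilon>"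
        using almost_identity_element'[OF h(2) hQ \<epsilon>(1)] by metis
      define e where "e = A m *v u - u"
      have Pe: "P e $ i = (z m i - 1) * P u $ i" for i
        by (simp add: e_def linear_diff[OF P_lin] P_A algebra_simps)
      have "e \<notin> V"
      proof -
        obtain i where "i \<notin> C" "P u $ i \<noteq> 0" using u by (auto simp: V_def)
        moreover have "z m i \<noteq> 1" using z_one m(1) by blast
        ultimately show ?thesis by (auto simp: V_def Pe)
      qed
      moreover have "off e \<le> \<rho> / K1"
      proof -
        have "off e \<le> \<epsilon> * off u"
        proof (rule off_mono)
          fix i
          show "cmod (P e $ i) \<le> \<epsilon> * cmod (P u $ i)"
            using m(2)[of i] nQ[of i] by (cases "i \<in> Q") (auto simp: Pe norm_mult intro: mult_right_mono)
        qed (use \<epsilon>(1) in simp)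
        also have "\<dots> \<le> \<rho> / K1 / (off u + 1) * (off u + 1)" using \<epsilon> offu by (intro mult_mono) auto
        finally show ?thesis using offu by simp
      qed
      ultimately obtain n where n: "\<And>i. i \<in> C \<Longrightarrow> \<bar>l i (vec_of_int n)\<bar> \<le> K1" "\<rho> / K1 \<le> off (A n *v e)"
          "off (A n *v e) \<le> \<rho>"
        using K1(2)[OF \<rho>] by blast
      obtain \<gamma> where \<gamma>: "\<gamma> \<in> int_lattice" "norm (A n *v u + \<gamma>) \<le> real CARD('d)" using lattice_reduction by blast
      have "norm (s + lamS n) \<le> Kt"
      proof -
        have "norm (lamS n) \<le> real CARD('i) * K1" using n(1) S_subset_C K1(1) by (intro norm_lamS_le) auto
        then show ?thesis using norm_triangle_ineq[of s "lamS n"] by (simp add: Kt_def)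
      qed
      moreover have "norm (lamS m) \<le> real CARD('i) * (1 / real (Suc k))"
      proof (rule norm_lamS_le)
        fix i assume "i \<in> S"
        then have "i \<in> Q" using S_subset_C by (auto simp: Q_def)
        then show "\<bar>l i (vec_of_int m)\<bar> \<le> 1 / real (Suc k)" using m(3)[of i] \<epsilon>(2) by linarith
      qed simp
      moreover have "cmod (P (A n *v e) $ i) \<le> exp K1 * norm (P u) * (1 / real (Suc k))" if i: "i \<in> C" for i
      proof -
        have "cmod (z m i - 1) \<le> 1 / real (Suc k)" using m(2)[of i] i \<epsilon>(2) by (simp add: Q_def)
        then have "exp (l i (vec_of_int n)) * (cmod (z m i - 1) * cmod (P u $ i))
            \<le> exp K1 * (1 / real (Suc k) * norm (P u))"
          using n(1)[OF i] P_coord_bound[of u i] by (intro mult_mono) (auto simp: abs_le_iff)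
        then show ?thesis by (simp add: P_A Pe norm_mult l_z mult.assoc mult.commute)
      qed
      moreover have "\<forall>i\<in>Q. cmod (z m i - 1) \<le> 1 / real (Suc k)" using m(2) \<epsilon>(2) by force
      ultimately have "R k m n \<gamma>" using \<gamma> n(2,3) unfolding R_def e_def by simp
      then show ?thesis by blast
    qed
    then obtain m n \<gamma> where R: "\<And>k. R k (m k) (n k) (\<gamma> k)" by metis
    have \<gamma>: "\<And>k. \<gamma> k \<in> int_lattice" and Rq: "\<And>k. norm (A (n k) *v u + \<gamma> k) \<le> real CARD('d)"
      and Rt: "\<And>k. norm (s + lamS (n k)) \<le> Kt" and Rz: "\<And>k i. i \<in> Q \<Longrightarrow> cmod (z (m k) i - 1) \<le> 1 / real (Suc k)"
      and Rl: "\<And>k. norm (lamS (m k)) \<le> real CARD('i) * (1 / real (Suc k))"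
      using R by (auto simp: R_def)
    define g where "g = (\<lambda>k. A (n k) *v (A (m k) *v u - u))"
    have Rg: "\<And>k. \<rho> / K1 \<le> off (g k)" "\<And>k. off (g k) \<le> \<rho>"
       "\<And>k i. i \<in> C \<Longrightarrow> cmod (P (g k) $ i) \<le> exp K1 * norm (P u) * (1 / real (Suc k))"
      using R by (auto simp: R_def g_def)
    define Kg where "Kg = exp K1 * norm (P u) + \<rho>"
    have Pg: "cmod (P (g k) $ i) \<le> Kg" for k i
    proof (cases "i \<in> C")
      case True
      have "exp K1 * norm (P u) * (1 / real (Suc k)) \<le> exp K1 * norm (P u) * 1" by (intro mult_left_mono) auto
      then show ?thesis using Rg(3)[OF True, of k] \<rho> by (simp add: Kg_def)
    next
      case False
      have "0 \<le> exp K1 * norm (P u)" by simp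
      then show ?thesis using off_coord[OF False, of "g k"] Rg(2)[of k] unfolding Kg_def by linarith
    qed
    have ng: "norm (g k) \<le> B1 * Kg" for k by (rule B1(2)) (rule Pg)
    from convergent_triple[of "\<lambda>k. A (n k) *v u + \<gamma> k" _ g _ "\<lambda>k. s + lamS (n k)", OF Rq ng Rt] obtain r q g' \<tau>
      where r: "strict_mono r"
      "(\<lambda>k. A (n (r k)) *v u + \<gamma> (r k)) \<longlonglongrightarrow> q" "(\<lambda>k. g (r k)) \<longlonglongrightarrow> g'" "(\<lambda>k. s + lamS (n (r k))) \<longlonglongrightarrow> \<tau>" by blast
    have inv0: "(\<lambda>k. 1 / real (Suc k)) \<longlonglongrightarrow> 0" by (rule LIMSEQ_Suc[OF lim_1_over_n])
    have z1: "(\<lambda>k. z (m k) i) \<longlonglongrightarrow> 1" if "i \<in> Q" for i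
    proof -
      have "(\<lambda>k. z (m k) i - 1) \<longlonglongrightarrow> 0"
        by (rule Lim_null_comparison[OF _ inv0]) (use Rz[OF that] in auto)
      then show ?thesis by (simp add: LIM_zero_iff)
    qed
    have l0: "(\<lambda>k. lamS (m k)) \<longlonglongrightarrow> 0"
    proof (rule Lim_null_comparison)
      show "(\<lambda>k. real CARD('i) * (1 / real (Suc k))) \<longlonglongrightarrow> 0" using tendsto_mult[OF tendsto_const inv0] by simp
    qed (use Rl in auto)
    have prog: "(q + real j *\<^sub>R g', \<tau>) \<in> M" for j :: nat
    proof -
      define err where "err = (\<lambda>k. A (of_nat j *s m k) *v (A (n k) *v u) - (A (n k) *v u + real j *\<^sub>R g k))"
      \<comment> \<open>z^j - 1 is z - 1 times a geometric sum of \<open>j\<close> terms that tend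
        to 1. The deviation from j (z - 1) is therefore a factor tending to 0, and it multiplies the
        bounded vector \<open>g\<close>.\<close>
      have Perr: "P (err k) $ i = P (g k) $ i * (\<Sum>a<j. z (m k) i ^ a - 1)" for k i
      proof -
        have a: "P (err k) $ i = (z (m k) i ^ j - 1) * (z (n k) i * P u $ i) - real j * P (g k) $ i"
          by (simp add: err_def linear_diff[OF P_lin] linear_add[OF P_lin] linear_scale[OF P_lin] P_A z_nat
              algebra_simps)
             (simp add: scaleR_conv_of_real)
        have b: "P (g k) $ i = (z (m k) i - 1) * (z (n k) i * P u $ i)"
          by (simp add: g_def linear_diff[OF P_lin] P_A algebra_simps)
        have "z (m k) i ^ j - 1 = (z (m k) i - 1) * (\<Sum>a<j. z (m k) i ^ a)"
          by (rule power_diff_1_eq)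
        then have "(z (m k) i ^ j - 1) * (z (n k) i * P u $ i) = P (g k) $ i * (\<Sum>a<j. z (m k) i ^ a)"
          by (simp add: b)
        then show ?thesis by (simp add: a sum_subtractf algebra_simps)
      qed
      have Perr0: "(\<lambda>k. P (err k) $ i) \<longlonglongrightarrow> 0" for i
      proof (cases "i \<in> Q")
        case True
        have "(\<lambda>k. \<Sum>a<j. z (m k) i ^ a - 1) \<longlonglongrightarrow> (\<Sum>a<j. 1 ^ a - 1)"
          by (intro tendsto_intros z1 True)
        then have "(\<lambda>k. Kg * cmod (\<Sum>a<j. z (m k) i ^ a - 1)) \<longlonglongrightarrow> Kg * 0"
          by (intro tendsto_mult tendsto_const tendsto_norm_zero) simp
        then have "(\<lambda>k. Kg * cmod (\<Sum>a<j. z (m k) i ^ a - 1)) \<longlonglongrightarrow> 0" by simp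
        then show ?thesis
        proof (rule Lim_null_comparison[rotated], intro always_eventually allI)
          fix k
          show "cmod (P (err k) $ i) \<le> Kg * cmod (\<Sum>a<j. z (m k) i ^ a - 1)"
            unfolding Perr norm_mult by (intro mult_right_mono Pg norm_ge_zero)
        qed
      next
        case False
        then have "P (g k) $ i = 0" for k by (simp add: g_def linear_diff[OF P_lin] P_A nQ)
        then show ?thesis by (simp add: Perr)
      qed
      have "(\<lambda>k. B0 * (\<Sum>i\<in>UNIV. cmod (P (err k) $ i))) \<longlonglongrightarrow> B0 * (\<Sum>i\<in>(UNIV::'i set). 0)"
        by (intro tendsto_mult tendsto_const tendsto_sum tendsto_norm_zero Perr0)
      then have "(\<lambda>k. B0 * (\<Sum>i\<in>UNIV. cmod (P (err k) $ i))) \<longlonglongrightarrow> 0" by simp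
      then have "err \<longlonglongrightarrow> 0" by (rule Lim_null_comparison[rotated]) (use B0(2) in auto)
      from LIMSEQ_subseq_LIMSEQ[OF this r(1)] have "(\<lambda>k. err (r k)) \<longlonglongrightarrow> 0" by (simp add: o_def)
      from tendsto_add[OF this tendsto_add[OF r(2) tendsto_scaleR[OF tendsto_const[of "real j"] r(3)]]]
      have lim1: "(\<lambda>k. A (of_nat j *s m (r k)) *v (A (n (r k)) *v u) + \<gamma> (r k)) \<longlonglongrightarrow> q + real j *\<^sub>R g'"
        by (simp add: err_def algebra_simps)
      from LIMSEQ_subseq_LIMSEQ[OF l0 r(1)] have "(\<lambda>k. lamS (m (r k))) \<longlonglongrightarrow> 0" by (simp add: o_def)
      from tendsto_add[OF r(4) tendsto_scaleR[OF tendsto_const[of "real j"] this]]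
      have lim2: "(\<lambda>k. s + lamS (n (r k)) + lamS (of_nat j *s m (r k))) \<longlonglongrightarrow> \<tau>" by (simp add: lamS_nat)
      show ?thesis
        by (rule limit_in_invariant[OF M(1) _ lim1 lim2]) (intro invariant_shift[OF M(1)] invariant_act[OF M(1)]
            M(2) \<gamma>)
    qed
    have "\<rho> / K1 \<le> off g'" by (rule LIMSEQ_le_const[OF tendsto_off[OF r(3)]]) (use Rg in auto)
    then have g0: "g' \<noteq> 0" using \<rho> K1(1) not_V_off[of 0] subspace_0[OF subspace_V]
      by (smt (verit) divide_pos_pos)
    have off_g': "off g' \<le> \<rho>" by (rule LIMSEQ_le_const2[OF tendsto_off[OF r(3)]]) (use Rg in auto)
    have "norm g' \<le> B1 * \<rho>"
    proof (rule B1(2))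
      fix i
      show "cmod (P g' $ i) \<le> \<rho>"
      proof (cases "i \<in> C")
        case True
        have "(\<lambda>k. exp K1 * norm (P u) * (1 / real (Suc k))) \<longlonglongrightarrow> 0" using tendsto_mult[OF tendsto_const inv0]
          by simp
        then have "(\<lambda>k. P (g k) $ i) \<longlonglongrightarrow> 0" by (rule Lim_null_comparison[rotated]) (use Rg(3)[OF True] in auto)
        from LIMSEQ_subseq_LIMSEQ[OF this r(1)] have "(\<lambda>k. P (g (r k)) $ i) \<longlonglongrightarrow> 0" by (simp add: o_def)
        with tendsto_P[OF r(3), of i] have "P g' $ i = 0" by (rule LIMSEQ_unique)
        then show ?thesis using \<rho> by simp
      next
        case False
        then show ?thesis using off_coord[OF False, of g'] off_g' by linarith
      qed
    qed
    moreover have "norm q \<le> real CARD('d)" by (rule LIMSEQ_le_const2[OF tendsto_norm[OF r(2)]]) (use Rq in auto)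
    moreover have "norm \<tau> \<le> Kt" by (rule LIMSEQ_le_const2[OF tendsto_norm[OF r(4)]]) (use Rt in auto)
    moreover have "B1 * \<rho> \<le> max (max B1 (real CARD('d))) Kt * \<rho>" using \<rho> by (intro mult_right_mono) auto
    ultimately have "(\<forall>j::nat. (q + real j *\<^sub>R g', \<tau>) \<in> M) \<and> g' \<noteq> 0
        \<and> norm g' \<le> max (max B1 (real CARD('d))) Kt * \<rho>
        \<and> norm q \<le> max (max B1 (real CARD('d))) Kt \<and> norm \<tau> \<le> max (max B1 (real CARD('d))) Kt"
      using prog g0 by auto
    then show "\<exists>q g \<tau>. (\<forall>j::nat. (q + real j *\<^sub>R g, \<tau>) \<in> M) \<and> g \<noteq> 0
        \<and> norm g \<le> max (max B1 (real CARD('d))) Kt * \<rho>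
        \<and> norm q \<le> max (max B1 (real CARD('d))) Kt \<and> norm \<tau> \<le> max (max B1 (real CARD('d))) Kt"
      by blast
  qed
qed

end

subsection \<open>Filling a fibre\<close>

lemma finite_bounded_int_lattice: "finite {b \<in> int_lattice. \<forall>i. \<bar>b $ i :: real\<bar> \<le> real N}"
proof -
  have "{b \<in> int_lattice. \<forall>i. \<bar>b $ i :: real\<bar> \<le> real N} \<subseteq> vec_of_int ` vec_lambda ` (PiE (UNIV::'a set) (\<lambda>_. {-
      int N..int N}))"
  proof
    fix b :: "real^'a" assume b: "b \<in> {b \<in> int_lattice. \<forall>i. \<bar>b $ i\<bar> \<le> real N}"
    have eq: "real_of_int \<lfloor>b $ i\<rfloor> = b $ i" for i using b by (auto simp: int_lattice_def Ints_def)
    have "\<lfloor>b $ i\<rfloor> \<in> {- int N..int N}" for i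
    proof -
      have "\<bar>real_of_int \<lfloor>b $ i\<rfloor>\<bar> \<le> real N" unfolding eq using b by blast
      then show ?thesis by (simp add: abs_le_iff)
    qed
    moreover have "b = vec_of_int (vec_lambda (\<lambda>i. \<lfloor>b $ i\<rfloor>))" by (simp add: vec_of_int_def vec_eq_iff eq)
    ultimately show "b \<in> vec_of_int ` vec_lambda ` (PiE (UNIV::'a set) (\<lambda>_. {- int N..int N}))" by blast
  qed
  then show ?thesis by (rule finite_subset) (intro finite_imageI finite_PiE; simp)
qed

context torus_flow
begin

text \<open>Let \<rho> tend to 0: the progressions start in a bounded set, their steps shrink, and
  the normalised steps converge along a subsequence. About \<sigma> / |g| steps lead to the point at
  distance \<sigma> on the limiting ray.\<close>

lemma half_line_in_invariant:
  assumes M: "invariant M" "(u, s) \<in> M" and u: "u \<notin> V"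
    and h: "h \<in> H" "h \<noteq> 0" "\<And>i. i \<in> outer_support u \<Longrightarrow> l i h = 0"
  obtains y f \<tau> where "f \<noteq> 0" "\<forall>\<sigma>\<ge>0. (y + \<sigma> *\<^sub>R f, \<tau>) \<in> M"
proof -
  obtain K where K: "\<forall>\<rho>>0. \<exists>q g \<tau>. (\<forall>j::nat. (q + real j *\<^sub>R g, \<tau>) \<in> M) \<and> g \<noteq> 0 \<and> norm g \<le> K * \<rho> \<and> norm q \<le> K
      \<and> norm \<tau> \<le> K"
    by (rule progression_in_invariant[OF M u h]) blast
  define R where "R = (\<lambda>k q g \<tau>. (\<forall>j::nat. (q + real j *\<^sub>R g, \<tau>) \<in> M) \<and> g \<noteq> 0 \<and> norm g \<le> K * (1 / real (Suc k))
      \<and> norm q \<le> K \<and> norm \<tau> \<le> K)"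
  have "\<exists>q g \<tau>. R k q g \<tau>" for k using K[rule_format, of "1 / real (Suc k)"] by (simp add: R_def)
  then obtain q g \<tau> where R: "\<And>k. R k (q k) (g k) (\<tau> k)" by metis
  have Rm: "\<And>k j. (q k + real j *\<^sub>R g k, \<tau> k) \<in> M" and Rg: "\<And>k. g k \<noteq> 0"
      "\<And>k. norm (g k) \<le> K * (1 / real (Suc k))"
    and Rb: "\<And>k. norm (q k) \<le> K" "\<And>k. norm (\<tau> k) \<le> K"
    using R by (auto simp: R_def)
  define f where "f = (\<lambda>k. (1 / norm (g k)) *\<^sub>R g k)"
  have f1: "norm (f k) = 1" for k using Rg(1)[of k] by (simp add: f_def)
  have f1': "norm (f k) \<le> 1" for k by (simp add: f1)
  from convergent_triple[of q _ f _ \<tau>, OF Rb(1) f1' Rb(2)] obtain r y f' \<tau>' where r: "strict_mono r"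
    "(\<lambda>k. q (r k)) \<longlonglongrightarrow> y" "(\<lambda>k. f (r k)) \<longlonglongrightarrow> f'" "(\<lambda>k. \<tau> (r k)) \<longlonglongrightarrow> \<tau>'" by blast
  have g0: "g \<longlonglongrightarrow> 0"
  proof (rule Lim_null_comparison)
    show "(\<lambda>k. K * (1 / real (Suc k))) \<longlonglongrightarrow> 0" using tendsto_mult[OF tendsto_const LIMSEQ_Suc[OF lim_1_over_n], of
        K] by simp
  qed (use Rg in auto)
  have "norm f' = 1" using LIMSEQ_unique[OF tendsto_norm[OF r(3)], of 1] by (simp add: f1)
  then have "f' \<noteq> 0" by auto
  moreover have "(y + \<sigma> *\<^sub>R f', \<tau>') \<in> M" if \<sigma>: "\<sigma> \<ge> 0" for \<sigma>
  proof -
    define j where "j = (\<lambda>k. nat \<lfloor>\<sigma> / norm (g k)\<rfloor>)"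
    have jb: "norm (real (j k) *\<^sub>R g k - \<sigma> *\<^sub>R f k) \<le> norm (g k)" for k
    proof -
      have "\<bar>real (j k) - \<sigma> / norm (g k)\<bar> \<le> 1"
      proof -
        have "0 \<le> \<sigma> / norm (g k)" using \<sigma> by simp
        then have "real (j k) = real_of_int \<lfloor>\<sigma> / norm (g k)\<rfloor>" unfolding j_def by simp
        then show ?thesis by linarith
      qed
      moreover have "real (j k) *\<^sub>R g k - \<sigma> *\<^sub>R f k = (real (j k) - \<sigma> / norm (g k)) *\<^sub>R g k"
        by (simp add: f_def scaleR_left_diff_distrib)
      ultimately show ?thesis using mult_right_mono[of "\<bar>real (j k) - \<sigma> / norm (g k)\<bar>" 1 "norm (g k)"] by simp
    qed
    have "(\<lambda>k. real (j k) *\<^sub>R g k - \<sigma> *\<^sub>R f k) \<longlonglongrightarrow> 0"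
      by (rule Lim_null_comparison[OF _ tendsto_norm_zero[OF g0]]) (use jb in auto)
    from LIMSEQ_subseq_LIMSEQ[OF this r(1)] have "(\<lambda>k. real (j (r k)) *\<^sub>R g (r k) - \<sigma> *\<^sub>R f (r k)) \<longlonglongrightarrow> 0"
      by (simp add: o_def)
    from tendsto_add[OF tendsto_add[OF r(2) this] tendsto_scaleR[OF tendsto_const[of \<sigma>] r(3)]]
    have "(\<lambda>k. q (r k) + real (j (r k)) *\<^sub>R g (r k)) \<longlonglongrightarrow> y + \<sigma> *\<^sub>R f'" by simp
    then show ?thesis by (rule limit_in_invariant[OF M(1) Rm _ r(4)])
  qed
  ultimately show ?thesis using that by blast
qed

lemma A_nat_transpose: "((\<lambda>b. transpose (A n) *v b) ^^ m) b \<bullet> x = b \<bullet> (A (of_nat m *s n) *v x)"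
proof (induction m arbitrary: x)
  case 0
  then show ?case by (simp add: A_0)
next
  case (Suc m)
  have s: "of_nat (Suc m) *s n = of_nat m *s n + n" by (simp add: vec_eq_iff algebra_simps)
  have "((\<lambda>b. transpose (A n) *v b) ^^ Suc m) b \<bullet> x = (((\<lambda>b. transpose (A n) *v b) ^^ m) b) \<bullet> (A n *v x)"
    by (simp add: dot_matrix_vector_mul transpose_matrix_vector) (simp add: dot_lmul_matrix)
  also have "\<dots> = b \<bullet> (A (of_nat m *s n) *v (A n *v x))" by (rule Suc.IH)
  finally show ?case by (simp only: s A_add_v)
qed

text \<open>For a short step along the line A k f, Kronecker's theorem can only fail through a
  character \<open>b\<close> of the box orthogonal to A k f, that is, with (D^m) b in the rational
  annihilator \<open>L\<close> of \<open>f\<close>. \<open>orbit_avoids_subspace\<close> yields a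
  power m < W for which this happens for no \<open>b\<close>. The fibre \<tau> is recovered because
  k = m n hardly changes the second coordinate.\<close>

lemma half_line_fills:
  assumes M: "invariant M" and f: "f \<noteq> 0" and line: "\<And>\<sigma>. \<sigma> \<ge> 0 \<Longrightarrow> (y + \<sigma> *\<^sub>R f, \<tau>) \<in> M"
  shows "(x, \<tau>) \<in> M"
proof -
  have "(x, \<tau>) \<in> closure M"
    unfolding closure_approachable
  proof (intro allI impI)
    fix e :: real assume e: "e > 0"
    define \<eta> where "\<eta> = e / 2"
    have \<eta>: "\<eta> > 0" using e by (simp add: \<eta>_def)
    obtain R where R: "\<And>g y :: real^'d. (\<And>b. b \<in> int_lattice \<Longrightarrow> b \<noteq> 0 \<Longrightarrow> \<forall>i. \<bar>b $ i\<bar> \<le> real R \<Longrightarrow> b \<bullet> g \<notin> \<int>) \<Longrightarrow>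
       \<exists>j::nat. \<exists>\<gamma>\<in>int_lattice. norm (y + real j *\<^sub>R g - \<gamma>) < \<eta>"
      using kronecker_int_lattice[OF \<eta>] by blast
    define B where "B = {b \<in> int_lattice. \<forall>i. \<bar>(b :: real^'d) $ i\<bar> \<le> real R} - {0}"
    have B: "finite B" "B \<subseteq> int_lattice" unfolding B_def using finite_bounded_int_lattice by auto
    obtain W where W: "\<And>D (L::(real^'d) set). totally_irreducible_map D \<Longrightarrow> (\<forall>b\<in>B. \<forall>m. (D ^^ m) b \<noteq> 0) \<Longrightarrow>
       rational_subspace L \<Longrightarrow> L \<noteq> UNIV \<Longrightarrow> \<exists>m<W. \<forall>b\<in>B. (D ^^ m) b \<notin> L"
      using orbit_avoids_subspace[OF B] by blast
    \<comment> \<open>Fewer than \<open>W\<close> multiples of \<open>n\<close> are used, so the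
      fibre moves by less than \<eta>; this needs \<open>W\<close> before \<open>n\<close>.\<close>
    define \<epsilon> where "\<epsilon> = \<eta> / (real CARD('i) * (real W + 1))"
    have "\<epsilon> > 0" using \<eta> by (simp add: \<epsilon>_def)
    from irred[OF this] obtain n where n: "\<forall>i\<in>S. \<bar>l i (vec_of_int n)\<bar> < \<epsilon>"
        "totally_irreducible_map (\<lambda>b. transpose (A n) *v b)" by blast
    define D where "D = (\<lambda>b. transpose (A n) *v b)"
    have Dm: "(D ^^ m) b \<bullet> x = b \<bullet> (A (of_nat m *s n) *v x)" for m b x unfolding D_def by (rule A_nat_transpose)
    define L where "L = span {c \<in> int_lattice. c \<bullet> f = 0}"
    have "L \<subseteq> {c. c \<bullet> f = 0}" unfolding L_def by (intro span_minimal) (auto simp: subspace_def inner_add_left)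
    moreover have "f \<notin> {c. c \<bullet> f = 0}" using f by simp
    ultimately have "L \<noteq> UNIV" by blast
      moreover have "rational_subspace L" unfolding rational_subspace_def L_def
        by (rule exI[of _ "{c \<in> int_lattice. c \<bullet> f = 0}"]) auto
    moreover have "\<forall>b\<in>B. \<forall>m. (D ^^ m) b \<noteq> 0"
    proof (intro ballI allI notI)
      fix b m assume b: "b \<in> B" "(D ^^ m) b = 0"
      \<comment> \<open>Pairing the supposedly zero iterate with the inverse image of
        \<open>b\<close> gives |b|^2 = 0.\<close>
      have "b \<bullet> (A (of_nat m *s n) *v (A (- (of_nat m *s n)) *v b)) = 0" unfolding Dm[symmetric]
        by (simp add: b(2))
      then have "b = 0" by (simp add: A_minus')
      then show False using b by (simp add: B_def)
    qed
    ultimately obtain m where m: "m < W" "\<forall>b\<in>B. (D ^^ m) b \<notin> L" using W[of D L] n(2) unfolding D_def by blast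
    define k where "k = of_nat m *s n"
    define f' where "f' = A k *v f"
    have bf: "b \<bullet> f' \<noteq> 0" if "b \<in> B" for b
    proof
      assume "b \<bullet> f' = 0"
      then have "(D ^^ m) b \<bullet> f = 0" by (simp add: Dm f'_def k_def)
      moreover have "(D ^^ m) b \<in> int_lattice"
        using n(2) that B(2) by (intro funpow_in_int_lattice) (auto simp: totally_irreducible_map_def D_def)
      ultimately have "(D ^^ m) b \<in> L" unfolding L_def by (intro span_base) simp
      with m(2) that show False by blast
    qed
    \<comment> \<open>So short that |b \<bullet> (\<theta> f')| < 1 for every \<open>b\<close> in
      \<open>B\<close>; being nonzero, these products are then not integers. The half-line allows
      any positive step length.\<close>
    define \<theta> where "\<theta> = 1 / (1 + (\<Sum>b\<in>B. \<bar>b \<bullet> f'\<bar>))"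
    have sum0: "0 \<le> (\<Sum>b\<in>B. \<bar>b \<bullet> f'\<bar>)" by (intro sum_nonneg) auto
    have \<theta>: "\<theta> > 0" unfolding \<theta>_def using add_pos_nonneg[OF zero_less_one sum0] by simp
    have "b \<bullet> (\<theta> *\<^sub>R f') \<notin> \<int>" if b: "b \<in> int_lattice" "b \<noteq> 0" "\<forall>i. \<bar>b $ i\<bar> \<le> real R" for b
    proof
      assume int: "b \<bullet> (\<theta> *\<^sub>R f') \<in> \<int>"
      have bB: "b \<in> B" using b by (simp add: B_def)
      have "\<bar>b \<bullet> f'\<bar> \<le> (\<Sum>b\<in>B. \<bar>b \<bullet> f'\<bar>)" using B(1) bB by (intro member_le_sum) auto
      then have "\<bar>b \<bullet> (\<theta> *\<^sub>R f')\<bar> < 1" using sum0 by (simp add: \<theta>_def abs_mult)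
      with int have "b \<bullet> (\<theta> *\<^sub>R f') = 0" by (rule Ints_nonzero_abs_less1)
      with bf[OF bB] \<theta> show False by simp
    qed
    from R[OF this, of "A k *v y - x"] obtain j \<gamma> where j: "\<gamma> \<in> int_lattice"
        "norm (A k *v y - x + real j *\<^sub>R (\<theta> *\<^sub>R f') - \<gamma>) < \<eta>" by blast
    have "(A k *v (y + (real j * \<theta>) *\<^sub>R f) + (- \<gamma>), \<tau> + lamS k) \<in> M"
      using \<theta> j(1) by (intro invariant_shift[OF M] invariant_act[OF M] line int_lattice_minus) simp_all
    moreover have "dist (A k *v (y + (real j * \<theta>) *\<^sub>R f) + (- \<gamma>), \<tau> + lamS k) (x, \<tau>) < e"
    proof -
      have eq: "A k *v (y + (real j * \<theta>) *\<^sub>R f) + (- \<gamma>) - x = A k *v y - x + real j *\<^sub>R (\<theta> *\<^sub>R f') - \<gamma>"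
        by (simp add: f'_def matrix_vector_right_distrib matrix_vector_mult_scaleR algebra_simps)
      have 1: "norm (A k *v (y + (real j * \<theta>) *\<^sub>R f) + (- \<gamma>) - x) < \<eta>" unfolding eq by (rule j(2))
      have "norm (lamS n) \<le> real CARD('i) * \<epsilon>" using n(1) \<open>\<epsilon> > 0\<close>
        by (intro norm_lamS_le) (auto intro: less_imp_le)
      then have "norm (lamS k) \<le> real m * (real CARD('i) * \<epsilon>)" by (simp add: k_def lamS_nat mult_left_mono)
      also have "\<dots> \<le> real W * (real CARD('i) * \<epsilon>)" using m(1) \<open>\<epsilon> > 0\<close> by (intro mult_right_mono) auto
      also have "\<dots> = real W * (\<eta> / (real W + 1))" by (simp add: \<epsilon>_def)
      also have "\<dots> < \<eta>" using \<eta> by (simp add: divide_less_eq algebra_simps)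
      finally have 2: "norm (lamS k) < \<eta>" .
      show ?thesis using norm_Pair_le[of "A k *v (y + (real j * \<theta>) *\<^sub>R f) + (- \<gamma>) - x" "lamS k"] 1 2
        by (simp add: dist_norm \<eta>_def)
    qed
    ultimately show "\<exists>y\<in>M. dist y (x, \<tau>) < e" by blast
  qed
  then show ?thesis using invariant_closed[OF M] by simp
qed

lemma accumulating_fills_fibre:
  assumes M: "invariant M" and acc: "accumulates M"
  obtains \<tau> where "\<And>x. (x, \<tau>) \<in> M"
proof -
  obtain u s h where u: "(u, s) \<in> M" "u \<notin> V" "h \<in> H" "h \<noteq> 0" "\<And>i. i \<in> outer_support u \<Longrightarrow> l i h = 0"
    by (rule proportional_limit_point[OF M acc]) blast
  obtain y f \<tau> where f: "f \<noteq> 0" "\<forall>\<sigma>\<ge>0. (y + \<sigma> *\<^sub>R f, \<tau>) \<in> M"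
    by (rule half_line_in_invariant[OF M u]) blast
  have "(x, \<tau>) \<in> M" for x by (rule half_line_fills[OF M f(1)]) (use f(2) in blast)
  then show ?thesis by (rule that)
qed

text \<open>The fibrewise differences of \<open>M\<close> form an invariant set themselves, so the
  filling result applies to them. For their closedness the base points are first brought into a
  bounded set by lattice shifts, as the limit of the differences alone does not control
  them.\<close>

lemma difference_fills_fibre:
  assumes M: "invariant M" "(x, t) \<in> M" and x: "x \<notin> translated_torsion"
  obtains \<tau> where "\<And>w. \<exists>y. (y, \<tau>) \<in> M \<and> (y + w, \<tau>) \<in> M"
proof -
  define \<D> where "\<D> = {(w, s) | w s. \<exists>y. (y, s) \<in> M \<and> (y + w, s) \<in> M}"
  have "invariant \<D>"
    unfolding invariant_def
  proof (intro conjI allI impI)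
    show "closed \<D>"
      unfolding closed_sequential_limits
    proof (intro allI impI, elim conjE)
      fix p lim assume p: "\<forall>k. p k \<in> \<D>" "p \<longlonglongrightarrow> lim"
      obtain w s where lim: "lim = (w, s)" by (cases lim) auto
      have "\<exists>y. norm y \<le> real CARD('d) \<and> (y, snd (p k)) \<in> M \<and> (y + fst (p k), snd (p k)) \<in> M" for k
      proof -
        obtain y where y: "(y, snd (p k)) \<in> M" "(y + fst (p k), snd (p k)) \<in> M"
          using p(1)[rule_format, of k] by (auto simp: \<D>_def)
        obtain \<gamma> where g: "\<gamma> \<in> int_lattice" "norm (y + \<gamma>) \<le> real CARD('d)" using lattice_reduction by blast
        have "(y + \<gamma> + fst (p k), snd (p k)) \<in> M" using invariant_shift[OF M(1) y(2) g(1)]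
          by (simp add: algebra_simps)
        then show ?thesis using g invariant_shift[OF M(1) y(1) g(1)] by blast
      qed
      then obtain y where y: "\<And>k. norm (y k) \<le> real CARD('d)" "\<And>k. (y k, snd (p k)) \<in> M"
          "\<And>k. (y k + fst (p k), snd (p k)) \<in> M" by metis
      from convergent_triple[of y _ y _ y, OF y(1) y(1) y(1)] obtain r y'
        where r: "strict_mono r" "(\<lambda>k. y (r k)) \<longlonglongrightarrow> y'" by blast
      have pl: "(\<lambda>k. p (r k)) \<longlonglongrightarrow> (w, s)" using LIMSEQ_subseq_LIMSEQ[OF p(2) r(1)] by (simp add: o_def lim)
      from tendsto_fst[OF pl] tendsto_snd[OF pl] have w: "(\<lambda>k. fst (p (r k))) \<longlonglongrightarrow> w" "(\<lambda>k. snd (p (r k))) \<longlonglongrightarrow> s"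
        by auto
      have "(y', s) \<in> M" by (rule limit_in_invariant[OF M(1) _ r(2) w(2)]) (rule y)
      moreover have "(y' + w, s) \<in> M" by (rule limit_in_invariant[OF M(1) _ tendsto_add[OF r(2) w(1)] w(2)])
          (rule y)
      ultimately show "lim \<in> \<D>" by (auto simp: \<D>_def lim)
    qed
  next
    fix w s and \<gamma> :: "real^'d" assume "(w, s) \<in> \<D>" "\<gamma> \<in> int_lattice"
    then obtain y where y: "(y, s) \<in> M" "(y + w, s) \<in> M" by (auto simp: \<D>_def)
    then show "(w + \<gamma>, s) \<in> \<D>" using invariant_shift[OF M(1) y(2) \<open>\<gamma> \<in> int_lattice\<close>]
      by (auto simp: \<D>_def algebra_simps)
  next
    fix w s n assume "(w, s) \<in> \<D>"
    then obtain y where y: "(y, s) \<in> M" "(y + w, s) \<in> M" by (auto simp: \<D>_def)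
    then show "(A n *v w, s + lamS n) \<in> \<D>" using invariant_act[OF M(1) y(1), of n] invariant_act[OF M(1) y(2),
        of n]
      by (auto simp: \<D>_def matrix_vector_right_distrib)
  qed
  moreover have "accumulates \<D>"
  proof -
    obtain K where K: "\<And>\<delta>. \<delta> > 0 \<Longrightarrow> \<exists>y y' s. (y, s) \<in> M \<and> (y', s) \<in> M \<and> y - y' \<notin> V \<and> off (y - y') \<le> \<delta>
        \<and> norm (y - y') \<le> K \<and> norm s \<le> K"
      by (rule small_differences[OF M x]) blast
    show ?thesis unfolding accumulates_def
    proof (intro exI[of _ K] allI impI)
      fix \<delta> :: real assume "\<delta> > 0"
      from K[OF this] obtain y y' s where y: "(y, s) \<in> M" "(y', s) \<in> M" "y - y' \<notin> V" "off (y - y') \<le> \<delta>"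
          "norm (y - y') \<le> K" "norm s \<le> K" by blast
      have "(y - y', s) \<in> \<D>" using y(1,2) by (auto simp: \<D>_def intro!: exI[of _ y'])
      then show "\<exists>u s. (u, s) \<in> \<D> \<and> norm s \<le> K \<and> norm u \<le> K \<and> u \<notin> V \<and> off u \<le> \<delta>" using y by blast
    qed
  qed
  ultimately obtain \<tau> where "\<And>w. (w, \<tau>) \<in> \<D>" by (rule accumulating_fills_fibre) blast
  then show ?thesis using that by (auto simp: \<D>_def)
qed

end

subsection \<open>Congruence subgroups and orbit closures\<close>

lemma nat_scale_add: "of_nat q *s (m + n) = of_nat q *s m + of_nat q *s (n :: int^'n)"
  by (simp add: vec_eq_iff algebra_simps)

lemma rational_vector_denominator:
  fixes p :: "real^'d"
  assumes "\<forall>j. p $ j \<in> \<rat>"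
  obtains N :: nat where "N > 0" "real N *\<^sub>R p \<in> int_lattice"
proof -
  have "\<exists>n::nat. n > 0 \<and> real n * p $ j \<in> \<int>" for j
  proof -
    obtain a b :: int where ab: "b > 0" "p $ j = of_int a / of_int b"
      using assms Rats_cases' by metis
    then have "real (nat b) * p $ j = of_int a" by simp
    then show ?thesis using ab(1) by (intro exI[of _ "nat b"]) simp
  qed
  then obtain n where n: "\<And>j. n j > (0::nat)" "\<And>j. real (n j) * p $ j \<in> \<int>" by metis
  show ?thesis
  proof (rule that[of "\<Prod>j\<in>UNIV. n j"])
    show "(\<Prod>j\<in>UNIV. n j) > 0" using n(1) by (simp add: prod_pos)
    have "real (\<Prod>j\<in>UNIV. n j) * p $ k \<in> \<int>" for k
    proof -
      have "(\<Prod>j\<in>UNIV. n j) = n k * (\<Prod>j\<in>UNIV-{k}. n j)" by (rule prod.remove) auto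
      then have "real (\<Prod>j\<in>UNIV. n j) * p $ k = real (\<Prod>j\<in>UNIV-{k}. n j) * (real (n k) * p $ k)" by simp
      also have "\<dots> \<in> \<int>" by (intro Ints_mult[OF Ints_of_nat] n(2))
      finally show ?thesis .
    qed
    then show "real (\<Prod>j\<in>UNIV. n j) *\<^sub>R p \<in> int_lattice" by (simp add: int_lattice_def)
  qed
qed

lemma totally_irreducible_map_funpow:
  assumes "totally_irreducible_map D" "q > 0"
  shows "totally_irreducible_map (D ^^ q)"
  unfolding totally_irreducible_map_def
proof (intro conjI allI impI)
  show "linear (D ^^ q)" "(D ^^ q) ` int_lattice \<subseteq> int_lattice"
    using assms by (auto simp: totally_irreducible_map_def linear_funpow intro: funpow_in_int_lattice)
  fix k L assume "0 < k" "rational_subspace L \<and> ((D ^^ q) ^^ k) ` L \<subseteq> L"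
  moreover have "(D ^^ q) ^^ k = D ^^ (q * k)" by (simp add: funpow_mult)
  ultimately show "L = {0} \<or> L = UNIV"
    using assms unfolding totally_irreducible_map_def by (metis nat_0_less_mult_iff)
qed

context torus_flow
begin

lemma transpose_nat_mult: "(\<lambda>b. transpose (A (of_nat q *s n)) *v b) = (\<lambda>b. transpose (A n) *v b) ^^ q"
proof
  fix b
  have "(transpose (A (of_nat q *s n)) *v b) \<bullet> x = (((\<lambda>b. transpose (A n) *v b) ^^ q) b) \<bullet> x" for x
    unfolding A_nat_transpose by (simp add: transpose_matrix_vector dot_lmul_matrix)
  then show "transpose (A (of_nat q *s n)) *v b = ((\<lambda>b. transpose (A n) *v b) ^^ q) b"
    by (subst vector_eq_rdot[symmetric]) blast
qed

text \<open>The functionals are multiplied by \<open>q\<close> so that they are still evaluated at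
  \<open>n\<close>. Powers of totally irreducible maps are totally irreducible, and dividing
  \<epsilon> by \<open>q\<close> keeps them almost isometric on \<open>S\<close>.\<close>

lemma scaled_flow:
  assumes q: "q > 0"
  shows "torus_flow (\<lambda>n. A (of_nat q *s n)) P (\<lambda>n. z (of_nat q *s n)) (\<lambda>i h. real q * l i h) S"
proof (rule torus_flow.intro)
  fix m n i
  show "A (of_nat q *s (m + n)) = A (of_nat q *s m) ** A (of_nat q *s n)" by (simp only: nat_scale_add A_add)
  show "z (of_nat q *s (m + n)) i = z (of_nat q *s m) i * z (of_nat q *s n) i"
    by (simp only: nat_scale_add z_add)
  show "cmod (z (of_nat q *s n) i) = exp (real q * l i (vec_of_int n))"
    by (simp add: l_z vec_of_int_scale l_scale)
  show "linear (\<lambda>h. real q * l i h)" using linear_compose_scale_right[OF l_lin[of i], of "real q"] by simp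
  show "n = 0" if "z (of_nat q *s n) i = 1"
    using z_one[OF that] q by (simp add: vec_eq_iff)
next
  show "A (of_nat q *s 0) = mat 1" by (simp add: A_0)
  show "2 \<le> dim {h. \<forall>i\<in>S. real q * l i h = 0}" using dim_H q by simp
next
  fix \<epsilon> :: real assume "\<epsilon> > 0"
  then have "\<epsilon> / real q > 0" using q by simp
  from irred[OF this] obtain n where n: "\<forall>i\<in>S. \<bar>l i (vec_of_int n)\<bar> < \<epsilon> / real q"
    "totally_irreducible_map (\<lambda>b. transpose (A n) *v b)" by blast
  have "\<forall>i\<in>S. \<bar>real q * l i (vec_of_int n)\<bar> < \<epsilon>" using n(1) q by (simp add: abs_mult field_simps)
  then show "\<exists>n. (\<forall>i\<in>S. \<bar>real q * l i (vec_of_int n)\<bar> < \<epsilon>)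
      \<and> totally_irreducible_map (\<lambda>b. transpose (A (of_nat q *s n)) *v b)"
    using totally_irreducible_map_funpow[OF n(2) q] unfolding transpose_nat_mult by blast
qed (use A_int P_lin P_inj P_A in auto)

text \<open>Residues modulo \<open>N\<close> of the vectors N A^k a take at most card T values, so
  each pair of \<open>n\<close> and \<open>a\<close> has a period p \<le> card T. The factorial is a
  multiple of every such period.\<close>

lemma congruence_subgroup:
  fixes N :: nat
  assumes N: "N > 0"
  obtains q where "q > 0" "\<And>n a. real N *\<^sub>R a \<in> int_lattice \<Longrightarrow> A (of_nat q *s n) *v a - a \<in> int_lattice"
proof -
  define T :: "(int^'d) set" where "T = vec_lambda ` (PiE UNIV (\<lambda>_. {0..<int N}))"
  have finT: "finite T" unfolding T_def by (intro finite_imageI finite_PiE) auto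
  define q :: nat where "q = fact (card T)"
  have per: "\<exists>p>0. p \<le> card T \<and> A (of_nat p *s n) *v a - a \<in> int_lattice" if a: "real N *\<^sub>R a \<in> int_lattice"
      for n a
  proof -
    have Na: "real N *\<^sub>R (A m *v a) \<in> int_lattice" for m using A_int[OF a, of m]
      by (simp add: matrix_vector_mult_scaleR)
    define f where "f = (\<lambda>k::nat. (\<chi> i. \<lfloor>real N * (A (of_nat k *s n) *v a) $ i\<rfloor> mod int N) :: int^'d)"
    have "f ` {..card T} \<subseteq> T"
      using N by (auto simp: f_def T_def intro!: imageI)
    then have "\<not> inj_on f {..card T}"
      using card_inj_on_le[of f "{..card T}" T] finT by auto
    then obtain k k' where k: "k < k'" "k' \<le> card T" "f k = f k'"
      unfolding inj_on_def by (metis atMost_iff linorder_neqE_nat)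
    have "(A (of_nat k' *s n) *v a) $ i - (A (of_nat k *s n) *v a) $ i \<in> \<int>" for i
    proof -
      define x x' where "x = real N * (A (of_nat k *s n) *v a) $ i" and
          "x' = real N * (A (of_nat k' *s n) *v a) $ i"
      have "x \<in> \<int>" "x' \<in> \<int>" using Na by (auto simp: x_def x'_def int_lattice_def)
      then obtain y y' where y: "x = of_int y" "x' = of_int y'" by (auto elim!: Ints_cases)
      have "y mod int N = y' mod int N"
      proof -
        have "f k $ i = f k' $ i" using k(3) by simp
        then have "\<lfloor>x\<rfloor> mod int N = \<lfloor>x'\<rfloor> mod int N" by (simp add: f_def x_def x'_def)
        then show ?thesis by (simp add: y)
      qed
      then have "int N dvd y' - y" by (metis mod_eq_dvd_iff)
      then obtain c where "y' - y = int N * c" by blast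
      then have "x' - x = real N * of_int c" unfolding y by (metis of_int_diff of_int_mult of_int_of_nat_eq)
      then have "real N * ((A (of_nat k' *s n) *v a) $ i - (A (of_nat k *s n) *v a) $ i) = real N * of_int c"
        by (simp add: x_def x'_def right_diff_distrib)
      then have "(A (of_nat k' *s n) *v a) $ i - (A (of_nat k *s n) *v a) $ i = of_int c" using N by simp
      then show ?thesis by simp
    qed
    then have "A (of_nat k' *s n) *v a - A (of_nat k *s n) *v a \<in> int_lattice" by (simp add: int_lattice_def)
    from A_int[OF this, of "- (of_nat k *s n)"]
    have "A (- (of_nat k *s n)) *v (A (of_nat k' *s n) *v a) - a \<in> int_lattice"
      by (simp add: matrix_vector_mult_diff_distrib A_minus)
    also have "A (- (of_nat k *s n)) *v (A (of_nat k' *s n) *v a) = A (of_nat (k' - k) *s n) *v a"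
      unfolding A_add_v[symmetric] using k(1)
      by (intro arg_cong[where f="\<lambda>n. A n *v a"]) (simp add: vec_eq_iff of_nat_diff algebra_simps)
    finally show ?thesis using k by (intro exI[of _ "k' - k"]) auto
  qed
  show ?thesis
  proof (rule that[of q])
    show "q > 0" by (simp add: q_def)
    fix n and a :: "real^'d" assume a: "real N *\<^sub>R a \<in> int_lattice"
    from per[OF a, of n] obtain p where p: "p > 0" "p \<le> card T" "A (of_nat p *s n) *v a - a \<in> int_lattice"
      by blast
    have "p dvd q" unfolding q_def using p by (intro dvd_fact) auto
    then obtain c where c: "q = c * p" by (metis dvd_def mult.commute)
    have "A (of_nat (c * p) *s n) *v a - a \<in> int_lattice" for c
    proof (induction c)
      case 0
      then show ?case by (simp add: A_0 int_lattice_0)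
    next
      case (Suc c)
      have e: "of_nat (Suc c * p) *s n = of_nat p *s n + of_nat (c * p) *s n"
        by (simp add: vec_eq_iff algebra_simps)
      have "A (of_nat (Suc c * p) *s n) *v a - a = A (of_nat p *s n) *v (A (of_nat (c * p) *s n) *v a - a)
          + (A (of_nat p *s n) *v a - a)"
        by (simp only: e A_add_v) (simp add: matrix_vector_mult_diff_distrib)
      also have "\<dots> \<in> int_lattice" by (intro int_lattice_add A_int Suc.IH p)
      finally show ?case .
    qed
    then show "A (of_nat q *s n) *v a - a \<in> int_lattice" by (simp add: c)
  qed
qed

section \<open>Orbit closures in the product space\<close>

definition orbit_closure :: "real^'d \<Rightarrow> ((real^'d) \<times> (real^'i)) set" where
  "orbit_closure x = closure {(A n *v x + \<gamma>, lamS n) | n \<gamma>. \<gamma> \<in> int_lattice}"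

lemma invariant_orbit_closure: "invariant (orbit_closure x)"
  unfolding invariant_def
proof (intro conjI allI impI)
  show "closed (orbit_closure x)" by (simp add: orbit_closure_def)
next
  fix y t and \<gamma> :: "real^'d" assume y: "(y, t) \<in> orbit_closure x" and g: "\<gamma> \<in> int_lattice"
  let ?f = "\<lambda>p :: (real^'d) \<times> (real^'i). (fst p + \<gamma>, snd p)"
  have "?f ` orbit_closure x \<subseteq> orbit_closure x"
    unfolding orbit_closure_def
  proof (rule image_closure_subset)
    show "?f ` {(A n *v x + \<gamma>, lamS n) | n \<gamma>. \<gamma> \<in> int_lattice} \<subseteq> closure {(A n *v x
        + \<gamma>, lamS n) | n \<gamma>. \<gamma> \<in> int_lattice}"
      using g by (intro order_trans[OF _ closure_subset]) (clarsimp simp: add.assoc, use int_lattice_add in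
          blast)
  qed (auto intro!: continuous_intros)
  with y show "(y + \<gamma>, t) \<in> orbit_closure x" by force
next
  fix y t m assume y: "(y, t) \<in> orbit_closure x"
  let ?f = "\<lambda>p :: (real^'d) \<times> (real^'i). (A m *v fst p, snd p + lamS m)"
  have "?f ` orbit_closure x \<subseteq> orbit_closure x"
    unfolding orbit_closure_def
  proof (rule image_closure_subset)
    have "(A m *v (A n *v x + \<gamma>), lamS n + lamS m) = (A (m + n) *v x + A m *v \<gamma>, lamS (m + n))" for n \<gamma>
      by (simp add: A_add_v lamS_add matrix_vector_right_distrib add.commute)
    then show "?f ` {(A n *v x + \<gamma>, lamS n) | n \<gamma>. \<gamma> \<in> int_lattice} \<subseteq> closure {(A n *v x
        + \<gamma>, lamS n) | n \<gamma>. \<gamma> \<in> int_lattice}"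
      by (intro order_trans[OF _ closure_subset]) (use A_int in fastforce)
  qed (auto intro!: continuous_intros matrix_vector_mult_linear_continuous_on[THEN continuous_on_compose2])
  with y show "(A m *v y, t + lamS m) \<in> orbit_closure x" by force
qed

lemma orbit_closure_base: "(x, 0) \<in> orbit_closure x"
proof -
  have "(A 0 *v x + 0, lamS 0) \<in> {(A n *v x + \<gamma>, lamS n) | n \<gamma>. \<gamma> \<in> int_lattice}" using int_lattice_0 by blast
  then show ?thesis unfolding orbit_closure_def using closure_subset by (fastforce simp: A_0)
qed

lemma orbit_closure_approx:
  assumes "(y, \<tau>) \<in> orbit_closure x" "e > 0"
  obtains n \<gamma> where "\<gamma> \<in> int_lattice" "norm (A n *v x + \<gamma> - y) < e" "norm (lamS n - \<tau>) < e"
proof -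
  from assms obtain p where p: "p \<in> {(A n *v x + \<gamma>, lamS n) | n \<gamma>. \<gamma> \<in> int_lattice}" "dist p (y, \<tau>) < e"
    unfolding orbit_closure_def closure_approachable by blast
  then obtain n \<gamma> where n: "p = (A n *v x + \<gamma>, lamS n)" "\<gamma> \<in> int_lattice" by blast
  have "dist (A n *v x + \<gamma>) y \<le> dist p (y, \<tau>)" "dist (lamS n) \<tau> \<le> dist p (y, \<tau>)"
    using dist_fst_le[of p "(y, \<tau>)"] dist_snd_le[of p "(y, \<tau>)"] by (auto simp: n(1))
  then show ?thesis using that[OF n(2), of n] p(2) by (simp add: dist_norm)
qed

text \<open>Some \<open>lamS n\<close> comes close to \<tau>. Acting by -n maps the full fibre over
  \<tau> onto a full fibre close to 0.\<close>

lemma full_fibre_at_0: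
  assumes full: "\<And>y. (y, \<tau>) \<in> orbit_closure x"
  shows "(y, 0) \<in> orbit_closure x"
proof -
  have "(y, 0) \<in> closure (orbit_closure x)"
    unfolding closure_approachable
  proof (intro allI impI)
    fix e :: real assume "e > 0"
    obtain n where n: "norm (lamS n - \<tau>) < e" using orbit_closure_approx[OF full \<open>e > 0\<close>] by metis
    have "(A (- n) *v (A n *v y), \<tau> + lamS (- n)) \<in> orbit_closure x"
      by (rule invariant_act[OF invariant_orbit_closure full])
    moreover have "dist (A (- n) *v (A n *v y), \<tau> + lamS (- n)) (y, 0) < e"
      using n by (simp add: A_minus lamS_minus dist_norm norm_Pair norm_minus_commute)
    ultimately show "\<exists>p\<in>orbit_closure x. dist p (y, 0) < e" by blast
  qed
  then show ?thesis by (simp add: orbit_closure_def)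
qed

text \<open>The property passes back along the orbit: \<open>A (- n)\<close> preserves the rational
  vectors and \<open>V\<close>.\<close>

lemma translated_torsion_A:
  assumes "A n *v x + \<gamma> - p \<in> V" "\<gamma> \<in> int_lattice" "\<forall>j. p $ j \<in> \<rat>"
  shows "x \<in> translated_torsion"
proof -
  define q where "q = A (- n) *v (p - \<gamma>)"
  have "\<gamma> $ j \<in> \<rat>" for j using assms(2) Ints_subset_Rats by (auto simp: int_lattice_def)
  then have "q $ j \<in> \<rat>" for j
    unfolding q_def matrix_vector_mult_def using assms(3) A_entries Ints_subset_Rats
    by (auto intro!: Rats_sum Rats_mult Rats_diff)
  moreover have "x - q = A (- n) *v (A n *v x + \<gamma> - p)"
    by (simp add: q_def matrix_vector_mult_diff_distrib matrix_vector_right_distrib A_minus)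
  then have "x - q \<in> V" using assms(1) by (simp add: V_A)
  ultimately show ?thesis unfolding translated_torsion_def
    by (intro CollectI exI[of _ q] exI[of _ "x - q"]) simp
qed

end

subsection \<open>Dense and non-dense partial orbits\<close>

lemma closed_int_lattice: "closed (int_lattice :: (real^'d) set)"
proof -
  have "int_lattice = (\<Inter>j. (\<lambda>x :: real^'d. x $ j) -` \<int>)" by (auto simp: int_lattice_def)
  moreover have "closed \<dots>" by (intro closed_INT ballI closed_vimage closed_Ints continuous_intros)
  ultimately show ?thesis by simp
qed

lemma countable_int_lattice: "countable (int_lattice :: (real^'d) set)"
proof -
  have "x \<in> range vec_of_int" if "x \<in> int_lattice" for x :: "real^'d"
  proof -
    have "x = vec_of_int (\<chi> j. \<lfloor>x $ j\<rfloor>)" using that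
      by (auto simp: vec_of_int_def vec_eq_iff int_lattice_def Ints_def)
    then show ?thesis by blast
  qed
  then show ?thesis by (intro countable_subset[OF _ countable_image[of UNIV vec_of_int]]) auto
qed

context torus_flow
begin

lemma off_add_V: "v \<in> V \<Longrightarrow> off (x + v) = off x"
  by (simp add: off_def V_def linear_add[OF P_lin] if_distrib cong: if_cong)

text \<open>Recentre at the rational point \<open>p\<close>. The shifted orbit closure is invariant
  under the congruence subgroup fixing \<open>p\<close> modulo the lattice, and orbit points near y
  = p + v become points near \<open>v\<close> in \<open>V\<close>. They are not in \<open>V\<close>
  since \<open>x\<close> is not translated torsion, so the shifted set accumulates at
  \<open>V\<close>.\<close>

lemma fibre_full_if_torsion_limit:
  assumes x: "x \<notin> translated_torsion" and y: "y \<in> translated_torsion" "(y, t0) \<in> orbit_closure x"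
  obtains \<tau> where "\<And>w. (w, \<tau>) \<in> orbit_closure x"
proof -
  obtain p v where p: "y = p + v" "\<forall>j. p $ j \<in> \<rat>" "v \<in> V" using y(1) by (auto simp: translated_torsion_def)
  obtain N :: nat where N: "N > 0" "real N *\<^sub>R p \<in> int_lattice" by (rule rational_vector_denominator[OF p(2)])
  obtain q where q: "q > 0" "\<And>n a. real N *\<^sub>R a \<in> int_lattice \<Longrightarrow> A (of_nat q *s n) *v a - a \<in> int_lattice"
    by (rule congruence_subgroup[OF N(1)]) blast
  interpret G: torus_flow "\<lambda>n. A (of_nat q *s n)" P "\<lambda>n. z (of_nat q *s n)" "\<lambda>i h. real q * l i h" S
    by (rule scaled_flow[OF q(1)])
  have GC: "G.C = C" using q(1) by (auto simp: G.H_def H_def G.C_def C_def)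
  have GV: "G.V = V" by (simp add: G.V_def V_def GC)
  have Goff: "G.off = off" by (simp add: fun_eq_iff G.off_def off_def GC)
  have Glam: "G.lamS n = lamS (of_nat q *s n)" for n
    by (simp add: G.lamS_def lamS_def vec_eq_iff vec_of_int_scale l_scale)
  define M where "M = {(w, t) | w t. (w + p, t) \<in> orbit_closure x}"
  note inv = invariant_orbit_closure[of x]
  have "G.invariant M" unfolding G.invariant_def
  proof (intro conjI allI impI)
    have "M = (\<lambda>r. (fst r + p, snd r)) -` orbit_closure x" by (auto simp: M_def)
    moreover have "closed ((\<lambda>r. (fst r + p, snd r)) -` orbit_closure x)"
      by (intro closed_vimage invariant_closed[OF inv] continuous_intros)
    ultimately show "closed M" by simp
  next
    fix w t and \<gamma> :: "real^'d" assume "(w, t) \<in> M" "\<gamma> \<in> int_lattice"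
    then show "(w + \<gamma>, t) \<in> M" using invariant_shift[OF inv, of "w + p" t \<gamma>] by (simp add: M_def algebra_simps)
  next
    fix w t n assume "(w, t) \<in> M"
    then have "(A (of_nat q *s n) *v (w + p), t + lamS (of_nat q *s n)) \<in> orbit_closure x"
      by (intro invariant_act[OF inv]) (simp add: M_def)
    from invariant_shift[OF inv this int_lattice_minus[OF q(2)[OF N(2), of n]]]
    show "(A (of_nat q *s n) *v w, t + G.lamS n) \<in> M"
      by (simp add: M_def Glam matrix_vector_right_distrib algebra_simps)
  qed
  moreover have "G.accumulates M" unfolding G.accumulates_def GV Goff
  proof (intro exI[of _ "norm v + norm t0 + 1"] allI impI)
    fix \<delta> :: real assume \<delta>: "\<delta> > 0"
    obtain B2 where B2: "B2 > 0" "\<And>x i. cmod (P x $ i) \<le> B2 * norm x" "\<And>x. off x \<le> B2 * norm x"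
      by (rule coord_le_norm) blast
    define e where "e = min 1 (\<delta> / B2)"
    have e: "e > 0" "e \<le> 1" "e \<le> \<delta> / B2" using \<delta> B2(1) by (auto simp: e_def)
    obtain n \<gamma> where n: "\<gamma> \<in> int_lattice" "norm (A n *v x + \<gamma> - y) < e" "norm (lamS n - t0) < e"
      by (rule orbit_closure_approx[OF y(2) e(1)]) blast
    define u where "u = A n *v x + \<gamma> - p"
    have uv: "u - v = A n *v x + \<gamma> - y" by (simp add: u_def p(1))
    have "(A n *v x + \<gamma>, 0 + lamS n) \<in> orbit_closure x"
      by (intro invariant_shift[OF inv] invariant_act[OF inv] orbit_closure_base n(1))
    then have "(u, lamS n) \<in> M" by (simp add: M_def u_def)
    moreover have "norm u \<le> norm v + norm t0 + 1"
      using norm_triangle_ineq2[of u v] n(2) e(2) norm_ge_zero[of t0] unfolding uv by linarith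
    moreover have "norm (lamS n) \<le> norm v + norm t0 + 1"
      using norm_triangle_ineq2[of "lamS n" t0] n(3) e(2) norm_ge_zero[of v] by linarith
    moreover have "u \<notin> V" using translated_torsion_A[of n x \<gamma> p] n(1) p(2) x by (auto simp: u_def)
    moreover have "off u \<le> \<delta>"
    proof -
      have "off u = off (u - v)" using off_add_V[OF p(3), of "u - v"] by simp
      also have "\<dots> \<le> B2 * norm (u - v)" by (rule B2)
      also have "\<dots> \<le> B2 * (\<delta> / B2)" using n(2) e(3) B2(1) unfolding uv by (intro mult_left_mono) auto
      finally show ?thesis using B2(1) by simp
    qed
    ultimately show "\<exists>u s. (u, s) \<in> M \<and> norm s \<le> norm v + norm t0 + 1 \<and> norm u \<le> norm v + norm t0 + 1 \<and> u \<notin> V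
        \<and> off u \<le> \<delta>"
      by blast
  qed
  ultimately obtain \<tau> where \<tau>: "\<And>w. (w, \<tau>) \<in> M" by (rule G.accumulating_fills_fibre) blast
  show ?thesis
  proof (rule that)
    fix w show "(w, \<tau>) \<in> orbit_closure x" using \<tau>[of "w - p"] by (simp add: M_def)
  qed
qed

text \<open>Intersecting \<open>M\<close> with its translates by torsion points: each intersection is non-empty
  because the fibrewise difference set of an invariant set is everything.\<close>
lemma torsion_coset_in_orbit_closure:
  assumes no: "\<And>y t. (y, t) \<in> orbit_closure x \<Longrightarrow> y \<notin> translated_torsion" and N: "(N :: nat) > 0"
  obtains y s where "norm s < 1" "\<And>a. real N *\<^sub>R a \<in> int_lattice \<Longrightarrow> (y + a, s) \<in> orbit_closure x"
proof -
  obtain q where q: "q > 0" "\<And>n a. real N *\<^sub>R a \<in> int_lattice \<Longrightarrow> A (of_nat q *s n) *v a - a \<in> int_lattice"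
    by (rule congruence_subgroup[OF N(1)]) blast
  interpret G: torus_flow "\<lambda>n. A (of_nat q *s n)" P "\<lambda>n. z (of_nat q *s n)" "\<lambda>i h. real q * l i h" S
    by (rule scaled_flow[OF q(1)])
  have GC: "G.C = C" using q(1) by (auto simp: G.H_def H_def G.C_def C_def)
  have GV: "G.V = V" by (simp add: G.V_def V_def GC)
  have Gt: "G.translated_torsion = translated_torsion"
    by (simp add: G.translated_torsion_def translated_torsion_def GV)
  have Glam: "G.lamS n = lamS (of_nat q *s n)" for n
    by (simp add: G.lamS_def lamS_def vec_eq_iff vec_of_int_scale l_scale)
  note inv = invariant_orbit_closure[of x]
  have Ginv: "G.invariant (orbit_closure x)"
    using inv unfolding invariant_def G.invariant_def Glam by blast
  have chain: "\<exists>M. G.invariant M \<and> M \<noteq> {} \<and> M \<subseteq> orbit_closure x \<and> (\<forall>a\<in>T. \<forall>y s. (y, s) \<in> M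
      \<longrightarrow> (y + a, s) \<in> orbit_closure x)"
    if "finite T" "\<forall>a\<in>T. real N *\<^sub>R a \<in> int_lattice" for T
    using that
  proof (induction T rule: finite_induct)
    case empty
    then show ?case using Ginv orbit_closure_base[of x] by (intro exI[of _ "orbit_closure x"]) auto
  next
    case (insert a T)
    then obtain M where M: "G.invariant M" "M \<noteq> {}" "M \<subseteq> orbit_closure x"
      "\<forall>a\<in>T. \<forall>y s. (y, s) \<in> M \<longrightarrow> (y + a, s) \<in> orbit_closure x" by auto
    \<comment> \<open>Elements of q Z^r fix \<open>a\<close> modulo the lattice, so the intersection
      keeps the invariance under the congruence subgroup.\<close>
    define M' where "M' = {(y, s) | y s. (y, s) \<in> M \<and> (y + a, s) \<in> M}"
    have a: "real N *\<^sub>R a \<in> int_lattice" using insert.prems by simp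
    have "G.invariant M'" unfolding G.invariant_def
    proof (intro conjI allI impI)
      have "M' = M \<inter> (\<lambda>r. (fst r + a, snd r)) -` M" by (auto simp: M'_def)
      moreover have "closed ((\<lambda>r. (fst r + a, snd r)) -` M)"
        by (intro closed_vimage G.invariant_closed[OF M(1)] continuous_intros)
      ultimately show "closed M'" using G.invariant_closed[OF M(1)] by auto
    next
      fix y s and \<gamma> :: "real^'d" assume "(y, s) \<in> M'" "\<gamma> \<in> int_lattice"
      then show "(y + \<gamma>, s) \<in> M'"
        using G.invariant_shift[OF M(1), of y s \<gamma>] G.invariant_shift[OF M(1), of "y + a" s \<gamma>]
        by (simp add: M'_def algebra_simps)
    next
      fix y s n assume "(y, s) \<in> M'"
      then have y: "(y, s) \<in> M" "(y + a, s) \<in> M" by (auto simp: M'_def)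
      have eq: "A (of_nat q *s n) *v (y + a) + (- (A (of_nat q *s n) *v a - a)) = A (of_nat q *s n) *v y + a"
        by (simp add: matrix_vector_right_distrib)
      have "(A (of_nat q *s n) *v y + a, s + G.lamS n) \<in> M"
        unfolding eq[symmetric] by (intro G.invariant_shift[OF M(1)] G.invariant_act[OF M(1) y(2)]
            int_lattice_minus q(2) a)
      then show "(A (of_nat q *s n) *v y, s + G.lamS n) \<in> M'"
        using G.invariant_act[OF M(1) y(1), of n] by (simp add: M'_def)
    qed
    moreover have "M' \<noteq> {}"
    proof -
      obtain y s where ys: "(y, s) \<in> M" using M(2) by auto
      then have "y \<notin> G.translated_torsion" using no M(3) Gt by blast
      from G.difference_fills_fibre[OF M(1) ys this] obtain \<tau> where "\<And>w. \<exists>y. (y, \<tau>) \<in> M \<and> (y + w, \<tau>) \<in> M"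
        by blast
      then obtain y' where "(y', \<tau>) \<in> M" "(y' + a, \<tau>) \<in> M" by blast
      then have "(y', \<tau>) \<in> M'" by (simp add: M'_def)
      then show ?thesis by blast
    qed
    moreover have "M' \<subseteq> orbit_closure x" using M(3) by (auto simp: M'_def)
    moreover have "\<forall>b\<in>insert a T. \<forall>y s. (y, s) \<in> M' \<longrightarrow> (y + b, s) \<in> orbit_closure x"
      using M(3,4) by (auto simp: M'_def)
    ultimately show ?case by blast
  qed
  define T where "T = (\<lambda>b. (1 / real N) *\<^sub>R b) ` {b \<in> int_lattice. \<forall>i. \<bar>(b :: real^'d) $ i\<bar> \<le> real N}"
  have T: "finite T" "\<forall>a\<in>T. real N *\<^sub>R a \<in> int_lattice"
    using N by (auto simp: T_def intro!: finite_imageI finite_bounded_int_lattice)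
  from chain[OF T] obtain M where M: "G.invariant M" "M \<noteq> {}" "M \<subseteq> orbit_closure x"
      "\<forall>a\<in>T. \<forall>y s. (y, s) \<in> M \<longrightarrow> (y + a, s) \<in> orbit_closure x" by (elim exE conjE)
  obtain y s where ys: "(y, s) \<in> M" using M(2) by auto
  have all: "(y + a, s) \<in> orbit_closure x" if a: "real N *\<^sub>R a \<in> int_lattice" for a
  proof -
    \<comment> \<open>Removing the integer part brings \<open>a\<close> into the finite set
      \<open>T\<close>, so finitely many intersections cover all of the N-torsion.\<close>
    define \<gamma> where "\<gamma> = vec_of_int (floor_vec a)"
    have g: "\<gamma> \<in> int_lattice" by (simp add: \<gamma>_def int_lattice_def vec_of_int_def)
    define b where "b = real N *\<^sub>R (a - \<gamma>)"
    have "b \<in> int_lattice"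
      using a g by (auto simp: b_def int_lattice_def right_diff_distrib intro!: Ints_diff Ints_mult)
    moreover have "\<bar>b $ i\<bar> \<le> real N" for i
    proof -
      have "\<bar>(a - \<gamma>) $ i\<bar> \<le> 1" by (simp add: \<gamma>_def vec_of_int_def floor_vec_def abs_le_iff) linarith
      then have "real N * \<bar>(a - \<gamma>) $ i\<bar> \<le> real N * 1" by (intro mult_left_mono) auto
      then show ?thesis by (simp add: b_def abs_mult)
    qed
    ultimately have "(1 / real N) *\<^sub>R b \<in> T" by (auto simp: T_def)
    then have "a - \<gamma> \<in> T" using N by (simp add: b_def)
    then have "(y + (a - \<gamma>), s) \<in> orbit_closure x" using M(4) ys by blast
    from invariant_shift[OF inv this g] show ?thesis by simp
  qed
  \<comment> \<open>The fibre is moved to within distance 1 of 0, so that fibres belonging to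
    different \<open>N\<close> have a convergent subsequence; \<open>A n\<close> preserves the
    N-torsion, hence a whole coset is moved.\<close>
  have "real N *\<^sub>R 0 \<in> int_lattice" by (simp add: int_lattice_0)
  from all[OF this] have "(y, s) \<in> orbit_closure x" by simp
  then obtain n where n: "norm (lamS n - s) < 1" using orbit_closure_approx[of y s x 1] by auto
  show ?thesis
  proof (rule that)
    show "norm (s + lamS (- n)) < 1" using n by (simp add: lamS_minus norm_minus_commute)
    fix a :: "real^'d" assume "real N *\<^sub>R a \<in> int_lattice"
    then have "real N *\<^sub>R (A n *v a) \<in> int_lattice" using A_int[of "real N *\<^sub>R a" n]
      by (simp add: matrix_vector_mult_scaleR)
    from invariant_act[OF inv all[OF this], of "- n"]
    show "(A (- n) *v y + a, s + lamS (- n)) \<in> orbit_closure x"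
      by (simp add: matrix_vector_right_distrib A_minus)
  qed
qed

text \<open>In the second case the closure contains cosets of the (k+1)-torsion for every
  \<open>k\<close>. Each of them comes within \<open>CARD('d)\<close> / (k+1) of any given
  \<open>w\<close>, and their fibres are bounded, so a limit fibre is full.\<close>

theorem orbit_closure_full:
  assumes x: "x \<notin> translated_torsion"
  shows "(w, 0) \<in> orbit_closure x"
proof (cases "\<exists>y t. (y, t) \<in> orbit_closure x \<and> y \<in> translated_torsion")
  case True
  then obtain y t where "(y, t) \<in> orbit_closure x" "y \<in> translated_torsion" by blast
  with fibre_full_if_torsion_limit[OF x] obtain \<tau> where "\<And>w. (w, \<tau>) \<in> orbit_closure x" by blast
  then show ?thesis by (rule full_fibre_at_0)
next
  case False
  define R where "R = (\<lambda>k y s. norm s < 1 \<and> (\<forall>a. real (Suc k) *\<^sub>R a \<in> int_lattice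
      \<longrightarrow> (y + a, s) \<in> orbit_closure x))"
  have "\<exists>y s. R k y s" for k
  proof -
    obtain y s where "norm s < 1" "\<And>a. real (Suc k) *\<^sub>R a \<in> int_lattice \<Longrightarrow> (y + a, s) \<in> orbit_closure x"
      by (rule torsion_coset_in_orbit_closure[of x "Suc k"]) (use False in auto)
    then show ?thesis by (auto simp: R_def)
  qed
  then obtain y s where R: "\<And>k. R k (y k) (s k)" by metis
  have s1: "norm (s k) \<le> 1" for k using R[of k] by (simp add: R_def)
  from convergent_triple[of s _ s _ s, OF s1 s1 s1] obtain r \<tau> where r: "strict_mono r" "(\<lambda>k. s (r k)) \<longlonglongrightarrow> \<tau>"
    by blast
  have "(w, \<tau>) \<in> orbit_closure x" for w
  proof -
    define a where "a = (\<lambda>k. (1 / real (Suc k)) *\<^sub>R vec_of_int (floor_vec (real (Suc k) *\<^sub>R (w - y k))))"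
    have "real (Suc k) *\<^sub>R a k \<in> int_lattice" for k
      by (simp add: a_def int_lattice_def vec_of_int_def del: of_nat_Suc)
    then have in_orb: "(y k + a k, s k) \<in> orbit_closure x" for k using R[of k] by (simp add: R_def)
    have "norm (y k + a k - w) \<le> real CARD('d) * (1 / real (Suc k))" for k
    proof -
      define h where "h = real (Suc k) *\<^sub>R (w - y k)"
      have "y k + a k - w = - (1 / real (Suc k)) *\<^sub>R (h - vec_of_int (floor_vec h))"
        by (simp add: a_def h_def scaleR_diff_right del: of_nat_Suc)
      then have "norm (y k + a k - w) = (1 / real (Suc k)) * norm (h - vec_of_int (floor_vec h))"
        by (simp del: of_nat_Suc)
      also have "\<dots> \<le> (1 / real (Suc k)) * real CARD('d)" by (intro mult_left_mono norm_floor_vec) auto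
      finally show ?thesis by (simp add: mult.commute)
    qed
    moreover have "(\<lambda>k. real CARD('d) * (1 / real (Suc k))) \<longlonglongrightarrow> 0"
      using tendsto_mult[OF tendsto_const LIMSEQ_Suc[OF lim_1_over_n], of "real CARD('d)"] by simp
    ultimately have "(\<lambda>k. y k + a k - w) \<longlonglongrightarrow> 0" by (intro Lim_null_comparison[of "\<lambda>k. y k + a k - w"]) auto
    then have "(\<lambda>k. y k + a k) \<longlonglongrightarrow> w" by (simp add: LIM_zero_iff)
    from LIMSEQ_subseq_LIMSEQ[OF this r(1)] have "(\<lambda>k. y (r k) + a (r k)) \<longlonglongrightarrow> w" by (simp add: o_def)
    from limit_in_invariant[OF invariant_orbit_closure _ this r(2)] show ?thesis using in_orb by blast
  qed
  then show ?thesis by (rule full_fibre_at_0)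
qed

theorem dense_partial_orbit:
  assumes x: "x \<notin> translated_torsion" and e: "\<epsilon> > 0" "\<eta> > 0"
  shows "\<exists>n. (\<forall>i\<in>S. \<bar>l i (vec_of_int n)\<bar> < \<epsilon>) \<and> (\<exists>\<gamma>\<in>int_lattice. norm (A n *v x + \<gamma> - w) < \<eta>)"
proof -
  obtain n \<gamma> where n: "\<gamma> \<in> int_lattice" "norm (A n *v x + \<gamma> - w) < min \<epsilon> \<eta>" "norm (lamS n - 0) < min \<epsilon> \<eta>"
    by (rule orbit_closure_approx[OF orbit_closure_full[OF x, of w], of "min \<epsilon> \<eta>"]) (use e in auto)
  have "\<bar>l i (vec_of_int n)\<bar> < \<epsilon>" if "i \<in> S" for i
    using Finite_Cartesian_Product.norm_nth_le[of "lamS n" i] n(3) that by (simp add: lamS_def)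
  then show ?thesis using n by auto
qed

text \<open>Without transverse places, an element \<open>m\<close> close to 1 on \<open>C\<close>
  moves every standard basis vector by less than 1. The displacement is a lattice vector, hence 0,
  so \<open>A m\<close> is the identity and has eigenvalue 1, against \<open>z_one\<close>.\<close>

lemma V_not_UNIV: "V \<noteq> UNIV"
proof
  assume VU: "V = UNIV"
  obtain h where h: "h \<in> H" "h \<noteq> 0" by (rule H_nonzero)
  have hC: "l i h = 0" if "i \<in> C" for i using that h(1) by (simp add: C_def)
  obtain B1 where B1: "B1 > 0" "\<And>x K. (\<And>i. cmod (P x $ i) \<le> K) \<Longrightarrow> norm x \<le> B1 * K"
    by (rule norm_le_coord_bound) blast
  define E where "E = (\<Sum>j\<in>UNIV. norm (P (axis j 1 :: real^'d))) + 1"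
  have E0: "E \<ge> 1" unfolding E_def by (simp add: sum_nonneg)
  have Ej: "norm (P (axis j 1)) \<le> E" for j
  proof -
    have "norm (P (axis j 1)) \<le> (\<Sum>j\<in>UNIV. norm (P (axis j 1 :: real^'d)))" by (rule member_le_sum) auto
    then show ?thesis by (simp add: E_def)
  qed
  define \<epsilon> where "\<epsilon> = 1 / (2 * B1 * E)"
  have "\<epsilon> > 0" using B1(1) E0 by (simp add: \<epsilon>_def)
  from almost_identity_element[OF h(2) hC this] obtain m where m: "m \<noteq> 0" "\<And>i. i \<in> C \<Longrightarrow> cmod (z m i - 1) < \<epsilon>"
    by blast
  have Pz: "P (A m *v x - x) $ i = (z m i - 1) * P x $ i" for x i
    by (simp add: linear_diff[OF P_lin] P_A algebra_simps)
  have fix_basis: "A m *v axis j 1 = axis j 1" for j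
  proof -
    define d where "d = A m *v axis j 1 - axis j 1"
    have ax: "axis j 1 \<in> int_lattice" by (simp add: int_lattice_def axis_def)
    have "norm d \<le> B1 * (\<epsilon> * E)"
    proof (rule B1(2))
      fix i
      show "cmod (P d $ i) \<le> \<epsilon> * E"
      proof (cases "i \<in> C")
        case True
        have "cmod (P (axis j 1) $ i) \<le> E" using P_coord_bound[of "axis j 1" i] Ej[of j] by linarith
        then show ?thesis unfolding d_def Pz norm_mult using m(2)[OF True] \<open>\<epsilon> > 0\<close> by (intro mult_mono) auto
      next
        case False
        then have "P (axis j 1) $ i = 0" using VU by (auto simp: V_def)
        then show ?thesis unfolding d_def Pz using \<open>\<epsilon> > 0\<close> E0 by simp
      qed
    qed
    also have "B1 * (\<epsilon> * E) < 1" using B1(1) E0 by (simp add: \<epsilon>_def)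
    finally have "norm d < 1" .
    moreover have "d \<in> int_lattice" unfolding d_def by (intro int_lattice_diff A_int ax)
    ultimately have "d $ i = 0" for i
      using Finite_Cartesian_Product.norm_nth_le[of d i]
        by (intro Ints_nonzero_abs_less1) (auto simp: int_lattice_def)
    then show ?thesis by (simp add: d_def vec_eq_iff)
  qed
  have "\<exists>j. P (axis j 1 :: real^'d) \<noteq> 0"
    using P_inj linear_0[OF P_lin] by (metis axis_eq_0_iff injD zero_neq_one)
  then obtain j i where ji: "P (axis j 1) $ i \<noteq> 0" by (auto simp: vec_eq_iff)
  have "(z m i - 1) * P (axis j 1) $ i = 0" unfolding Pz[symmetric] fix_basis by (simp add: linear_0[OF P_lin])
  then have "z m i = 1" using ji by simp
  then show False using z_one m(1) by blast
qed

text \<open>With x = p + v, the orbit of \<open>p\<close> stays among vectors of denominator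
  \<open>N\<close>, and that of \<open>v\<close> in a bounded part of \<open>V\<close> because the
  eigenvalues over \<open>C\<close> are bounded on \<Omega>. The sum \<open>E\<close> of the two
  sets is closed, one summand being compact, and it is null as part of countably many translates of
  a proper subspace; so it misses a ball.\<close>

theorem torsion_partial_orbit_not_dense:
  assumes x: "x \<in> translated_torsion" and bd: "\<And>n i. n \<in> \<Omega> \<Longrightarrow> i \<in> C \<Longrightarrow> l i (vec_of_int n) \<le> K"
  obtains w \<eta> where "\<eta> > 0" "\<And>n \<gamma>. n \<in> \<Omega> \<Longrightarrow> \<gamma> \<in> int_lattice \<Longrightarrow> norm (A n *v x + \<gamma> - w) \<ge> \<eta>"
proof -
  obtain p v where p: "x = p + v" "\<forall>j. p $ j \<in> \<rat>" "v \<in> V" using x by (auto simp: translated_torsion_def)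
  obtain N :: nat where N: "N > 0" "real N *\<^sub>R p \<in> int_lattice" by (rule rational_vector_denominator[OF p(2)])
  obtain B1 where B1: "B1 > 0" "\<And>x K. (\<And>i. cmod (P x $ i) \<le> K) \<Longrightarrow> norm x \<le> B1 * K"
    by (rule norm_le_coord_bound) blast
  define T where "T = {a :: real^'d. real N *\<^sub>R a \<in> int_lattice}"
  define W where "W = V \<inter> cball 0 (B1 * (exp K * norm (P v)))"
  have "T = (\<lambda>a. real N *\<^sub>R a) -` int_lattice" by (auto simp: T_def)
  then have clT: "closed T" by (simp add: closed_vimage closed_int_lattice continuous_intros)
  have cmW: "compact W" unfolding W_def by (intro closed_Int_compact closed_subspace subspace_V compact_cball)
  define E where "E = (\<Union>a\<in>T. \<Union>u\<in>W. {a + u})"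
  have clE: "closed E" unfolding E_def by (rule closed_compact_sums[OF clT cmW])
  have "E \<noteq> UNIV"
  proof
    assume "E = UNIV"
    have "countable T"
    proof -
      have "T \<subseteq> (\<lambda>b. (1 / real N) *\<^sub>R b) ` int_lattice"
      proof
        fix a assume "a \<in> T"
        then have "a = (1 / real N) *\<^sub>R (real N *\<^sub>R a)" "real N *\<^sub>R a \<in> int_lattice" using N
          by (auto simp: T_def)
        then show "a \<in> (\<lambda>b. (1 / real N) *\<^sub>R b) ` int_lattice" by blast
      qed
      then show ?thesis using countable_int_lattice countable_image countable_subset by blast
    qed
    moreover have "negligible ((+) a ` V)" for a
    proof -
      have "dim V < DIM(real^'d)"
        using V_not_UNIV subspace_V dim_eq_full[of V] dim_subset_UNIV[of V] span_eq_iff[of V]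
          by (metis le_neq_implies_less)
      then show ?thesis by (intro negligible_translation negligible_lowdim)
    qed
    ultimately have "negligible (\<Union>((\<lambda>a. (+) a ` V) ` T))" by (intro negligible_countable_Union) auto
    moreover have "E \<subseteq> \<Union>((\<lambda>a. (+) a ` V) ` T)" by (auto simp: E_def W_def)
    ultimately have "negligible (UNIV :: (real^'d) set)" using \<open>E = UNIV\<close> by (metis negligible_subset)
    then show False by simp
  qed
  then obtain w where w: "w \<notin> E" by blast
  have "open (- E)" using clE by (rule open_Compl)
  then obtain \<eta> where \<eta>: "\<eta> > 0" "ball w \<eta> \<subseteq> - E" using w open_contains_ball by (metis ComplI)
  show ?thesis
  proof (rule that[OF \<eta>(1)], rule ccontr)
    fix n \<gamma> assume n: "n \<in> \<Omega>" "\<gamma> \<in> int_lattice" "\<not> norm (A n *v x + \<gamma> - w) \<ge> \<eta>"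
    have "A n *v x + \<gamma> \<in> E"
    proof -
      have "real N *\<^sub>R (A n *v p + \<gamma>) = A n *v (real N *\<^sub>R p) + real N *\<^sub>R \<gamma>"
        by (simp add: scaleR_right_distrib matrix_vector_mult_scaleR)
      also have "\<dots> \<in> int_lattice" using n(2) by (intro int_lattice_add A_int N) (auto simp: int_lattice_def)
      finally have "A n *v p + \<gamma> \<in> T" by (simp add: T_def)
      moreover have "A n *v v \<in> W"
      proof -
        have "norm (A n *v v) \<le> B1 * (exp K * norm (P v))"
        proof (rule B1(2))
          fix i
          show "cmod (P (A n *v v) $ i) \<le> exp K * norm (P v)"
          proof (cases "i \<in> C")
            case True
            then show ?thesis unfolding P_A norm_mult l_z using bd[OF n(1) True] P_coord_bound[of v i]
              by (intro mult_mono) auto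
          next
            case False
            then have "P v $ i = 0" using p(3) by (simp add: V_def)
            then show ?thesis by (simp add: P_A)
          qed
        qed
        then show ?thesis using p(3) by (simp add: W_def V_A)
      qed
      moreover have "A n *v x + \<gamma> = (A n *v p + \<gamma>) + A n *v v" by (simp add: p(1) matrix_vector_right_distrib)
      ultimately show ?thesis unfolding E_def by blast
    qed
    moreover have "A n *v x + \<gamma> \<in> ball w \<eta>" using n(3) by (simp add: dist_norm norm_minus_commute)
    ultimately show False using \<eta>(2) by blast
  qed
qed

end

subsection \<open>Quotient groups and irreducibility\<close>

lemma coset_proj_eq_image: "coset_proj V \<Gamma> x = (\<lambda>\<gamma>. \<gamma> + x) ` \<Gamma>"
  by (auto simp: coset_proj_def r_coset_def additive_group_def)

lemma image_coset_proj:
  assumes "\<And>x y. f (x + y) = f x + f y" "f ` \<Gamma> = \<Gamma>"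
  shows "f ` coset_proj V \<Gamma> x = coset_proj V \<Gamma> (f x)"
proof -
  have "f ` coset_proj V \<Gamma> x = (\<lambda>\<gamma>. \<gamma> + f x) ` f ` \<Gamma>"
    by (simp add: coset_proj_eq_image image_image assms(1))
  then show ?thesis by (simp add: assms(2) coset_proj_eq_image)
qed

locale real_quotient =
  fixes V \<Gamma> :: "'a::real_normed_vector set"
  assumes subspace: "subspace V" and \<Gamma>_sub: "\<Gamma> \<subseteq> V" and \<Gamma>_0: "0 \<in> \<Gamma>"
    and \<Gamma>_add: "\<And>x y. x \<in> \<Gamma> \<Longrightarrow> y \<in> \<Gamma> \<Longrightarrow> x + y \<in> \<Gamma>" and \<Gamma>_minus: "\<And>x. x \<in> \<Gamma> \<Longrightarrow> - x \<in> \<Gamma>"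
begin

lemma coset_proj_eq_iff: "coset_proj V \<Gamma> x = coset_proj V \<Gamma> y \<longleftrightarrow> x - y \<in> \<Gamma>"
proof
  assume "coset_proj V \<Gamma> x = coset_proj V \<Gamma> y"
  moreover have "x \<in> coset_proj V \<Gamma> x" using \<Gamma>_0 by (force simp: coset_proj_eq_image)
  ultimately show "x - y \<in> \<Gamma>" by (auto simp: coset_proj_eq_image)
next
  assume xy: "x - y \<in> \<Gamma>"
  have "\<gamma> + x \<in> (\<lambda>\<gamma>. \<gamma> + y) ` \<Gamma>" if "\<gamma> \<in> \<Gamma>" for \<gamma>
    using \<Gamma>_add[OF that xy] by (intro image_eqI[of _ _ "\<gamma> + (x - y)"]) auto
  moreover have "\<gamma> + y \<in> (\<lambda>\<gamma>. \<gamma> + x) ` \<Gamma>" if "\<gamma> \<in> \<Gamma>" for \<gamma>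
    using \<Gamma>_add[OF that \<Gamma>_minus[OF xy]] by (intro image_eqI[of _ _ "\<gamma> + - (x - y)"]) auto
  ultimately show "coset_proj V \<Gamma> x = coset_proj V \<Gamma> y" unfolding coset_proj_eq_image by blast
qed

lemma comm_group_additive: "comm_group (additive_group V)"
proof (rule comm_groupI)
  fix x assume "x \<in> carrier (additive_group V)"
  then show "\<exists>y\<in>carrier (additive_group V). y \<otimes>\<^bsub>additive_group V\<^esub> x = \<one>\<^bsub>additive_group V\<^esub>"
    using subspace_neg[OF subspace, of x] by (intro bexI[of _ "- x"]) (auto simp: additive_group_def)
qed (use subspace in \<open>auto simp: additive_group_def subspace_add subspace_0\<close>)

lemma inv_additive: "x \<in> V \<Longrightarrow> inv\<^bsub>additive_group V\<^esub> x = - x"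
proof -
  interpret comm_group "additive_group V" by (rule comm_group_additive)
  assume "x \<in> V"
  then show ?thesis using subspace_neg[OF subspace] by (intro inv_equality) (auto simp: additive_group_def)
qed

lemma normal_\<Gamma>: "\<Gamma> \<lhd> additive_group V"
proof -
  interpret comm_group "additive_group V" by (rule comm_group_additive)
  have "subgroup \<Gamma> (additive_group V)"
  proof (rule subgroupI)
    show "\<Gamma> \<subseteq> carrier (additive_group V)" using \<Gamma>_sub by (simp add: additive_group_def)
    show "\<Gamma> \<noteq> {}" using \<Gamma>_0 by blast
    show "inv\<^bsub>additive_group V\<^esub> a \<in> \<Gamma>" if "a \<in> \<Gamma>" for a
      using that \<Gamma>_sub \<Gamma>_minus by (simp add: inv_additive subset_iff)
    show "a \<otimes>\<^bsub>additive_group V\<^esub> b \<in> \<Gamma>" if "a \<in> \<Gamma>" "b \<in> \<Gamma>" for a b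
      using that \<Gamma>_add by (simp add: additive_group_def)
  qed
  then show ?thesis by (rule subgroup_imp_normal)
qed

lemma group_hom_coset_proj: "group_hom (additive_group V) (quotient_group V \<Gamma>) (coset_proj V \<Gamma>)"
proof -
  interpret normal \<Gamma> "additive_group V" by (rule normal_\<Gamma>)
  show ?thesis unfolding group_hom_def group_hom_axioms_def quotient_group_def coset_proj_def[abs_def]
    using factorgroup_is_group r_coset_hom_Mod is_group by blast
qed

lemma carrier_quotient: "carrier (quotient_group V \<Gamma>) = coset_proj V \<Gamma> ` V"
  by (simp add: carrier_quotient_group topspace_quotient_topology)

lemma coset_proj_mult:
  assumes "x \<in> V" "y \<in> V"
  shows "coset_proj V \<Gamma> x \<otimes>\<^bsub>quotient_group V \<Gamma>\<^esub> coset_proj V \<Gamma> y = coset_proj V \<Gamma> (x + y)"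
  using group_hom.hom_mult[OF group_hom_coset_proj, of x y] assms by (simp add: additive_group_def)

lemma coset_proj_pow:
  assumes "x \<in> V"
  shows "coset_proj V \<Gamma> x [^]\<^bsub>quotient_group V \<Gamma>\<^esub> (n::nat) = coset_proj V \<Gamma> (real n *\<^sub>R x)"
proof (induction n)
  case 0
  have "coset_proj V \<Gamma> 0 = \<one>\<^bsub>quotient_group V \<Gamma>\<^esub>"
    using group_hom.hom_one[OF group_hom_coset_proj] by (simp add: additive_group_def)
  then show ?case by simp
next
  case (Suc n)
  then show ?case using assms subspace by (simp add: coset_proj_mult subspace_scale scaleR_left_distrib
      add.commute)
qed

lemma torsion_point_iff:
  assumes "x \<in> V"
  shows "torsion_point (quotient_group V \<Gamma>) (coset_proj V \<Gamma> x) \<longleftrightarrow> (\<exists>n::nat. n > 0 \<and> real n *\<^sub>R x \<in> \<Gamma>)"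
proof -
  have "coset_proj V \<Gamma> 0 = \<one>\<^bsub>quotient_group V \<Gamma>\<^esub>"
    using group_hom.hom_one[OF group_hom_coset_proj] by (simp add: additive_group_def)
  then have "coset_proj V \<Gamma> x [^]\<^bsub>quotient_group V \<Gamma>\<^esub> n = \<one>\<^bsub>quotient_group V \<Gamma>\<^esub> \<longleftrightarrow> real n *\<^sub>R x \<in> \<Gamma>" for n :: nat
    using coset_proj_eq_iff[of "real n *\<^sub>R x" 0] by (simp add: coset_proj_pow[OF assms])
  then show ?thesis using assms by (auto simp: torsion_point_def carrier_quotient)
qed

text \<open>Neighbourhoods in the quotient are tested by images of balls; the preimage of such an
  image is a union of lattice translates of the ball, hence open.\<close>

lemma dense_in_quotient_iff:
  assumes Y: "Y \<subseteq> V"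
  shows "quotient_topology V \<Gamma> closure_of (coset_proj V \<Gamma> ` Y) = carrier (quotient_group V \<Gamma>) \<longleftrightarrow>
    (\<forall>x\<in>V. \<forall>\<eta>>0. \<exists>y\<in>Y. \<exists>\<gamma>\<in>\<Gamma>. norm (y + \<gamma> - x) < \<eta>)"
  unfolding carrier_quotient_group dense_intersects_open openin_quotient_topology
proof (intro iffI ballI allI impI)
  fix x and \<eta> :: real
  assume dense: "\<forall>T. (T \<subseteq> coset_proj V \<Gamma> ` V \<and> openin (top_of_set V) {x \<in> V. coset_proj V \<Gamma> x \<in> T}) \<and> T \<noteq> {} \<longrightarrow>
      coset_proj V \<Gamma> ` Y \<inter> T \<noteq> {}" and x: "x \<in> V" and \<eta>: "\<eta> > 0"
  define T where "T = coset_proj V \<Gamma> ` (ball x \<eta> \<inter> V)"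
  have "{v \<in> V. coset_proj V \<Gamma> v \<in> T} = V \<inter> (\<Union>\<gamma>\<in>\<Gamma>. (\<lambda>v. v + \<gamma>) -` ball x \<eta>)"
  proof (rule Set.set_eqI)
    fix v
    show "v \<in> {v \<in> V. coset_proj V \<Gamma> v \<in> T} \<longleftrightarrow> v \<in> V \<inter> (\<Union>\<gamma>\<in>\<Gamma>. (\<lambda>v. v + \<gamma>) -` ball x \<eta>)"
    proof
      assume "v \<in> {v \<in> V. coset_proj V \<Gamma> v \<in> T}"
      then obtain u where u: "v \<in> V" "u \<in> ball x \<eta>" "v - u \<in> \<Gamma>" by (auto simp: T_def coset_proj_eq_iff)
      have "v + - (v - u) \<in> ball x \<eta>" using u(2) by simp
      then show "v \<in> V \<inter> (\<Union>\<gamma>\<in>\<Gamma>. (\<lambda>v. v + \<gamma>) -` ball x \<eta>)" using u(1) \<Gamma>_minus[OF u(3)] by blast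
    next
      assume "v \<in> V \<inter> (\<Union>\<gamma>\<in>\<Gamma>. (\<lambda>v. v + \<gamma>) -` ball x \<eta>)"
      then obtain \<gamma> where g: "v \<in> V" "\<gamma> \<in> \<Gamma>" "v + \<gamma> \<in> ball x \<eta>" by auto
      have "v + \<gamma> \<in> V" using g \<Gamma>_sub subspace by (auto intro: subspace_add)
      moreover have "coset_proj V \<Gamma> v = coset_proj V \<Gamma> (v + \<gamma>)" using \<Gamma>_minus[OF g(2)]
        by (simp add: coset_proj_eq_iff)
      ultimately show "v \<in> {v \<in> V. coset_proj V \<Gamma> v \<in> T}" using g by (auto simp: T_def)
    qed
  qed
  moreover have "open (\<Union>\<gamma>\<in>\<Gamma>. (\<lambda>v. v + \<gamma>) -` ball x \<eta>)"
    by (intro open_UN ballI open_vimage open_ball continuous_intros)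
  ultimately have op: "openin (top_of_set V) {v \<in> V. coset_proj V \<Gamma> v \<in> T}" by (simp add: openin_open_Int)
  have "x \<in> ball x \<eta> \<inter> V" using x \<eta> by simp
  then have ne: "T \<noteq> {}" and sub: "T \<subseteq> coset_proj V \<Gamma> ` V" unfolding T_def by blast+
  from dense[rule_format, OF conjI[OF conjI[OF sub op] ne]]
  obtain c where c: "c \<in> coset_proj V \<Gamma> ` Y" "c \<in> T" by blast
  from c(1) obtain y where y: "y \<in> Y" "c = coset_proj V \<Gamma> y" by blast
  from c(2) obtain u where u: "u \<in> ball x \<eta>" "c = coset_proj V \<Gamma> u" unfolding T_def by blast
  have uy: "u - y \<in> \<Gamma>" using y(2) u(2) by (simp add: coset_proj_eq_iff)
  have "norm (y + (u - y) - x) < \<eta>" using u(1) by (simp add: dist_norm norm_minus_commute)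
  then show "\<exists>y\<in>Y. \<exists>\<gamma>\<in>\<Gamma>. norm (y + \<gamma> - x) < \<eta>" using y(1) uy by blast
next
  fix T
  assume dense: "\<forall>x\<in>V. \<forall>\<eta>>0. \<exists>y\<in>Y. \<exists>\<gamma>\<in>\<Gamma>. norm (y + \<gamma> - x) < \<eta>"
    and T: "(T \<subseteq> coset_proj V \<Gamma> ` V \<and> openin (top_of_set V) {x \<in> V. coset_proj V \<Gamma> x \<in> T}) \<and> T \<noteq> {}"
  then obtain x where x: "x \<in> V" "coset_proj V \<Gamma> x \<in> T" by blast
  then obtain \<eta> where \<eta>: "\<eta> > 0" "ball x \<eta> \<inter> V \<subseteq> {x \<in> V. coset_proj V \<Gamma> x \<in> T}"
    using T openin_contains_ball[of V "{x \<in> V. coset_proj V \<Gamma> x \<in> T}"] by blast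
  obtain y \<gamma> where y: "y \<in> Y" "\<gamma> \<in> \<Gamma>" "norm (y + \<gamma> - x) < \<eta>" using dense x \<eta>(1) by blast
  have "y + \<gamma> \<in> ball x \<eta> \<inter> V" using y Y \<Gamma>_sub subspace
    by (auto simp: dist_norm norm_minus_commute intro: subspace_add)
  then have "coset_proj V \<Gamma> (y + \<gamma>) \<in> T" using \<eta>(2) by blast
  moreover have "coset_proj V \<Gamma> (y + \<gamma>) = coset_proj V \<Gamma> y" using y(2) by (simp add: coset_proj_eq_iff)
  ultimately show "coset_proj V \<Gamma> ` Y \<inter> T \<noteq> {}" using y(1) by auto
qed

end

interpretation torus: real_quotient "UNIV :: (real^'d) set" int_lattice
  by unfold_locales (auto simp: int_lattice_0 int_lattice_add int_lattice_minus)

section \<open>Integer matrices on the torus, subtori and rational subspaces\<close>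

lemma map_matrix_of_int_mult:
  "map_matrix real_of_int (X ** Y) = map_matrix real_of_int X ** map_matrix real_of_int Y"
  by (simp add: matrix_matrix_mult_def map_matrix_def vec_eq_iff)

lemma map_matrix_of_int_mat_1: "map_matrix real_of_int (mat 1) = mat 1"
  by (simp add: map_matrix_def mat_def vec_eq_iff)

lemma integer_matrix_int_lattice:
  "x \<in> int_lattice \<Longrightarrow> map_matrix real_of_int X *v x \<in> int_lattice"
  by (auto simp: int_lattice_def matrix_vector_mult_def map_matrix_def intro!: Ints_sum Ints_mult)

lemma torus_act_torus_proj:
  assumes "invertible X"
  shows "torus_act X (torus_proj x) = torus_proj (map_matrix real_of_int X *v x)"
proof -
  obtain Y where Y: "X ** Y = mat 1" using assms by (auto simp: invertible_def)
  have "\<gamma> = map_matrix real_of_int X *v (map_matrix real_of_int Y *v \<gamma>)" for \<gamma>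
    using arg_cong[OF Y, of "\<lambda>Z. map_matrix real_of_int Z *v \<gamma>"]
    by (simp add: map_matrix_of_int_mult map_matrix_of_int_mat_1 matrix_vector_mul_assoc)
  then have "(\<lambda>x. map_matrix real_of_int X *v x) ` int_lattice = int_lattice"
    using integer_matrix_int_lattice by (auto intro!: image_eqI)
  then show ?thesis unfolding torus_act_def by (intro image_coset_proj) (simp add: matrix_vector_right_distrib)
qed

text \<open>The annihilator \<open>Y\<close> of \<open>L\<close> projects to a subtorus invariant
  under \<open>X\<close>. It is proper since \<open>L\<close> is nonzero, and of positive dimension
  since \<open>L\<close> is not everything. It is closed because pairing with a basis of
  \<open>L\<close> made of lattice vectors takes integer values on the preimage, so these values are
  eventually constant along convergent sequences.\<close>

lemma irreducible_rational_subspace: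
  fixes X :: "int^'d^'d"
  assumes irr: "irreducible_automorphism X" and L: "rational_subspace L"
    and inv: "(\<lambda>b. transpose (map_matrix real_of_int X) *v b) ` L \<subseteq> L"
  shows "L = {0} \<or> L = UNIV"
proof (rule ccontr)
  assume "\<not> ?thesis"
  then have ne: "L \<noteq> {0}" "L \<noteq> UNIV" by auto
  obtain T where T: "T \<subseteq> int_lattice" "L = span T" using L by (auto simp: rational_subspace_def)
  define B where "B = L \<inter> int_lattice"
  have spanB: "span B = L"
    using T span_superset[of T] by (intro antisym span_minimal) (auto simp: B_def intro: span_mono[THEN subsetD,
        rotated])
  obtain T' where T': "T' \<subseteq> B" "independent T'" "B \<subseteq> span T'" by (rule maximal_independent_subset[of B])
  have finT': "finite T'" using T'(2) by (simp add: independent_imp_finite)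
  have spanT': "span T' = L" using T' spanB by (metis span_mono span_span subset_antisym)
  define Y where "Y = {y :: real^'d. \<forall>b\<in>L. b \<bullet> y = 0}"
  have Y_eq: "Y = {y. \<forall>b\<in>T'. b \<bullet> y = 0}"
  proof -
    have "L \<subseteq> {b. b \<bullet> y = 0}" if "\<forall>b\<in>T'. b \<bullet> y = 0" for y
      unfolding spanT'[symmetric] using that by (intro span_minimal) (auto simp: subspace_def inner_add_left)
    then show ?thesis using spanT' span_superset[of T'] by (auto simp: Y_def)
  qed
  have subY: "subspace Y" by (auto simp: Y_def subspace_def inner_add_right)
  define H where "H = torus_proj ` Y"
  have preH: "{x. torus_proj x \<in> H} = {u + \<gamma> | u \<gamma>. u \<in> Y \<and> \<gamma> \<in> int_lattice}"
  proof -
    have "torus_proj x \<in> H \<longleftrightarrow> (\<exists>u\<in>Y. x - u \<in> int_lattice)" for x by (auto simp: H_def torus.coset_proj_eq_iff)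
    moreover have "(\<exists>u\<in>Y. x - u \<in> int_lattice) \<longleftrightarrow> (\<exists>u \<gamma>. x = u + \<gamma> \<and> u \<in> Y \<and> \<gamma> \<in> int_lattice)" for x
      by (metis add_diff_cancel_left' diff_add_cancel add.commute)
    ultimately show ?thesis by simp
  qed
  have closed_pre: "closed {u + \<gamma> | u \<gamma>. u \<in> Y \<and> \<gamma> \<in> int_lattice}"
    unfolding closed_sequential_limits
  proof (intro allI impI, elim conjE)
    fix f x assume f: "\<forall>n. f n \<in> {u + \<gamma> | u \<gamma>. u \<in> Y \<and> \<gamma> \<in> int_lattice}" "f \<longlonglongrightarrow> x"
    then obtain u \<gamma> where ug: "\<And>n. f n = u n + \<gamma> n" "\<And>n. u n \<in> Y" "\<And>n. \<gamma> n \<in> int_lattice"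
      by (simp add: Setcompr_eq_image) metis
    have ev: "\<forall>\<^sub>F n in sequentially. b \<bullet> f n = b \<bullet> x" if b: "b \<in> T'" for b
    proof -
      have int: "b \<bullet> f n \<in> \<int>" for n
      proof -
        have "b \<bullet> u n = 0" using ug(2) b by (auto simp: Y_eq)
        moreover have "b \<bullet> \<gamma> n \<in> \<int>" using b T'(1) ug(3)[of n]
          by (auto simp: inner_vec_def B_def int_lattice_def intro!: Ints_sum Ints_mult)
        ultimately show ?thesis by (simp add: ug(1) inner_add_right)
      qed
      have lim: "(\<lambda>n. b \<bullet> f n) \<longlonglongrightarrow> b \<bullet> x" by (intro tendsto_intros f(2))
      have "b \<bullet> x \<in> \<int>" using closed_sequentially[OF closed_Ints _ lim] int by blast
      from tendstoD[OF lim, of 1] have "\<forall>\<^sub>F n in sequentially. \<bar>b \<bullet> f n - b \<bullet> x\<bar> < 1"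
        by (simp add: dist_real_def)
      then show ?thesis
      proof eventually_elim
        case (elim n)
        have "b \<bullet> f n - b \<bullet> x = 0" using int[of n] \<open>b \<bullet> x \<in> \<int>\<close> elim by (intro Ints_nonzero_abs_less1 Ints_diff)
        then show ?case by simp
      qed
    qed
    have "\<forall>\<^sub>F n in sequentially. \<forall>b\<in>T'. b \<bullet> f n = b \<bullet> x" using finT' ev by (simp add: eventually_ball_finite)
    then obtain n where n: "\<forall>b\<in>T'. b \<bullet> f n = b \<bullet> x" by (auto simp: eventually_sequentially)
    have "x - \<gamma> n \<in> Y" unfolding Y_eq
    proof (intro CollectI ballI)
      fix b assume b: "b \<in> T'"
      have "b \<bullet> u n = 0" using ug(2) b by (auto simp: Y_eq)
      then show "b \<bullet> (x - \<gamma> n) = 0" using n[rule_format, OF b]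
        by (simp add: inner_diff_right ug(1) inner_add_right)
    qed
    then show "x \<in> {u + \<gamma> | u \<gamma>. u \<in> Y \<and> \<gamma> \<in> int_lattice}" using ug(3)[of n]
      by (intro CollectI exI[of _ "x - \<gamma> n"] exI[of _ "\<gamma> n"]) simp
  qed
  have "subtorus H" unfolding subtorus_def
  proof (intro conjI)
    have "subgroup Y (additive_group UNIV)"
    proof -
      interpret comm_group "additive_group (UNIV :: (real^'d) set)" by (rule torus.comm_group_additive)
      show ?thesis
      proof (rule subgroupI)
        show "inv\<^bsub>additive_group UNIV\<^esub> a \<in> Y" if "a \<in> Y" for a
          using that subY by (simp add: torus.inv_additive subspace_neg)
      qed (use subY subspace_0 in \<open>auto simp: additive_group_def subspace_add\<close>)
    qed
    then show "subgroup H torus" unfolding H_def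
      by (rule group_hom.subgroup_img_is_subgroup[OF torus.group_hom_coset_proj])
    show "closedin torus_topology H"
      unfolding closedin_def openin_quotient_topology topspace_quotient_topology
    proof (intro conjI)
      show "H \<subseteq> range torus_proj" by (auto simp: H_def)
      have "{x \<in> UNIV. torus_proj x \<in> range torus_proj - H} = - {x. torus_proj x \<in> H}" by auto
      then show "openin (top_of_set UNIV) {x \<in> UNIV. torus_proj x \<in> range torus_proj - H}"
        using closed_pre unfolding preH[symmetric] by (simp add: open_Compl)
    qed auto
    have "continuous_map euclidean torus_topology torus_proj"
      by (auto simp: continuous_map_def openin_quotient_topology topspace_quotient_topology)
    moreover have "connectedin euclidean Y" using subY by (simp add: subspace_imp_convex convex_connected)
    ultimately show "connectedin torus_topology H" unfolding H_def by (rule connectedin_continuous_map_image)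
  qed
  moreover have "H \<noteq> carrier torus"
  proof
    assume "H = carrier torus"
    then have all: "{x. torus_proj x \<in> H} = UNIV" by (auto simp: torus.carrier_quotient)
    obtain b where b: "b \<in> B" "b \<noteq> 0"
    proof -
      have "\<not> B \<subseteq> {0}" using spanB ne(1) span_mono[of B "{0}"] subspace_0[of L] spanB by auto
      then show ?thesis using that by blast
    qed
    \<comment> \<open>\<open>b\<close> pairs with this vector to 1/2, but with every vector of the
      preimage of \<open>H\<close> to an integer.\<close>
    define y where "y = (1 / (2 * (b \<bullet> b))) *\<^sub>R b"
    obtain u \<gamma> where u: "y = u + \<gamma>" "u \<in> Y" "\<gamma> \<in> int_lattice" using all unfolding preH by blast
    have "b \<bullet> y = 1 / 2" using b(2) by (simp add: y_def)
    moreover have "b \<bullet> y \<in> \<int>"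
    proof -
      have "b \<bullet> u = 0" using u(2) b(1) by (auto simp: Y_def B_def)
      moreover have "b \<bullet> \<gamma> \<in> \<int>" using b(1) u(3)
        by (auto simp: inner_vec_def B_def int_lattice_def intro!: Ints_sum Ints_mult)
      ultimately show ?thesis by (simp add: u(1) inner_add_right)
    qed
    ultimately have "(1/2::real) \<in> \<int>" by metis
    then have "(1/2::real) = 0" by (rule Ints_nonzero_abs_less1) simp
    then show False by simp
  qed
  moreover have "0 < subtorus_dim H"
  proof -
    have subL: "subspace L" using T by simp
    have "dim L < DIM(real^'d)" using ne(2) subL dim_eq_full[of L] dim_subset_UNIV[of L] span_eq_iff[of L]
      by (metis le_neq_implies_less)
    then obtain y where y: "y \<noteq> 0" "\<And>b. b \<in> span L \<Longrightarrow> orthogonal y b" using orthogonal_to_subspace_exists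
      by blast
    have "y \<in> Y" using y(2) by (auto simp: Y_def orthogonal_def inner_commute span_base)
    then have "torus_proj (t *\<^sub>R y) \<in> H" for t using subspace_scale[OF subY] by (simp add: H_def)
    then have "y \<in> {v. \<forall>t::real. torus_proj (t *\<^sub>R v) \<in> H}" by blast
    then show ?thesis unfolding subtorus_dim_def using y(1) dim_eq_0
      by (metis (no_types, lifting) gr0I singletonD subsetD)
  qed
  moreover have "torus_act X ` H \<subseteq> H"
  proof -
    have "invertible X" using irr by (simp add: irreducible_automorphism_def GL_def)
    moreover have "map_matrix real_of_int X *v y \<in> Y" if "y \<in> Y" for y
    proof -
      have "b \<bullet> (map_matrix real_of_int X *v y) = (transpose (map_matrix real_of_int X) *v b) \<bullet> y" for b
        by (simp add: transpose_matrix_vector dot_lmul_matrix)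
      then show ?thesis using that inv by (auto simp: Y_def)
    qed
    ultimately show ?thesis by (auto simp: H_def torus_act_torus_proj)
  qed
  ultimately show False using irr by (auto simp: irreducible_automorphism_def)
qed

lemma totally_irreducible_automorphism_map:
  assumes "totally_irreducible_automorphism X"
  shows "totally_irreducible_map (\<lambda>b. transpose (map_matrix real_of_int X) *v b)"
  unfolding totally_irreducible_map_def
proof (intro conjI allI impI)
  let ?D = "\<lambda>b. transpose (map_matrix real_of_int X) *v b"
  show "linear ?D" by (rule matrix_vector_mul_linear)
  have "transpose (map_matrix real_of_int X) = map_matrix real_of_int (transpose X)"
    by (simp add: transpose_def map_matrix_def vec_eq_iff)
  then show "?D ` int_lattice \<subseteq> int_lattice" using integer_matrix_int_lattice by auto
  fix k :: nat and L assume k: "0 < k" and L: "rational_subspace L \<and> (?D ^^ k) ` L \<subseteq> L"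
  have pow: "(\<lambda>b. transpose (map_matrix real_of_int (X [^]\<^bsub>GL\<^esub> k)) *v b) = ?D ^^ k" for k :: nat
  proof (induction k)
    case 0
    then show ?case by (simp add: GL_def map_matrix_of_int_mat_1 fun_eq_iff)
  next
    case (Suc k)
    have "X [^]\<^bsub>GL\<^esub> Suc k = X [^]\<^bsub>GL\<^esub> k ** X" by (simp add: GL_def)
    then have "(\<lambda>b. transpose (map_matrix real_of_int (X [^]\<^bsub>GL\<^esub> Suc k)) *v b)
       = ?D \<circ> (\<lambda>b. transpose (map_matrix real_of_int (X [^]\<^bsub>GL\<^esub> k)) *v b)"
      by (simp only: map_matrix_of_int_mult matrix_transpose_mul fun_eq_iff o_def matrix_vector_mul_assoc) simp
    then show ?case by (simp only: Suc.IH funpow.simps)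
  qed
  have "irreducible_automorphism (X [^]\<^bsub>GL\<^esub> int k)" using assms k unfolding totally_irreducible_automorphism_def
    by auto
  then have "irreducible_automorphism (X [^]\<^bsub>GL\<^esub> k)" by (simp add: int_pow_int)
  from irreducible_rational_subspace[OF this, of L] show "L = {0} \<or> L = UNIV" using L unfolding pow by blast
qed

subsection \<open>The action attached to the number field data\<close>

lemma span_orthogonal_iff:
  fixes a :: "'i \<Rightarrow> 'v::euclidean_space"
  shows "v \<in> span (a ` S) \<longleftrightarrow> (\<forall>h. (\<forall>i\<in>S. a i \<bullet> h = 0) \<longrightarrow> v \<bullet> h = 0)"
proof
  assume v: "v \<in> span (a ` S)"
  show "\<forall>h. (\<forall>i\<in>S. a i \<bullet> h = 0) \<longrightarrow> v \<bullet> h = 0"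
  proof (intro allI impI)
    fix h assume "\<forall>i\<in>S. a i \<bullet> h = 0"
    then have "span (a ` S) \<subseteq> {v. v \<bullet> h = 0}" by (intro span_minimal) (auto simp: subspace_def inner_add_left)
    then show "v \<bullet> h = 0" using v by blast
  qed
next
  assume h: "\<forall>h. (\<forall>i\<in>S. a i \<bullet> h = 0) \<longrightarrow> v \<bullet> h = 0"
  obtain y w where yw: "y \<in> span (a ` S)" "\<And>u. u \<in> span (a ` S) \<Longrightarrow> orthogonal w u" "v = y + w"
    using orthogonal_subspace_decomp_exists[of "a ` S" v] by metis
  have "\<forall>i\<in>S. a i \<bullet> w = 0"
  proof
    fix i assume "i \<in> S"
    then have "a i \<in> span (a ` S)" by (intro span_base) simp
    from yw(2)[OF this] show "a i \<bullet> w = 0" by (simp add: orthogonal_def inner_commute)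
  qed
  then have "v \<bullet> w = 0" using h by blast
  moreover have "y \<bullet> w = 0" using yw(2)[OF yw(1)] by (simp add: orthogonal_def inner_commute)
  ultimately have "w = 0" by (simp add: yw(3) inner_add_left)
  then show "v \<in> span (a ` S)" using yw by simp
qed

lemma dim_orthogonal_to_family:
  fixes a :: "'i \<Rightarrow> 'v::euclidean_space"
  shows "dim {h. \<forall>i\<in>S. a i \<bullet> h = 0} + dim (span (a ` S)) = DIM('v)"
proof -
  have "{h. \<forall>i\<in>S. a i \<bullet> h = 0} = {h \<in> UNIV. \<forall>x\<in>span (a ` S). orthogonal x h}"
    using span_orthogonal_iff[of _ a S] by (auto simp: orthogonal_def span_base)
  then show ?thesis using dim_subspace_orthogonal_to_vectors[of "span (a ` S)" "UNIV :: 'v set"] by simp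
qed

text \<open>The vectors for which a bound exists form a subspace containing the family. This carries
  the restriction on the functionals of \<open>S\<close> over to those of <S>, where only some bound
  is left of \<epsilon>.\<close>

lemma span_bounded_by_family:
  fixes a :: "'i \<Rightarrow> 'v::euclidean_space"
  assumes "v \<in> span (a ` S)" "e \<ge> 0"
  obtains K where "\<forall>h. (\<forall>i\<in>S. \<bar>a i \<bullet> h\<bar> < e) \<longrightarrow> \<bar>v \<bullet> h\<bar> \<le> K"
proof -
  let ?W = "{v. \<exists>K. \<forall>h. (\<forall>i\<in>S. \<bar>a i \<bullet> h\<bar> < e) \<longrightarrow> \<bar>v \<bullet> h\<bar> \<le> K}"
  have "subspace ?W"
  proof (rule subspaceI)
    show "0 \<in> ?W" by (auto intro!: exI[of _ 0])
    fix u v assume uv: "u \<in> ?W" "v \<in> ?W"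
    from uv(1) obtain K1 where K1: "\<forall>h. (\<forall>i\<in>S. \<bar>a i \<bullet> h\<bar> < e) \<longrightarrow> \<bar>u \<bullet> h\<bar> \<le> K1" by (elim CollectE exE)
    from uv(2) obtain K2 where K2: "\<forall>h. (\<forall>i\<in>S. \<bar>a i \<bullet> h\<bar> < e) \<longrightarrow> \<bar>v \<bullet> h\<bar> \<le> K2" by (elim CollectE exE)
    have "\<bar>(u + v) \<bullet> h\<bar> \<le> K1 + K2" if "\<forall>i\<in>S. \<bar>a i \<bullet> h\<bar> < e" for h
      using K1[rule_format, of h] K2[rule_format, of h] that by (simp add: inner_add_left)
    then show "u + v \<in> ?W" by (intro CollectI exI[of _ "K1 + K2"]) simp
  next
    fix c v assume "v \<in> ?W"
    then obtain K where K: "\<forall>h. (\<forall>i\<in>S. \<bar>a i \<bullet> h\<bar> < e) \<longrightarrow> \<bar>v \<bullet> h\<bar> \<le> K" by (elim CollectE exE)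
    have "\<bar>(c *\<^sub>R v) \<bullet> h\<bar> \<le> \<bar>c\<bar> * K" if "\<forall>i\<in>S. \<bar>a i \<bullet> h\<bar> < e" for h
      using K[rule_format, of h] that by (simp add: abs_mult mult_left_mono)
    then show "c *\<^sub>R v \<in> ?W" by (intro CollectI exI[of _ "\<bar>c\<bar> * K"]) simp
  qed
  moreover have "a ` S \<subseteq> ?W"
  proof
    fix v assume "v \<in> a ` S"
    then obtain i where i: "i \<in> S" "v = a i" by blast
    then have "\<forall>h. (\<forall>i\<in>S. \<bar>a i \<bullet> h\<bar> < e) \<longrightarrow> \<bar>v \<bullet> h\<bar> \<le> e" by (simp add: less_imp_le)
    then show "v \<in> ?W" by (intro CollectI exI)
  qed
  ultimately have "span (a ` S) \<subseteq> ?W" by (rule span_minimal[rotated])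
  with assms(1) have "v \<in> ?W" by blast
  then obtain K where "\<forall>h. (\<forall>i\<in>S. \<bar>a i \<bullet> h\<bar> < e) \<longrightarrow> \<bar>v \<bullet> h\<bar> \<le> K" by (elim CollectE exE)
  then show ?thesis by (rule that)
qed

lemma linear_blinfun_inner_right: "linear (blinfun_inner_right :: real^'n \<Rightarrow> (real^'n) \<Rightarrow>\<^sub>L real)"
  by (rule linearI; rule blinfun_eqI) (auto simp: inner_add_left blinfun.add_left blinfun.scaleR_left)

lemma inj_blinfun_inner_right: "inj (blinfun_inner_right :: real^'n \<Rightarrow> (real^'n) \<Rightarrow>\<^sub>L real)"
proof (rule injI)
  fix x y :: "real^'n" assume "blinfun_inner_right x = blinfun_inner_right y"
  then have "blinfun_apply (blinfun_inner_right x) h = blinfun_apply (blinfun_inner_right y) h" for h by simp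
  then have "\<forall>h. x \<bullet> h = y \<bullet> h" by simp
  then show "x = y" by (simp only: vector_eq_rdot)
qed

text \<open>By linearity a nonzero coordinate could be rescaled to the value 1/2.\<close>

lemma linear_lattice_valued_0:
  fixes g :: "real^'d \<Rightarrow> real^'d"
  assumes "linear g" "\<And>x. g x \<in> int_lattice"
  shows "g x = 0"
proof (rule ccontr)
  assume "g x \<noteq> 0"
  then obtain j where j: "g x $ j \<noteq> 0" by (auto simp: vec_eq_iff)
  have "g ((1 / (2 * g x $ j)) *\<^sub>R x) $ j = 1 / 2" using j by (simp add: linear_scale[OF assms(1)])
  then have "(1/2::real) \<in> \<int>" using assms(2)[of "(1 / (2 * g x $ j)) *\<^sub>R x"]
    by (metis int_lattice_def mem_Collect_eq)
  then have "(1/2::real) = 0" by (rule Ints_nonzero_abs_less1) simp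
  then show False by simp
qed

section \<open>Lyapunov functionals as vectors and the lifted action\<close>

context toral_action_data
begin

text \<open>The Riesz representative of the functional, so that spans and dimensions are handled by
  orthogonality in R^r.\<close>

definition "lyapunov_vector i = (\<Sum>b\<in>Basis. blinfun_apply (linear_extension (lyapunov \<sigma> \<zeta> i)) b *\<^sub>R b)"

lemma inner_lyapunov_vector: "lyapunov_vector i \<bullet> h = blinfun_apply (linear_extension (lyapunov \<sigma> \<zeta> i)) h"
proof -
  have lin: "linear (blinfun_apply (linear_extension (lyapunov \<sigma> \<zeta> i)))"
    using blinfun.bounded_linear_right by (simp add: linear_conv_bounded_linear)
  have "blinfun_apply (linear_extension (lyapunov \<sigma> \<zeta> i)) h =
     blinfun_apply (linear_extension (lyapunov \<sigma> \<zeta> i)) (\<Sum>b\<in>Basis. (h \<bullet> b) *\<^sub>R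
         b)" by (simp add: euclidean_representation)
  also have "\<dots> = (\<Sum>b\<in>Basis. (h \<bullet> b) * blinfun_apply (linear_extension (lyapunov \<sigma> \<zeta> i)) b)"
    by (simp add: linear_sum[OF lin] linear_scale[OF lin])
  finally show ?thesis
    unfolding lyapunov_vector_def inner_sum_left inner_scaleR_left by (simp add: inner_commute mult.commute)
qed

lemma linear_extension_lyapunov: "linear_extension (lyapunov \<sigma> \<zeta> i) = blinfun_inner_right (lyapunov_vector i)"
  by (rule blinfun_eqI) (simp add: inner_lyapunov_vector)

lemma lyapunov_span_eq: "lyapunov_span \<sigma> \<zeta> S = blinfun_inner_right ` span (lyapunov_vector ` S)"
  unfolding lyapunov_span_def linear_extension_lyapunov
  by (simp add: linear_span_image[OF linear_blinfun_inner_right, symmetric] image_image)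

lemma dim_lyapunov_span: "dim (lyapunov_span \<sigma> \<zeta> S) = dim (span (lyapunov_vector ` S))"
  unfolding lyapunov_span_eq
  by (rule dim_image_eq[OF linear_blinfun_inner_right]) (meson inj_blinfun_inner_right inj_on_subset
      subset_UNIV)

lemma lyapunov_closure_iff: "i \<in> lyapunov_closure \<sigma> \<zeta> S \<longleftrightarrow> lyapunov_vector i \<in> span (lyapunov_vector ` S)"
  unfolding lyapunov_closure_def lyapunov_span_eq linear_extension_lyapunov
  using inj_blinfun_inner_right by (auto dest: injD)

lemma field_embedding_\<sigma>: "field_embedding (\<sigma> i)"
  using embeddings by blast

lemma \<zeta>_add: "\<zeta> (m + n) = \<zeta> m * \<zeta> n" and \<zeta>_nz: "\<zeta> n \<noteq> 0"
  using zeta_hom by (auto simp: hom_def additive_group_def unit_group_def Pi_def)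

lemma \<zeta>_0: "\<zeta> 0 = 1"
  using \<zeta>_add[of 0 0] \<zeta>_nz[of 0] by simp

lemma \<sigma>_mult: "\<sigma> i (x * y) = \<sigma> i x * \<sigma> i y" and \<sigma>_add: "\<sigma> i (x + y) = \<sigma> i x + \<sigma> i y" and \<sigma>_1: "\<sigma> i 1 = 1"
  using field_embedding_\<sigma>[of i] by (auto simp: field_embedding_def)

lemma \<sigma>_nz: "x \<noteq> 0 \<Longrightarrow> \<sigma> i x \<noteq> 0"
  using \<sigma>_mult[of i x "inverse x"] \<sigma>_1[of i] by auto

lemma \<sigma>_eq_1: "\<sigma> i x = 1 \<Longrightarrow> x = 1"
  using \<sigma>_nz[of "x - 1" i] \<sigma>_add[of i "x - 1" 1] by (auto simp: \<sigma>_1)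

lemma subspace_minkowski: "subspace (minkowski_space R)"
  by (auto simp: minkowski_space_def subspace_def complex_is_Real_iff)

lemma range_\<psi>l: "range \<psi>l = minkowski_space R" and inj_\<psi>l: "inj \<psi>l"
  using lift_bij by (auto simp: bij_betw_def)

lemma \<psi>l_\<Gamma>: "\<psi>l x \<in> \<Gamma> \<longleftrightarrow> x \<in> int_lattice"
  using lift_lattice inj_\<psi>l by (metis image_eqI imageE injD)

sublocale X: real_quotient "minkowski_space R" \<Gamma>
proof
  show "subspace (minkowski_space R)" by (rule subspace_minkowski)
  show "\<Gamma> \<subseteq> minkowski_space R" using lift_lattice range_\<psi>l by blast
  show "0 \<in> \<Gamma>" using \<psi>l_\<Gamma>[of 0] by (simp add: linear_0[OF lift_linear] int_lattice_0)
  show "x + y \<in> \<Gamma>" if "x \<in> \<Gamma>" "y \<in> \<Gamma>" for x y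
    using that unfolding lift_lattice[symmetric] by (force simp: linear_add[OF lift_linear, symmetric] intro:
        int_lattice_add)
  show "- x \<in> \<Gamma>" if "x \<in> \<Gamma>" for x
    using that unfolding lift_lattice[symmetric] by (force simp: linear_neg[OF lift_linear, symmetric] intro:
        int_lattice_minus)
qed

lemma field_act_minkowski: "v \<in> minkowski_space R \<Longrightarrow> field_act \<sigma> \<theta> v \<in> minkowski_space R"
  unfolding minkowski_space_def field_act_def using real_embeddings
    by (auto simp: subset_iff intro!: Reals_mult)

lemma field_act_\<Gamma>: "field_act \<sigma> (\<zeta> n) ` \<Gamma> = \<Gamma>"
proof
  show "\<Gamma> \<subseteq> field_act \<sigma> (\<zeta> n) ` \<Gamma>"
  proof
    fix \<gamma> assume g: "\<gamma> \<in> \<Gamma>"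
    have "\<zeta> n * \<zeta> (- n) = 1" using \<zeta>_add[of n "- n"] by (simp add: \<zeta>_0)
    then have "\<gamma> = field_act \<sigma> (\<zeta> n) (field_act \<sigma> (\<zeta> (- n)) \<gamma>)"
      by (simp add: field_act_def vec_eq_iff \<sigma>_mult[symmetric] mult.assoc[symmetric] \<sigma>_1)
    moreover have "field_act \<sigma> (\<zeta> (- n)) \<gamma> \<in> \<Gamma>" using lattice_invariant[of "- n"] g by blast
    ultimately show "\<gamma> \<in> field_act \<sigma> (\<zeta> n) ` \<Gamma>" by blast
  qed
qed (rule lattice_invariant)

lemma field_act_coset: "field_act \<sigma> (\<zeta> n) ` coset_proj (minkowski_space R) \<Gamma> v
    = coset_proj (minkowski_space R) \<Gamma> (field_act \<sigma> (\<zeta> n) v)"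
proof (rule image_coset_proj)
  show "field_act \<sigma> (\<zeta> n) (x + y) = field_act \<sigma> (\<zeta> n) x + field_act \<sigma> (\<zeta> n) y" for x y
    by (simp add: field_act_def vec_eq_iff algebra_simps)
qed (rule field_act_\<Gamma>)

text \<open>Equivariance on the quotient gives it for the lift up to an element of \<Gamma>. Pulled
  back to R^d by a linear inverse of \<open>\<psi>l\<close>, this error is linear in
  \<open>x\<close> and takes values in the integer lattice, so it is 0.\<close>

lemma \<psi>l_equivariant:
  assumes inv: "invertible (\<alpha> n)"
  shows "\<psi>l (map_matrix real_of_int (\<alpha> n) *v x) = field_act \<sigma> (\<zeta> n) (\<psi>l x)"
proof -
  define M where "M = map_matrix real_of_int (\<alpha> n)"
  have "\<exists>g. linear g \<and> (\<forall>v\<in>minkowski_space R. \<psi>l (g v) = v)"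
  proof -
    obtain g where "linear g" "g \<circ> \<psi>l = id" using linear_injective_left_inverse[OF lift_linear inj_\<psi>l] by blast
    moreover have "\<psi>l (g v) = v" if "v \<in> minkowski_space R" for v
      using that \<open>g \<circ> \<psi>l = id\<close> unfolding range_\<psi>l[symmetric] by (auto simp: fun_eq_iff)
    ultimately show ?thesis by blast
  qed
  then obtain g where g: "linear g" "\<And>v. v \<in> minkowski_space R \<Longrightarrow> \<psi>l (g v) = v" by blast
  have mink: "\<psi>l x \<in> minkowski_space R" for x using range_\<psi>l by blast
  define f where "f = (\<lambda>x. M *v x - g (field_act \<sigma> (\<zeta> n) (\<psi>l x)))"
  have "linear (field_act \<sigma> (\<zeta> n))"
    by (rule linearI) (auto simp: field_act_def vec_eq_iff algebra_simps)
  then have "linear (\<lambda>x. g (field_act \<sigma> (\<zeta> n) (\<psi>l x)))"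
    using linear_compose[OF linear_compose[OF lift_linear] g(1)] by (simp add: o_def)
  then have "linear f" unfolding f_def by (intro linear_compose_sub matrix_vector_mul_linear)
  moreover have "f x \<in> int_lattice" for x
  proof -
    have c: "torus_proj x \<in> carrier torus" by (simp add: torus.carrier_quotient)
    have "torus_proj (M *v x) = torus_act (\<alpha> n) (torus_proj x)"
      by (simp add: torus_act_torus_proj[OF inv] M_def)
    also have "\<dots> = inv_into (carrier torus) \<psi> (field_act \<sigma> (\<zeta> n) ` \<psi> (torus_proj x))"
      by (rule psi_equivariant[OF c])
    finally have "\<psi> (torus_proj (M *v x)) = \<psi> (inv_into (carrier torus) \<psi> (coset_proj (minkowski_space R) \<Gamma>
        (field_act \<sigma> (\<zeta> n) (\<psi>l x))))"
      by (simp add: lift_psi field_act_coset)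
    also have "\<dots> = coset_proj (minkowski_space R) \<Gamma> (field_act \<sigma> (\<zeta> n) (\<psi>l x))"
    proof (rule f_inv_into_f)
      have "\<psi> ` carrier torus = carrier (quotient_group (minkowski_space R) \<Gamma>)" using psi_iso
        by (simp add: iso_def bij_betw_def)
      then show "coset_proj (minkowski_space R) \<Gamma> (field_act \<sigma> (\<zeta> n) (\<psi>l x)) \<in> \<psi> ` carrier torus"
        using field_act_minkowski[OF mink] by (simp add: X.carrier_quotient)
    qed
    finally have "\<psi>l (M *v x) - field_act \<sigma> (\<zeta> n) (\<psi>l x) \<in> \<Gamma>" by (simp add: lift_psi X.coset_proj_eq_iff)
    moreover have "\<psi>l (f x) = \<psi>l (M *v x) - field_act \<sigma> (\<zeta> n) (\<psi>l x)"
      by (simp add: f_def linear_diff[OF lift_linear] g(2) field_act_minkowski mink)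
    ultimately show ?thesis using \<psi>l_\<Gamma> by metis
  qed
  ultimately have "f x = 0" by (rule linear_lattice_valued_0)
  then have "M *v x = g (field_act \<sigma> (\<zeta> n) (\<psi>l x))" by (simp add: f_def)
  then show ?thesis by (simp add: M_def[symmetric] g(2) field_act_minkowski mink)
qed

end

context torus_flow
begin

lemma translated_torsion_iff:
  "x \<in> translated_torsion \<longleftrightarrow> (\<exists>p v. (\<exists>n::nat. n > 0 \<and> real n *\<^sub>R p \<in> int_lattice) \<and> v \<in> V \<and> x = p + v)"
proof -
  have "(\<forall>j. p $ j \<in> \<rat>) \<longleftrightarrow> (\<exists>n::nat. n > 0 \<and> real n *\<^sub>R p \<in> int_lattice)" for p :: "real^'d"
  proof
    assume "\<forall>j. p $ j \<in> \<rat>"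
    then show "\<exists>n::nat. n > 0 \<and> real n *\<^sub>R p \<in> int_lattice" by (rule rational_vector_denominator) blast
  next
    assume "\<exists>n::nat. n > 0 \<and> real n *\<^sub>R p \<in> int_lattice"
    then obtain n :: nat where n: "n > 0" "\<And>j. real n * p $ j \<in> \<int>" by (auto simp: int_lattice_def)
    show "\<forall>j. p $ j \<in> \<rat>"
    proof
      fix j
      have "(real n * p $ j) / real n \<in> \<rat>" using n(2)[of j] Ints_subset_Rats by (intro Rats_divide) auto
      then show "p $ j \<in> \<rat>" using n(1) by simp
    qed
  qed
  then show ?thesis by (auto simp: translated_torsion_def)
qed

lemma translated_torsion_add_lattice:
  assumes "\<gamma> \<in> int_lattice" "x + \<gamma> \<in> translated_torsion"
  shows "x \<in> translated_torsion"
proof -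
  obtain p v where p: "x + \<gamma> = p + v" "\<forall>j. p $ j \<in> \<rat>" "v \<in> V" using assms(2)
    by (auto simp: translated_torsion_def)
  have "\<forall>j. (p - \<gamma>) $ j \<in> \<rat>" using p(2) assms(1) Ints_subset_Rats
    by (auto simp: int_lattice_def intro!: Rats_diff)
  moreover have "x = (p - \<gamma>) + v" using p(1) by (simp add: algebra_simps)
  ultimately show ?thesis using p(3) unfolding translated_torsion_def by blast
qed

end

lemma hom_GL:
  fixes \<alpha> :: "int^'r \<Rightarrow> int^'d^'d"
  assumes hom: "\<alpha> \<in> hom (additive_group UNIV) GL"
  shows "invertible (\<alpha> n)" "\<alpha> (m + n) = \<alpha> m ** \<alpha> n" "\<alpha> 0 = mat 1"
proof -
  have inv: "invertible (\<alpha> n)" and add: "\<alpha> (m + n) = \<alpha> m ** \<alpha> n" for m n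
    using hom by (auto simp: hom_def additive_group_def GL_def Pi_def)
  show "invertible (\<alpha> n)" "\<alpha> (m + n) = \<alpha> m ** \<alpha> n" by (fact inv, fact add)
  obtain Y where Y: "Y ** \<alpha> 0 = mat 1" using inv[of 0] by (auto simp: invertible_def)
  have "Y ** (\<alpha> 0 ** \<alpha> 0) = Y ** \<alpha> 0" using add[of 0 0] by simp
  then show "\<alpha> 0 = mat 1" by (simp add: matrix_mul_assoc Y)
qed

theorem theorem1p8:
  fixes \<alpha> :: "int^'r \<Rightarrow> int^'d^'d"
    and R :: "'i::finite set"
    and \<sigma> :: "'i \<Rightarrow> 'k::field_char_0 \<Rightarrow> complex"
    and \<zeta> :: "int^'r \<Rightarrow> 'k"
    and \<Gamma> :: "(complex^'i) set"
    and \<psi> :: "(real^'d) set \<Rightarrow> (complex^'i) set"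
    and \<psi>l :: "real^'d \<Rightarrow> complex^'i"
    and S :: "'i set"
  assumes hom: "\<alpha> \<in> hom (additive_group UNIV) GL"
    and inj: "inj \<alpha>"
    and irreducible: "\<exists>n. irreducible_automorphism (\<alpha> n)"
    and data: "toral_action_data \<alpha> R \<sigma> \<zeta> \<Gamma> \<psi> \<psi>l"
    and dim: "int (dim (lyapunov_span \<sigma> \<zeta> S)) \<le> int CARD('r) - 2"
    and small: "\<forall>\<epsilon>>0. \<exists>n. totally_irreducible_automorphism (\<alpha> n) \<and>
                  (\<forall>i\<in>S. \<bar>lyapunov \<sigma> \<zeta> i n\<bar> < \<epsilon>)"
  shows "(\<forall>\<epsilon>>0. \<forall>x \<in> carrier (quotient_group (minkowski_space R) \<Gamma>).
           quotient_topology (minkowski_space R) \<Gamma> closure_of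
             {field_act \<sigma> (\<zeta> n) ` x | n. \<forall>i\<in>S. \<bar>lyapunov \<sigma> \<zeta> i n\<bar> < \<epsilon>}
             = carrier (quotient_group (minkowski_space R) \<Gamma>)
           \<longleftrightarrow> \<not> translated_torsion_point (minkowski_space R) \<Gamma>
                  (coordinate_subspace R (lyapunov_closure \<sigma> \<zeta> S)) x) \<and>
         (\<forall>\<epsilon>>0. \<forall>y \<in> carrier torus.
           torus_topology closure_of
             {torus_act (\<alpha> n) y | n. \<forall>i\<in>S. \<bar>lyapunov \<sigma> \<zeta> i n\<bar> < \<epsilon>} = carrier torus
           \<longleftrightarrow> \<not> (\<exists>y0 v. rational_point y0 \<and>
                   v \<in> \<psi>l -` coordinate_subspace R (lyapunov_closure \<sigma> \<zeta> S) \<and>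
                   y = y0 \<otimes>\<^bsub>torus\<^esub> torus_proj v))"
proof -
  interpret toral_action_data \<alpha> R \<sigma> \<zeta> \<Gamma> \<psi> \<psi>l by (rule data)
  note \<alpha> = hom_GL[OF hom]
  define A where "A = (\<lambda>n. map_matrix real_of_int (\<alpha> n))"
  define l where "l = (\<lambda>i h. lyapunov_vector i \<bullet> h)"
  have l_eq: "l i (vec_of_int n) = lyapunov \<sigma> \<zeta> i n" for i n
    unfolding l_def inner_lyapunov_vector by (rule linear_extension) (rule lyapunov_add)
  have \<psi>A: "\<psi>l (A n *v x) = field_act \<sigma> (\<zeta> n) (\<psi>l x)" for n x
    unfolding A_def by (rule \<psi>l_equivariant) (rule \<alpha>)
  interpret F: torus_flow A \<psi>l "\<lambda>n i. \<sigma> i (\<zeta> n)" l S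
  proof (rule torus_flow.intro)
    show "A (m + n) = A m ** A n" for m n by (simp add: A_def \<alpha> map_matrix_of_int_mult)
    show "A 0 = mat 1" by (simp add: A_def \<alpha> map_matrix_of_int_mat_1)
    show "A n *v x \<in> int_lattice" if "x \<in> int_lattice" for n x
      unfolding A_def using that by (rule integer_matrix_int_lattice)
    show "linear \<psi>l" "inj \<psi>l" by (rule lift_linear, rule inj_\<psi>l)
    show "\<psi>l (A n *v x) $ i = \<sigma> i (\<zeta> n) * \<psi>l x $ i" for n x i
      by (simp add: \<psi>A field_act_def)
    show "\<sigma> i (\<zeta> (m + n)) = \<sigma> i (\<zeta> m) * \<sigma> i (\<zeta> n)" for m n i by (simp add: \<zeta>_add \<sigma>_mult)
    show "n = 0" if "\<sigma> i (\<zeta> n) = 1" for n i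
      using \<sigma>_eq_1[OF that] \<zeta>_0 zeta_inj by (metis injD)
    show "linear (l i)" for i unfolding l_def by (rule linearI) (auto simp: inner_add_right)
    show "cmod (\<sigma> i (\<zeta> n)) = exp (l i (vec_of_int n))" for i n
      using \<sigma>_nz[OF \<zeta>_nz] by (simp add: l_eq lyapunov_def)
    show "2 \<le> dim {h. \<forall>i\<in>S. l i h = 0}"
      using dim_orthogonal_to_family[of S lyapunov_vector] dim unfolding dim_lyapunov_span l_def by simp
    show "\<exists>n. (\<forall>i\<in>S. \<bar>l i (vec_of_int n)\<bar> < \<epsilon>) \<and> totally_irreducible_map (\<lambda>b. transpose (A n) *v b)" if "\<epsilon> > 0"
        for \<epsilon>
      using small that totally_irreducible_automorphism_map unfolding l_eq A_def by blast
  qed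
  \<comment> \<open>Membership in the span is vanishing on the orthogonal complement, by
    \<open>span_orthogonal_iff\<close>.\<close>
  have C: "lyapunov_closure \<sigma> \<zeta> S = F.C"
  proof (rule Set.set_eqI)
    fix i
    have "lyapunov_vector j \<bullet> h = l j h" for j h by (simp add: l_def)
    then show "i \<in> lyapunov_closure \<sigma> \<zeta> S \<longleftrightarrow> i \<in> F.C"
      unfolding lyapunov_closure_iff span_orthogonal_iff F.C_def F.H_def by simp
  qed
  have mink: "\<psi>l x \<in> minkowski_space R" for x using range_\<psi>l by blast
  have V: "\<psi>l x \<in> coordinate_subspace R (lyapunov_closure \<sigma> \<zeta> S) \<longleftrightarrow> x \<in> F.V" for x
    using mink[of x] by (simp add: coordinate_subspace_def F.V_def C)
  \<comment> \<open>Both equivalences come down to this one about lifts in R^d.\<close>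
  have key: "(\<forall>w. \<forall>\<eta>>0. \<exists>n. (\<forall>i\<in>S. \<bar>lyapunov \<sigma> \<zeta> i n\<bar> < \<epsilon>) \<and> (\<exists>\<gamma>\<in>int_lattice. norm (A n *v x + \<gamma> - w) < \<eta>))
      \<longleftrightarrow> x \<notin> F.translated_torsion" if \<epsilon>: "\<epsilon> > 0" for x \<epsilon>
  proof
    assume "x \<notin> F.translated_torsion"
    then show "\<forall>w. \<forall>\<eta>>0. \<exists>n. (\<forall>i\<in>S. \<bar>lyapunov \<sigma> \<zeta> i n\<bar> < \<epsilon>) \<and> (\<exists>\<gamma>\<in>int_lattice. norm (A n *v x + \<gamma> - w) < \<eta>)"
      using F.dense_partial_orbit[OF _ \<epsilon>] unfolding l_eq by blast
  next
    assume dense: "\<forall>w. \<forall>\<eta>>0. \<exists>n. (\<forall>i\<in>S. \<bar>lyapunov \<sigma> \<zeta> i n\<bar> < \<epsilon>) \<and> (\<exists>\<gamma>\<in>int_lattice. norm (A n *v x + \<gamma> - w) < \<eta>)"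
    show "x \<notin> F.translated_torsion"
    proof
      assume tt: "x \<in> F.translated_torsion"
      \<comment> \<open>The functionals of <S> are bounded wherever those of \<open>S\<close> are
        below \<epsilon>, which is the bound asked for by
        \<open>torsion_partial_orbit_not_dense\<close>.\<close>
      have "\<exists>K. i \<in> F.C \<longrightarrow> (\<forall>h. (\<forall>j\<in>S. \<bar>l j h\<bar> < \<epsilon>) \<longrightarrow> \<bar>l i h\<bar> \<le> K)" for i
      proof (cases "i \<in> F.C")
        case True
        then have "lyapunov_vector i \<in> span (lyapunov_vector ` S)"
          by (simp add: C[symmetric] lyapunov_closure_iff)
        then obtain K where "\<forall>h. (\<forall>j\<in>S. \<bar>lyapunov_vector j \<bullet> h\<bar> < \<epsilon>) \<longrightarrow> \<bar>lyapunov_vector i \<bullet> h\<bar> \<le> K"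
          using \<epsilon> by (elim span_bounded_by_family[where e = \<epsilon>]) auto
        then show ?thesis unfolding l_def by blast
      qed simp
      then obtain K where K: "\<And>i h. i \<in> F.C \<Longrightarrow> (\<forall>j\<in>S. \<bar>l j h\<bar> < \<epsilon>) \<Longrightarrow> \<bar>l i h\<bar> \<le> K i" by metis
      define \<Omega> where "\<Omega> = {n. \<forall>j\<in>S. \<bar>l j (vec_of_int n)\<bar> < \<epsilon>}"
      have bd: "l i (vec_of_int n) \<le> Max (range K)" if "n \<in> \<Omega>" "i \<in> F.C" for n i
      proof -
        have "\<bar>l i (vec_of_int n)\<bar> \<le> K i" using K that by (simp add: \<Omega>_def)
        also have "K i \<le> Max (range K)" by simp
        finally show ?thesis by simp
      qed
      obtain w \<eta> where w: "\<eta> > 0" "\<And>n \<gamma>. n \<in> \<Omega> \<Longrightarrow> \<gamma> \<in> int_lattice \<Longrightarrow> norm (A n *v x + \<gamma> - w) \<ge> \<eta>"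
        by (rule F.torsion_partial_orbit_not_dense[of x \<Omega> "Max (range K)", OF tt bd]) blast+
      from dense w(1) obtain n \<gamma> where "\<forall>i\<in>S. \<bar>lyapunov \<sigma> \<zeta> i n\<bar> < \<epsilon>" "\<gamma> \<in> int_lattice"
          "norm (A n *v x + \<gamma> - w) < \<eta>" by blast
      then show False using w(2)[of n \<gamma>] by (simp add: l_eq \<Omega>_def)
    qed
  qed
  \<comment> \<open>Two-sided comparison of norms under \<open>\<psi>l\<close>, so that
    approximation in the Minkowski space and in R^d are equivalent.\<close>
  obtain b where b: "b > 0" "\<And>x. b * norm x \<le> norm (\<psi>l x)"
    using linear_inj_bounded_below_pos[OF lift_linear inj_\<psi>l] by blast
  obtain B where B: "B > 0" "\<And>x. norm (\<psi>l x) \<le> B * norm x" using linear_bounded_pos[OF lift_linear] by blast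
  have X: "quotient_topology (minkowski_space R) \<Gamma> closure_of
             {field_act \<sigma> (\<zeta> n) ` coset_proj (minkowski_space R) \<Gamma> (\<psi>l x) | n. \<forall>i\<in>S. \<bar>lyapunov \<sigma> \<zeta> i n\<bar> < \<epsilon>}
             = carrier (quotient_group (minkowski_space R) \<Gamma>)
           \<longleftrightarrow> \<not> translated_torsion_point (minkowski_space R) \<Gamma>
                  (coordinate_subspace R (lyapunov_closure \<sigma> \<zeta> S)) (coset_proj (minkowski_space R) \<Gamma> (\<psi>l x))"
    if \<epsilon>: "\<epsilon> > 0" for x \<epsilon>
  proof -
    define Y where "Y = {A n *v x | n. \<forall>i\<in>S. \<bar>lyapunov \<sigma> \<zeta> i n\<bar> < \<epsilon>}"
    have "{field_act \<sigma> (\<zeta> n) ` coset_proj (minkowski_space R) \<Gamma> (\<psi>l x) | n. \<forall>i\<in>S. \<bar>lyapunov \<sigma> \<zeta> i n\<bar> < \<epsilon>}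
       = coset_proj (minkowski_space R) \<Gamma> ` \<psi>l ` Y"
      unfolding field_act_coset \<psi>A[symmetric] Y_def by blast
    moreover have "quotient_topology (minkowski_space R) \<Gamma> closure_of (coset_proj (minkowski_space R) \<Gamma> ` \<psi>l `
        Y)
         = carrier (quotient_group (minkowski_space R) \<Gamma>) \<longleftrightarrow>
        (\<forall>v\<in>minkowski_space R. \<forall>\<eta>>0. \<exists>y\<in>\<psi>l ` Y. \<exists>\<gamma>\<in>\<Gamma>. norm (y + \<gamma> - v) < \<eta>)"
      using mink by (intro X.dense_in_quotient_iff) blast
    moreover have "\<dots> \<longleftrightarrow> (\<forall>w. \<forall>\<eta>>0. \<exists>y\<in>Y. \<exists>\<gamma>\<in>int_lattice. norm (\<psi>l (y + \<gamma> - w)) < \<eta>)"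
      unfolding range_\<psi>l[symmetric] lift_lattice[symmetric]
      by (simp add: linear_add[OF lift_linear] linear_diff[OF lift_linear])
    moreover have "\<dots> \<longleftrightarrow> (\<forall>w. \<forall>\<eta>>0. \<exists>y\<in>Y. \<exists>\<gamma>\<in>int_lattice. norm (y + \<gamma> - w) < \<eta>)"
    proof (intro iffI allI impI)
      fix w and \<eta> :: real assume d: "\<forall>w. \<forall>\<eta>>0. \<exists>y\<in>Y. \<exists>\<gamma>\<in>int_lattice. norm (\<psi>l (y + \<gamma> - w)) < \<eta>" and \<eta>: "\<eta> > 0"
      have "b * \<eta> > 0" using b(1) \<eta> by simp
      then obtain y \<gamma> where y: "y \<in> Y" "\<gamma> \<in> int_lattice" "norm (\<psi>l (y + \<gamma> - w)) < b * \<eta>" using d by blast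
      have "b * norm (y + \<gamma> - w) < b * \<eta>" using b(2)[of "y + \<gamma> - w"] y(3) by linarith
      then have "norm (y + \<gamma> - w) < \<eta>" using b(1) by simp
      then show "\<exists>y\<in>Y. \<exists>\<gamma>\<in>int_lattice. norm (y + \<gamma> - w) < \<eta>" using y by blast
    next
      fix w and \<eta> :: real assume d: "\<forall>w. \<forall>\<eta>>0. \<exists>y\<in>Y. \<exists>\<gamma>\<in>int_lattice. norm (y + \<gamma> - w) < \<eta>" and \<eta>: "\<eta> > 0"
      have "\<eta> / B > 0" using B(1) \<eta> by simp
      then obtain y \<gamma> where y: "y \<in> Y" "\<gamma> \<in> int_lattice" "norm (y + \<gamma> - w) < \<eta> / B" using d by blast
      have "B * norm (y + \<gamma> - w) < \<eta>" using y(3) B(1) by (simp add: less_divide_eq mult.commute)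
      then have "norm (\<psi>l (y + \<gamma> - w)) < \<eta>" using B(2)[of "y + \<gamma> - w"] by linarith
      then show "\<exists>y\<in>Y. \<exists>\<gamma>\<in>int_lattice. norm (\<psi>l (y + \<gamma> - w)) < \<eta>" using y by blast
    qed
    moreover have "\<dots> \<longleftrightarrow> x \<notin> F.translated_torsion" unfolding key[OF \<epsilon>, symmetric] Y_def by blast
    moreover have "translated_torsion_point (minkowski_space R) \<Gamma> (coordinate_subspace R (lyapunov_closure \<sigma> \<zeta>
        S))
        (coset_proj (minkowski_space R) \<Gamma> (\<psi>l x)) \<longleftrightarrow> x \<in> F.translated_torsion"
    proof
      assume "translated_torsion_point (minkowski_space R) \<Gamma> (coordinate_subspace R (lyapunov_closure \<sigma> \<zeta> S))
        (coset_proj (minkowski_space R) \<Gamma> (\<psi>l x))"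
      then obtain x0 v where x0: "torsion_point (quotient_group (minkowski_space R) \<Gamma>) x0"
        "v \<in> coordinate_subspace R (lyapunov_closure \<sigma> \<zeta> S)"
        "coset_proj (minkowski_space R) \<Gamma> (\<psi>l x) = x0 \<otimes>\<^bsub>quotient_group (minkowski_space R) \<Gamma>\<^esub> coset_proj
            (minkowski_space R) \<Gamma> v"
        unfolding translated_torsion_point_def by blast
      from x0(1) have "x0 \<in> coset_proj (minkowski_space R) \<Gamma> ` range \<psi>l"
        unfolding torsion_point_def X.carrier_quotient range_\<psi>l by blast
      then obtain p where p: "x0 = coset_proj (minkowski_space R) \<Gamma> (\<psi>l p)" by blast
      have "v \<in> range \<psi>l" using x0(2) unfolding range_\<psi>l coordinate_subspace_def by blast
      then obtain u where u: "v = \<psi>l u" by blast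
      have "u \<in> F.V" using x0(2) V u by simp
      from x0(1) obtain n :: nat where n: "n > 0" "real n *\<^sub>R \<psi>l p \<in> \<Gamma>" unfolding p
        using X.torsion_point_iff[OF mink] by blast
      have np: "real n *\<^sub>R p \<in> int_lattice" using n(2) \<psi>l_\<Gamma>[of "real n *\<^sub>R p"]
        by (simp add: linear_scale[OF lift_linear])
      have "\<psi>l x - (\<psi>l p + \<psi>l u) \<in> \<Gamma>"
        using x0(3) unfolding p u X.coset_proj_mult[OF mink mink] X.coset_proj_eq_iff .
      then have "x - (p + u) \<in> int_lattice"
        using \<psi>l_\<Gamma>[of "x - (p + u)"] by (simp add: linear_add[OF lift_linear] linear_diff[OF lift_linear])
      then have "- (x - (p + u)) \<in> int_lattice" by (rule int_lattice_minus)
      moreover have "x + - (x - (p + u)) \<in> F.translated_torsion"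
        unfolding F.translated_torsion_iff using n(1) np \<open>u \<in> F.V\<close> by (intro exI[of _ p] exI[of _ u]) auto
      ultimately show "x \<in> F.translated_torsion" by (rule F.translated_torsion_add_lattice)
    next
      assume "x \<in> F.translated_torsion"
      then obtain p u and n :: nat where p: "n > 0" "real n *\<^sub>R p \<in> int_lattice" "u \<in> F.V" "x = p + u"
        unfolding F.translated_torsion_iff by blast
      have "torsion_point (quotient_group (minkowski_space R) \<Gamma>) (coset_proj (minkowski_space R) \<Gamma> (\<psi>l p))"
        unfolding X.torsion_point_iff[OF mink] using p(1,2) \<psi>l_\<Gamma>[of "real n *\<^sub>R p"]
        by (intro exI[of _ n]) (simp add: linear_scale[OF lift_linear])
      moreover have "\<psi>l u \<in> coordinate_subspace R (lyapunov_closure \<sigma> \<zeta> S)" using p(3) V by simp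
      moreover have "coset_proj (minkowski_space R) \<Gamma> (\<psi>l x) = coset_proj (minkowski_space R) \<Gamma> (\<psi>l p)
          \<otimes>\<^bsub>quotient_group (minkowski_space R) \<Gamma>\<^esub> coset_proj (minkowski_space R) \<Gamma> (\<psi>l u)"
        by (simp add: X.coset_proj_mult[OF mink mink] p(4) linear_add[OF lift_linear])
      ultimately show "translated_torsion_point (minkowski_space R) \<Gamma> (coordinate_subspace R (lyapunov_closure \<sigma>
          \<zeta> S))
        (coset_proj (minkowski_space R) \<Gamma> (\<psi>l x))" unfolding translated_torsion_point_def by blast
    qed
    ultimately show ?thesis by simp
  qed
  have T: "torus_topology closure_of {torus_act (\<alpha> n) (torus_proj x) | n. \<forall>i\<in>S. \<bar>lyapunov \<sigma> \<zeta> i n\<bar> < \<epsilon>}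
      = carrier torus
           \<longleftrightarrow> \<not> (\<exists>y0 v. rational_point y0 \<and> v \<in> \<psi>l -` coordinate_subspace R (lyapunov_closure \<sigma> \<zeta> S) \<and>
                   torus_proj x = y0 \<otimes>\<^bsub>torus\<^esub> torus_proj v)" if \<epsilon>: "\<epsilon> > 0" for x \<epsilon>
  proof -
    define Y where "Y = {A n *v x | n. \<forall>i\<in>S. \<bar>lyapunov \<sigma> \<zeta> i n\<bar> < \<epsilon>}"
    have "{torus_act (\<alpha> n) (torus_proj x) | n. \<forall>i\<in>S. \<bar>lyapunov \<sigma> \<zeta> i n\<bar> < \<epsilon>} = torus_proj ` Y"
      unfolding torus_act_torus_proj[OF \<alpha>(1)] Y_def A_def by blast
    moreover have "torus_topology closure_of (torus_proj ` Y) = carrier torus \<longleftrightarrow>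
        (\<forall>w\<in>UNIV. \<forall>\<eta>>0. \<exists>y\<in>Y. \<exists>\<gamma>\<in>int_lattice. norm (y + \<gamma> - w) < \<eta>)"
      by (rule torus.dense_in_quotient_iff) simp
    moreover have "\<dots> \<longleftrightarrow> x \<notin> F.translated_torsion" unfolding key[OF \<epsilon>, symmetric] Y_def by blast
    moreover have "(\<exists>y0 v. rational_point y0 \<and> v \<in> \<psi>l -` coordinate_subspace R (lyapunov_closure \<sigma> \<zeta> S) \<and>
                   torus_proj x = y0 \<otimes>\<^bsub>torus\<^esub> torus_proj v) \<longleftrightarrow> x \<in> F.translated_torsion"
    proof
      assume "\<exists>y0 v. rational_point y0 \<and> v \<in> \<psi>l -` coordinate_subspace R (lyapunov_closure \<sigma> \<zeta> S) \<and>
                   torus_proj x = y0 \<otimes>\<^bsub>torus\<^esub> torus_proj v"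
      then obtain p v where p: "\<forall>j. p $ j \<in> \<rat>" "v \<in> F.V" "torus_proj x = torus_proj p \<otimes>\<^bsub>torus\<^esub> torus_proj v"
        unfolding rational_point_def using V by blast
      have "x - (p + v) \<in> int_lattice" using p(3) by (simp add: torus.coset_proj_mult torus.coset_proj_eq_iff)
      then have "- (x - (p + v)) \<in> int_lattice" by (rule int_lattice_minus)
      moreover have "x + - (x - (p + v)) \<in> F.translated_torsion"
        unfolding F.translated_torsion_def using p(1,2) by auto
      ultimately show "x \<in> F.translated_torsion" by (rule F.translated_torsion_add_lattice)
    next
      assume "x \<in> F.translated_torsion"
      then obtain p v where p: "\<forall>j. p $ j \<in> \<rat>" "v \<in> F.V" "x = p + v" unfolding F.translated_torsion_def by blast
      then have "rational_point (torus_proj p) \<and> v \<in> \<psi>l -` coordinate_subspace R (lyapunov_closure \<sigma> \<zeta> S) \<and>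
                   torus_proj x = torus_proj p \<otimes>\<^bsub>torus\<^esub> torus_proj v"
        using V by (auto simp: rational_point_def torus.coset_proj_mult)
      then show "\<exists>y0 v. rational_point y0 \<and> v \<in> \<psi>l -` coordinate_subspace R (lyapunov_closure \<sigma> \<zeta> S) \<and>
                   torus_proj x = y0 \<otimes>\<^bsub>torus\<^esub> torus_proj v" by blast
    qed
    ultimately show ?thesis by simp
  qed
  show ?thesis
  proof (intro conjI allI impI ballI)
    fix \<epsilon> :: real and x assume \<epsilon>: "\<epsilon> > 0" and "x \<in> carrier (quotient_group (minkowski_space R) \<Gamma>)"
    then have "x \<in> coset_proj (minkowski_space R) \<Gamma> ` range \<psi>l" by (simp add: X.carrier_quotient range_\<psi>l)
    then obtain x' where "x = coset_proj (minkowski_space R) \<Gamma> (\<psi>l x')" by blast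
    then show "quotient_topology (minkowski_space R) \<Gamma> closure_of
             {field_act \<sigma> (\<zeta> n) ` x | n. \<forall>i\<in>S. \<bar>lyapunov \<sigma> \<zeta> i n\<bar> < \<epsilon>}
             = carrier (quotient_group (minkowski_space R) \<Gamma>)
           \<longleftrightarrow> \<not> translated_torsion_point (minkowski_space R) \<Gamma>
                  (coordinate_subspace R (lyapunov_closure \<sigma> \<zeta> S)) x" using X[OF \<epsilon>] by simp
  next
    fix \<epsilon> :: real and y :: "(real^'d) set" assume \<epsilon>: "\<epsilon> > 0" and "y \<in> carrier torus"
    then obtain x where "y = torus_proj x" unfolding torus.carrier_quotient by blast
    then show "torus_topology closure_of {torus_act (\<alpha> n) y | n. \<forall>i\<in>S. \<bar>lyapunov \<sigma> \<zeta> i n\<bar> < \<epsilon>} = carrier torus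
           \<longleftrightarrow> \<not> (\<exists>y0 v. rational_point y0 \<and> v \<in> \<psi>l -` coordinate_subspace R (lyapunov_closure \<sigma> \<zeta> S) \<and>
                   y = y0 \<otimes>\<^bsub>torus\<^esub> torus_proj v)" using T[OF \<epsilon>] by simp
  qed
qed

end
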